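(* Let $n\geq 3$ and let $p$ be a prime. Then any finite index subgroup of $\mathrm{SL}_n(\mathbf{Z})$ or of $\mathrm{SL}_n(\mathbf{Z}[1/p])$ has the strong property $\mathrm{FA}_{n-2}$.
   Context: All actions on metric spaces are by isometries. A group $\Gamma$ has the strong property $\mathrm{FA}_m$ if every isometric $\Gamma$-action on a complete $\mathrm{CAT}(0)$ space $X$ satisfying the following two properties has a global fixed point: (i) ($m$-dimensionality) the reduced singular homology $\widetilde{H}_m(Y)$ vanishes for all open subsets $Y\subseteq X$; (ii) (semisimplicity) the action is semisimple, i.e. for each $g\in\Gamma$ the translation length $\tau(g)=\inf_{x\in X}d(x,gx)$ is attained at some $x\in X$. *)

theory Defs
  imports
    "HOL-Analysis.Analysis"
    "HOL-Homology.Brouwer_Degree"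
    "HOL-Algebra.Group_Action"
    "Jordan_Normal_Form.Determinant"
begin

section \<open>CAT(0) spaces\<close>

definition geodesic_path :: "'x metric \<Rightarrow> 'x \<Rightarrow> 'x \<Rightarrow> (real \<Rightarrow> 'x) \<Rightarrow> bool" where
  "geodesic_path X x y c \<longleftrightarrow>
     c \<in> {0..mdist X x y} \<rightarrow> mspace X \<and> c 0 = x \<and> c (mdist X x y) = y \<and>
     (\<forall>s\<in>{0..mdist X x y}. \<forall>t\<in>{0..mdist X x y}. mdist X (c s) (c t) = \<bar>s - t\<bar>)"

definition geodesic_segment :: "'x metric \<Rightarrow> 'x \<Rightarrow> 'x \<Rightarrow> 'x set \<Rightarrow> bool" where
  "geodesic_segment X x y S \<longleftrightarrow> (\<exists>c. geodesic_path X x y c \<and> S = c ` {0..mdist X x y})"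

definition geodesic_space :: "'x metric \<Rightarrow> bool" where
  "geodesic_space X \<longleftrightarrow> (\<forall>x\<in>mspace X. \<forall>y\<in>mspace X. \<exists>S. geodesic_segment X x y S)"

definition geodesic_triangle ::
  "'x metric \<Rightarrow> 'x \<Rightarrow> 'x \<Rightarrow> 'x \<Rightarrow> 'x set \<Rightarrow> 'x set \<Rightarrow> 'x set \<Rightarrow> bool" where
  "geodesic_triangle X p q r A B C \<longleftrightarrow>
     p \<in> mspace X \<and> q \<in> mspace X \<and> r \<in> mspace X \<and>
     geodesic_segment X p q A \<and> geodesic_segment X q r B \<and> geodesic_segment X r p C"

definition comparison_triangle ::
  "'x metric \<Rightarrow> 'x \<Rightarrow> 'x \<Rightarrow> 'x \<Rightarrow> real^2 \<Rightarrow> real^2 \<Rightarrow> real^2 \<Rightarrow> bool" where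
  "comparison_triangle X p q r p' q' r' \<longleftrightarrow>
     dist p' q' = mdist X p q \<and> dist q' r' = mdist X q r \<and> dist r' p' = mdist X r p"

text \<open>The pairs of a point on the side \<open>S\<close> from \<open>p\<close> to \<open>q\<close> and its comparison point on the
  Euclidean segment from \<open>p'\<close> to \<open>q'\<close>.\<close>

definition comparison_points ::
  "'x metric \<Rightarrow> 'x \<Rightarrow> 'x set \<Rightarrow> real^2 \<Rightarrow> real^2 \<Rightarrow> ('x \<times> (real^2)) set" where
  "comparison_points X p S p' q' =
     {(x, x'). x \<in> S \<and> x' \<in> closed_segment p' q' \<and> dist p' x' = mdist X p x}"

definition CAT0_space :: "'x metric \<Rightarrow> bool" where
  "CAT0_space X \<longleftrightarrow> geodesic_space X \<and>
     (\<forall>p q r A B C p' q' r'.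
        geodesic_triangle X p q r A B C \<and> comparison_triangle X p q r p' q' r' \<longrightarrow>
        (let P = comparison_points X p A p' q' \<union> comparison_points X q B q' r' \<union>
                 comparison_points X r C r' p'
         in \<forall>(x, x')\<in>P. \<forall>(y, y')\<in>P. mdist X x y \<le> dist x' y'))"

section \<open>The strong property FA\<close>

definition isometric_action :: "('g, 'b) monoid_scheme \<Rightarrow> 'x metric \<Rightarrow> ('g \<Rightarrow> 'x \<Rightarrow> 'x) \<Rightarrow> bool" where
  "isometric_action \<Gamma> X \<phi> \<longleftrightarrow> group_action \<Gamma> (mspace X) \<phi> \<and>
     (\<forall>g\<in>carrier \<Gamma>. \<forall>x\<in>mspace X. \<forall>y\<in>mspace X. mdist X (\<phi> g x) (\<phi> g y) = mdist X x y)"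

definition translation_length :: "'x metric \<Rightarrow> ('x \<Rightarrow> 'x) \<Rightarrow> real" where
  "translation_length X f = (INF x\<in>mspace X. mdist X x (f x))"

text \<open>An action on the empty space is not semisimple, so \<open>strong_FA\<close> below only concerns
  nonempty spaces.\<close>

definition semisimple_action :: "('g, 'b) monoid_scheme \<Rightarrow> 'x metric \<Rightarrow> ('g \<Rightarrow> 'x \<Rightarrow> 'x) \<Rightarrow> bool" where
  "semisimple_action \<Gamma> X \<phi> \<longleftrightarrow>
     (\<forall>g\<in>carrier \<Gamma>. \<exists>x\<in>mspace X. mdist X x (\<phi> g x) = translation_length X (\<phi> g))"

definition m_dimensional :: "nat \<Rightarrow> 'x metric \<Rightarrow> bool" where
  "m_dimensional m X \<longleftrightarrow>
     (\<forall>Y. openin (mtopology_of X) Y \<longrightarrow>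
        trivial_group (reduced_homology_group (int m) (subtopology (mtopology_of X) Y)))"

text \<open>HOL cannot quantify over all types inside a formula, so the type of the points of the spaces
  is a parameter. The strong property FA of \<open>\<Gamma>\<close> in degree \<open>m\<close> is \<open>strong_FA TYPE('x) m \<Gamma>\<close> for
  an arbitrary type variable \<open>'x\<close>.\<close>

definition strong_FA :: "'x itself \<Rightarrow> nat \<Rightarrow> ('g, 'b) monoid_scheme \<Rightarrow> bool" where
  "strong_FA TYPE('x) m \<Gamma> \<longleftrightarrow>
     (\<forall>(X :: 'x metric) \<phi>.
        mcomplete_of X \<and> CAT0_space X \<and> isometric_action \<Gamma> X \<phi> \<and>
        m_dimensional m X \<and> semisimple_action \<Gamma> X \<phi> \<longrightarrow>
        (\<exists>x\<in>mspace X. \<forall>g\<in>carrier \<Gamma>. \<phi> g x = x))"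

section \<open>Special linear groups\<close>

text \<open>The ring of entries is given as a subring \<open>R\<close> of the ambient ring \<open>'a\<close>.\<close>

definition SL :: "nat \<Rightarrow> 'a::comm_ring_1 set \<Rightarrow> 'a mat monoid" where
  "SL n R = \<lparr>carrier = {A \<in> carrier_mat n n. elements_mat A \<subseteq> R \<and> Determinant.det A = 1},
             mult = (*), one = 1\<^sub>m n\<rparr>"

definition Z_inverse :: "nat \<Rightarrow> rat set" where
  "Z_inverse p = {of_int a / of_nat p ^ k | a k. True}"

definition finite_index_subgroup :: "'g set \<Rightarrow> ('g, 'b) monoid_scheme \<Rightarrow> bool" where
  "finite_index_subgroup H G \<longleftrightarrow> subgroup H G \<and> finite (rcosets\<^bsub>G\<^esub> H)"

end

theory Submission
  imports Defs "HOL-Number_Theory.Cong"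
begin

text \<open>Let \<open>R\<close> be \<open>\<int>\<close> or \<open>\<int>[1/p]\<close>, let \<open>H\<close> be a subgroup of finite index in \<open>SL n R\<close> that acts on the
complete CAT(0) space \<open>X\<close>, and write \<open>e i j a\<close> for the elementary matrix with entry \<open>a\<close> at \<open>(i, j)\<close>
(\<open>elmat n i j a\<close> below).

Elementary matrices are elliptic. Some \<open>N > 0\<close> prime to \<open>p\<close> has \<open>e i j (N r) \<in> H\<close> for all \<open>r \<in> R\<close>.
For \<open>z = e i j (N^2 r)\<close> the power with exponent \<open>s^2\<close> is the commutator of the \<open>s\<close>-th powers of
\<open>e i k (N r)\<close> and \<open>e k j N\<close>, so it moves a given point by at most a constant times \<open>s\<close>. In a CAT(0)
space the least displacement at least doubles when an isometry is squared
(\<open>displacement_doubles\<close>), so the translation length of \<open>z\<close> is \<open>0\<close>, and semisimplicity gives a fixed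
point (\<open>elementary_elliptic\<close>).

A common fixed point of finitely many of them. Replace \<open>N\<close> by its square and arrange the matrices
\<open>e i (i+1) (c i)\<close>, indices modulo \<open>n\<close>, in a cycle. Leave one out. The indices are then linearly
ordered so that the others are upper unitriangular, and a common fixed point is found one central
extension at a time (\<open>chain_fixed_point\<close>). The \<open>n\<close> fixed point sets are closed and convex, any \<open>n - 1\<close>
of them meet, and hence all of them meet (\<open>helly\<close>): otherwise suitable open convex
neighbourhoods would have as nerve the boundary of an \<open>(n-1)\<close>-simplex, and their union would have the
homology of a sphere of dimension \<open>n - 2\<close> (\<open>nontrivial_homology_nerve\<close>).

From finitely many matrices to a finite orbit. Take \<open>c i = N\<close> except for one \<open>i\<close>, where
\<open>c i = N / p\<close>, and let \<open>M\<close> be the stabiliser in \<open>H\<close> of a common fixed point. Commutators show that \<open>M\<close>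
contains \<open>e i j (N^n r)\<close> for all \<open>r \<in> R\<close>; the denominators come from the factor \<open>1 / p\<close>
(\<open>cyclic_elementary_generate\<close>). With \<open>q = N^(2n)\<close>, Suslin's factorisation of transvections shows that \<open>M\<close>
contains every conjugate of \<open>e i j (q r)\<close> in \<open>SL n R\<close> (\<open>conj_elmat_mem\<close>). These conjugates generate
a normal subgroup \<open>L\<close> of finite index: modulo \<open>L\<close> the congruence subgroup of level \<open>q\<close> is central
(\<open>congruence_subgroup_central\<close>), so the elementary matrices have only finitely many conjugates modulo \<open>L\<close>,
all of order dividing \<open>q\<close>; they generate, and Dietzmann's lemma makes the quotient finite
(\<open>finite_quotient\<close>). So the fixed point of \<open>M\<close> has a finite \<open>H\<close>-orbit, and the point that minimises the sum
of the squared distances to this orbit is fixed by \<open>H\<close>.\<close>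

section \<open>Homology of unions of open sets\<close>

text \<open>All reduced homology groups of the empty space vanish here, so the empty set counts as acyclic.\<close>

definition acyclic_in :: "'a topology \<Rightarrow> 'a set \<Rightarrow> bool" where
  "acyclic_in X S \<longleftrightarrow> (\<forall>p. trivial_group (reduced_homology_group p (subtopology X S)))"

lemma excision_open_union:
  assumes "openin X A" "openin X B" "A \<union> B = topspace X"
  shows "relative_homology_group p (subtopology X A) (A \<inter> B) \<cong> relative_homology_group p X B"
proof -
  have A: "A \<subseteq> topspace X" and B: "B \<subseteq> topspace X"
    using assms openin_subset by auto
  have cl: "X closure_of (topspace X - A) = topspace X - A"
    using assms(1) by (intro closure_of_closedin) auto
  have "X closure_of (topspace X - A) \<subseteq> X interior_of B"
    unfolding cl interior_of_openin[OF assms(2)] using assms(3) by auto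
  from homology_excision_axiom[OF this B, of p]
  have "relative_homology_group p (subtopology X (topspace X - (topspace X - A))) (B - (topspace X - A))
        \<cong> relative_homology_group p X B"
    by (auto simp: is_iso_def)
  moreover have "topspace X - (topspace X - A) = A" "B - (topspace X - A) = A \<inter> B"
    using A B by auto
  ultimately show ?thesis by simp
qed

text \<open>In this lemma and the next, acyclicity takes the place of contractibility, because the unions of convex sets
to which they are applied are only known to be acyclic.\<close>

lemma reduced_homology_iso_relative:
  assumes "acyclic_in X S" "topspace X \<inter> S \<noteq> {}"
  shows "reduced_homology_group p X \<cong> relative_homology_group p X S"
proof -
  have "hom_induced p X {} X S id \<in> iso (reduced_homology_group p X) (relative_homology_group p X S)"
    using very_short_exact_sequence
    [of "reduced_homology_group (p - 1) (subtopology X S)"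
        "relative_homology_group p X S"
        "reduced_homology_group p X"
        "reduced_homology_group p (subtopology X S)"
        "hom_boundary p X S"
        "hom_induced p X {} X S id"
        "hom_induced p (subtopology X S) {} X {} id"] assms(1)
    by (meson exact_seq_cons_iff homology_exactness_reduced_1[OF assms(2)] homology_exactness_reduced_3 acyclic_in_def)
  then show ?thesis by (rule is_isoI)
qed

lemma relative_homology_iso_reduced:
  assumes "\<And>p. trivial_group (reduced_homology_group p X)" "topspace X \<inter> S \<noteq> {}"
  shows "relative_homology_group p X S \<cong> reduced_homology_group (p - 1) (subtopology X S)"
proof -
  have "hom_boundary p X S
      \<in> iso (relative_homology_group p X S) (reduced_homology_group(p - 1) (subtopology X S))"
  using very_short_exact_sequence
    [of "reduced_homology_group (p - 1) X"
        "reduced_homology_group (p - 1) (subtopology X S)"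
        "relative_homology_group p X S"
        "reduced_homology_group p X"
        "hom_induced (p - 1) (subtopology X S) {} X {} id"
        "hom_boundary p X S"
        "hom_induced p X {} X S id"] assms(1)
  by (meson exact_seq_cons_iff homology_exactness_reduced_1[OF assms(2)] homology_exactness_reduced_2)
  then show ?thesis by (rule is_isoI)
qed

lemma reduced_homology_union_acyclic_aux:
  assumes "openin X A" "openin X B" "acyclic_in X A" "acyclic_in X B" "B \<noteq> {}"
  shows "relative_homology_group p (subtopology X A) (A \<inter> B) 
          \<cong> reduced_homology_group p (subtopology X (A \<union> B))"
proof -
  let ?Y = "subtopology X (A \<union> B)"
  have AB: "A \<subseteq> topspace X" "B \<subseteq> topspace X"
    using assms openin_subset by auto
  have s: "subtopology ?Y A = subtopology X A" "subtopology ?Y B = subtopology X B"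
    by (simp_all add: subtopology_subtopology Int_absorb1 Int_absorb2)
  have o: "openin ?Y A" "openin ?Y B" "A \<union> B = topspace ?Y"
    using assms(1,2) AB by (auto simp: openin_subtopology_alt)
  have "relative_homology_group p (subtopology ?Y A) (A \<inter> B) \<cong> relative_homology_group p ?Y B"
    by (rule excision_open_union) (use o in auto)
  moreover have "reduced_homology_group p ?Y \<cong> relative_homology_group p ?Y B"
    by (rule reduced_homology_iso_relative) (use assms AB s in \<open>auto simp: acyclic_in_def\<close>)
  ultimately show ?thesis unfolding s
    by (meson group.iso_sym group_reduced_homology_group iso_trans)
qed

text \<open>The boundary map of the Mayer-Vietoris sequence is an isomorphism here. Excision replaces that sequence:
the pair \<open>(A \<union> B, B)\<close> has the same relative homology as \<open>(A, A \<inter> B)\<close>, and the long exact sequences of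
both pairs collapse because \<open>B\<close> and \<open>A\<close> are acyclic.\<close>

lemma reduced_homology_union_acyclic:
  assumes "openin X A" "openin X B" "acyclic_in X A" "acyclic_in X B" "A \<inter> B \<noteq> {}"
  shows "reduced_homology_group p (subtopology X (A \<union> B))
          \<cong> reduced_homology_group (p - 1) (subtopology X (A \<inter> B))"
proof -
  have AB: "A \<subseteq> topspace X" "B \<subseteq> topspace X"
    using assms openin_subset by auto
  have "relative_homology_group p (subtopology X A) (A \<inter> B) 
          \<cong> reduced_homology_group (p - 1) (subtopology (subtopology X A) (A \<inter> B))"
    by (rule relative_homology_iso_reduced) (use assms AB in \<open>auto simp: acyclic_in_def\<close>)
  moreover have "subtopology (subtopology X A) (A \<inter> B) = subtopology X (A \<inter> B)"
    by (simp add: subtopology_subtopology)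
  moreover have "relative_homology_group p (subtopology X A) (A \<inter> B) 
          \<cong> reduced_homology_group p (subtopology X (A \<union> B))"
    by (rule reduced_homology_union_acyclic_aux) (use assms in auto)
  ultimately show ?thesis
    by (metis (no_types, lifting) group.iso_sym group_relative_homology_group iso_trans)
qed

lemma trivial_imp_isomorphic:
  "trivial_group G \<Longrightarrow> trivial_group H \<Longrightarrow> G \<cong> H"
proof -
  assume "trivial_group G" "trivial_group H"
  then have g: "carrier G = {\<one>\<^bsub>G\<^esub>}" "carrier H = {\<one>\<^bsub>H\<^esub>}" "group G" "group H"
    by (auto simp: trivial_group_def)
  then have "(\<lambda>x. \<one>\<^bsub>H\<^esub>) \<in> iso G H"
    by (auto simp: iso_def hom_def bij_betw_def intro: group.is_monoid)
       (metis group.is_monoid monoid.l_one monoid.one_closed)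
  then show "G \<cong> H" by (rule is_isoI)
qed

lemma nontrivial_homology_group_0:
  assumes "topspace X \<noteq> {}"
  shows "\<not> trivial_group (homology_group 0 X)"
proof
  assume "trivial_group (homology_group 0 X)"
  moreover have "trivial_group (homology_group 0 (subtopology X {}))"
    by (rule trivial_homology_group_empty) simp
  ultimately have "homology_group 0 X \<cong> homology_group 0 (subtopology X {})"
    by (rule trivial_imp_isomorphic)
  then have "path_components_of X \<approx> path_components_of (subtopology X {})"
    by (rule isomorphic_homology_imp_path_components)
  moreover have "path_components_of (subtopology X {}) = {}"
    by (simp add: path_components_of_eq_empty)
  ultimately show False using assms
    by (simp add: path_components_of_eq_empty)
qed

lemma reduced_homology_disjoint_union_acyclic:
  assumes "openin X A" "openin X B" "acyclic_in X A" "acyclic_in X B" "A \<inter> B = {}" "A \<noteq> {}" "B \<noteq> {}"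
  shows "\<not> trivial_group (reduced_homology_group 0 (subtopology X (A \<union> B)))"
proof -
  have "relative_homology_group 0 (subtopology X A) (A \<inter> B) 
          \<cong> reduced_homology_group 0 (subtopology X (A \<union> B))"
    by (rule reduced_homology_union_acyclic_aux) (use assms in auto)
  moreover have "\<not> trivial_group (homology_group 0 (subtopology X A))"
    by (rule nontrivial_homology_group_0) (use assms openin_subset in fastforce)
  ultimately show ?thesis
    using assms(5) isomorphic_group_triviality
    by (metis group_reduced_homology_group group_relative_homology_group)
qed

text \<open>Split off one set \<open>U k\<close>. The rest of the union is acyclic by induction, and so is its intersection with \<open>U k\<close>,
which is the union of the smaller family \<open>U i \<inter> U k\<close>.\<close>

lemma acyclic_Union:
  assumes "finite I" "I \<noteq> {}" "\<And>i. i \<in> I \<Longrightarrow> openin X (U i)"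
    "\<And>J. J \<subseteq> I \<Longrightarrow> J \<noteq> {} \<Longrightarrow> \<Inter>(U ` J) \<noteq> {} \<and> acyclic_in X (\<Inter>(U ` J))"
  shows "acyclic_in X (\<Union>(U ` I))"
  using assms
proof (induction I arbitrary: U rule: finite_ne_induct)
  case (singleton x)
  then show ?case using singleton(2)[of "{x}"] by auto
next
  case (insert k I)
  let ?A = "\<Union>(U ` I)" and ?B = "U k"
  have A: "acyclic_in X ?A"
  proof (rule insert.IH)
    fix J assume "J \<subseteq> I" "J \<noteq> {}"
    then show "\<Inter>(U ` J) \<noteq> {} \<and> acyclic_in X (\<Inter>(U ` J))"
      using insert.prems(2)[of J] by blast
  qed (use insert.prems in auto)
  have B: "acyclic_in X ?B" using insert.prems(2)[of "{k}"] by auto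
  have AB: "?A \<inter> ?B = \<Union>((\<lambda>i. U i \<inter> U k) ` I)" by auto
  have "acyclic_in X (?A \<inter> ?B)" unfolding AB
  proof (rule insert.IH)
    fix J assume J: "J \<subseteq> I" "J \<noteq> {}"
    have "(\<Inter>((\<lambda>i. U i \<inter> U k) ` J)) = \<Inter>(U ` insert k J)"
      using J by auto
    then show "\<Inter>((\<lambda>i. U i \<inter> U k) ` J) \<noteq> {} \<and> acyclic_in X (\<Inter>((\<lambda>i. U i \<inter> U k) ` J))"
      using insert.prems(2)[of "insert k J"] J by auto
  qed (use insert.prems in auto)
  moreover obtain i where "i \<in> I" using insert.hyps by auto
  then have "?A \<inter> ?B \<noteq> {}" using insert.prems(2)[of "{i,k}"] by auto
  then have "reduced_homology_group p (subtopology X (?A \<union> ?B))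
          \<cong> reduced_homology_group (p - 1) (subtopology X (?A \<inter> ?B))" for p
    by (intro reduced_homology_union_acyclic) (use insert.prems A B in auto)
  ultimately have "acyclic_in X (?A \<union> ?B)"
    unfolding acyclic_in_def
    using isomorphic_group_triviality group_reduced_homology_group by metis
  then show ?case by (simp add: Un_commute)
qed

text \<open>The nerve of the family is the boundary of a simplex of dimension \<open>k + 1\<close>, so that the union has the homology
of a \<open>k\<close>-sphere. Splitting off one set leaves an acyclic union that meets it in a family of the same kind
with one set fewer; this lowers the degree by one. In degree \<open>0\<close> the union is disconnected.\<close>

lemma nontrivial_homology_nerve:
  assumes "finite I" "card I = k + 2" "\<And>i. i \<in> I \<Longrightarrow> openin X (U i)"
    "\<And>J. J \<subset> I \<Longrightarrow> J \<noteq> {} \<Longrightarrow> \<Inter>(U ` J) \<noteq> {} \<and> acyclic_in X (\<Inter>(U ` J))"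
    "\<Inter>(U ` I) = {}"
  shows "\<not> trivial_group (reduced_homology_group (int k) (subtopology X (\<Union>(U ` I))))"
  using assms
proof (induction k arbitrary: I U)
  case 0
  then obtain a b where I: "I = {a,b}" "a \<noteq> b" by (metis add_0 card_2_iff)
  have "{a} \<subset> I" "{b} \<subset> I" using I by auto
  with 0(4)[of "{a}"] 0(4)[of "{b}"] have *: "U a \<noteq> {}" "U b \<noteq> {}" "acyclic_in X (U a)" "acyclic_in X (U b)"
    by auto
  have "\<not> trivial_group (reduced_homology_group 0 (subtopology X (U a \<union> U b)))"
    by (rule reduced_homology_disjoint_union_acyclic) (use 0 * I in auto)
  then show ?case using I by simp
next
  case (Suc k)
  obtain l I' where I: "I = insert l I'" "l \<notin> I'" "card I' = k + 2"
    using Suc.prems(2) by (metis add_Suc card_Suc_eq)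
  have fI: "finite I'" "I' \<noteq> {}" using I Suc.prems(1) by auto
  let ?A = "\<Union>(U ` I')" and ?B = "U l"
  have A: "acyclic_in X ?A"
  proof (rule acyclic_Union)
    fix J assume "J \<subseteq> I'" "J \<noteq> {}"
    then show "\<Inter>(U ` J) \<noteq> {} \<and> acyclic_in X (\<Inter>(U ` J))"
      using Suc.prems(4)[of J] I by blast
  qed (use fI Suc.prems I in auto)
  have "{l} \<subset> I" using I fI by auto
  then have B: "acyclic_in X ?B" using Suc.prems(4)[of "{l}"] by auto
  have AB: "?A \<inter> ?B = \<Union>((\<lambda>i. U i \<inter> U l) ` I')" by auto
  have "\<not> trivial_group (reduced_homology_group (int k) (subtopology X (?A \<inter> ?B)))" unfolding AB
  proof (rule Suc.IH)
    fix J assume J: "J \<subset> I'" "J \<noteq> {}"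
    have "(\<Inter>((\<lambda>i. U i \<inter> U l) ` J)) = \<Inter>(U ` insert l J)"
      using J by auto
    moreover have "insert l J \<subset> I" using J I by auto
    ultimately show "\<Inter>((\<lambda>i. U i \<inter> U l) ` J) \<noteq> {} \<and> acyclic_in X (\<Inter>((\<lambda>i. U i \<inter> U l) ` J))"
      using Suc.prems(4)[of "insert l J"] by simp
  next
    show "\<Inter>((\<lambda>i. U i \<inter> U l) ` I') = {}" using Suc.prems(5) I fI by auto
  qed (use fI Suc.prems I in auto)
  moreover 
  obtain i where i: "i \<in> I'" using fI by auto
  have "{i,l} \<subset> I"
  proof -
    have "card {i,l} < card I" using Suc.prems(2) I i by (simp add: card_insert_if)
    then show ?thesis using I i by auto
  qed
  then have "?A \<inter> ?B \<noteq> {}" using Suc.prems(4)[of "{i,l}"] i by auto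
  then have "reduced_homology_group (int (Suc k)) (subtopology X (?A \<union> ?B))
          \<cong> reduced_homology_group (int (Suc k) - 1) (subtopology X (?A \<inter> ?B))"
    by (intro reduced_homology_union_acyclic) (use Suc.prems A B I in auto)
  then have "reduced_homology_group (int (Suc k)) (subtopology X (?A \<union> ?B))
          \<cong> reduced_homology_group (int k) (subtopology X (?A \<inter> ?B))"
    by simp
  ultimately have "\<not> trivial_group (reduced_homology_group (int (Suc k)) (subtopology X (?A \<union> ?B)))"
    using isomorphic_group_triviality group_reduced_homology_group by metis
  then show ?case using I by (simp add: Un_commute)
qed

section \<open>Geometry of CAT(0) spaces\<close>

text \<open>The comparison inequality is used only for a vertex and a point of the opposite side, where Stewart's theorem
makes the Euclidean distance explicit. The function \<open>geo\<close> chooses the point of the side \<open>xy\<close> at the fraction \<open>t\<close>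
from \<open>x\<close>; \<open>geo_unique\<close> shows that there is no choice.\<close>

locale cat0 = Metric_space M d for M :: "'x set" and d +
  fixes geo :: "'x \<Rightarrow> 'x \<Rightarrow> real \<Rightarrow> 'x"
  assumes geo_in: "\<lbrakk>x \<in> M; y \<in> M; 0 \<le> t; t \<le> 1\<rbrakk> \<Longrightarrow> geo x y t \<in> M"
    and geo_cn: "\<lbrakk>x \<in> M; y \<in> M; w \<in> M; 0 \<le> t; t \<le> 1\<rbrakk> \<Longrightarrow>
      (d w (geo x y t))\<^sup>2 \<le> (1 - t) * (d w x)\<^sup>2 + t * (d w y)\<^sup>2 - t * (1 - t) * (d x y)\<^sup>2"
begin

lemma geo_dist:
  assumes "x \<in> M" "y \<in> M" "0 \<le> t" "t \<le> 1"
  shows "d x (geo x y t) = t * d x y" "d (geo x y t) y = (1 - t) * d x y"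
proof -
  have "(d x (geo x y t))\<^sup>2 \<le> (t * d x y)\<^sup>2"
    using geo_cn[of x y x t] assms by (simp add: power2_eq_square algebra_simps)
  then have 1: "d x (geo x y t) \<le> t * d x y"
    by (rule power2_le_imp_le) (use assms in simp)
  have "(d y (geo x y t))\<^sup>2 \<le> ((1 - t) * d x y)\<^sup>2"
    using geo_cn[of x y y t] assms by (simp add: power2_eq_square algebra_simps commute)
  then have 2: "d y (geo x y t) \<le> (1 - t) * d x y"
    by (rule power2_le_imp_le) (use assms in simp)
  have "d x y \<le> d x (geo x y t) + d (geo x y t) y"
    using assms geo_in by (intro triangle) auto
  with 1 2 show "d x (geo x y t) = t * d x y" "d (geo x y t) y = (1 - t) * d x y"
    by (auto simp: commute algebra_simps)
qed

lemma geo_unique: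
  assumes "x \<in> M" "y \<in> M" "z \<in> M" "0 \<le> t" "t \<le> 1" "d x z = t * d x y" "d z y = (1 - t) * d x y"
  shows "z = geo x y t"
proof -
  have "(d z (geo x y t))\<^sup>2 \<le> (1 - t) * (d z x)\<^sup>2 + t * (d z y)\<^sup>2 - t * (1 - t) * (d x y)\<^sup>2"
    using assms by (intro geo_cn) auto
  also have "\<dots> = 0" unfolding commute[of z x] assms(6,7) by (simp add: power2_eq_square algebra_simps)
  finally show ?thesis using assms geo_in[of x y t] by simp
qed

lemma geo_sym:
  assumes "x \<in> M" "y \<in> M" "0 \<le> t" "t \<le> 1"
  shows "geo x y t = geo y x (1 - t)"
proof (rule geo_unique)
  show "d y (geo x y t) = (1 - t) * d y x"
    using geo_dist(2)[OF assms] unfolding commute[of y] by (simp only: commute)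
  show "d (geo x y t) x = (1 - (1 - t)) * d y x"
    using geo_dist(1)[OF assms] by (simp add: commute)
qed (use assms geo_in in auto)

text \<open>The comparison inequality for \<open>geo z y t\<close> and the side \<open>zx\<close>, followed by the one for \<open>x\<close> and the side \<open>zy\<close>:
the terms that do not involve \<open>d x y\<close> cancel.\<close>

lemma geo_same_start:
  assumes "x \<in> M" "y \<in> M" "z \<in> M" "0 \<le> t" "t \<le> 1"
  shows "d (geo z x t) (geo z y t) \<le> t * d x y"
proof -
  let ?b = "geo z y t"
  have b: "?b \<in> M" using assms geo_in by auto
  have "(d ?b (geo z x t))\<^sup>2 \<le> (1 - t) * (d ?b z)\<^sup>2 + t * (d ?b x)\<^sup>2 - t * (1 - t) * (d z x)\<^sup>2"
    using assms b by (intro geo_cn) auto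
  also have "(d ?b x)\<^sup>2 \<le> (1 - t) * (d x z)\<^sup>2 + t * (d x y)\<^sup>2 - t * (1 - t) * (d z y)\<^sup>2"
    unfolding commute[of ?b x] using assms by (intro geo_cn) auto
  finally have "(d ?b (geo z x t))\<^sup>2 \<le> (1 - t) * (d ?b z)\<^sup>2
      + t * ((1 - t) * (d x z)\<^sup>2 + t * (d x y)\<^sup>2 - t * (1 - t) * (d z y)\<^sup>2) - t * (1 - t) * (d z x)\<^sup>2"
    using assms by (simp add: mult_left_mono)
  also have "\<dots> = (t * d x y)\<^sup>2"
    using geo_dist(1)[of z y t] assms
    by (simp add: commute[of ?b z] commute[of x z] power2_eq_square algebra_simps)
  finally have "d ?b (geo z x t) \<le> t * d x y"
    by (rule power2_le_imp_le) (use assms in simp)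
  then show ?thesis by (simp only: commute[of ?b])
qed

lemma geo_quadrilateral:
  assumes "x \<in> M" "y \<in> M" "x' \<in> M" "y' \<in> M" "0 \<le> t" "t \<le> 1"
  shows "d (geo x y t) (geo x' y' t) \<le> (1 - t) * d x x' + t * d y y'"
proof -
  have "d (geo x y t) (geo x' y' t) \<le> d (geo x y t) (geo x y' t) + d (geo x y' t) (geo x' y' t)"
    using assms geo_in by (intro triangle) auto
  also have "d (geo x y t) (geo x y' t) \<le> t * d y y'"
    using assms by (intro geo_same_start) auto
  also have "d (geo x y' t) (geo x' y' t) \<le> (1 - t) * d x x'"
    using assms geo_same_start[of x x' y' "1 - t"] geo_sym[of x y' t] geo_sym[of x' y' t] by simp
  finally show ?thesis by simp
qed

lemma geo_param:
  assumes "x \<in> M" "y \<in> M" "0 \<le> t" "t \<le> 1" "0 \<le> s" "s \<le> 1"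
  shows "d (geo x y s) (geo x y t) \<le> \<bar>s - t\<bar> * d x y"
proof -
  have "(d (geo x y s) (geo x y t))\<^sup>2 \<le> (1 - t) * (d (geo x y s) x)\<^sup>2 + t * (d (geo x y s) y)\<^sup>2 - t * (1 - t) * (d x y)\<^sup>2"
    using assms geo_in by (intro geo_cn) auto
  also have "\<dots> = (\<bar>s - t\<bar> * d x y)\<^sup>2"
    unfolding commute[of "geo x y s" x] geo_dist[OF assms(1,2,5,6)]
    by (simp add: power_mult_distrib) (simp add: power2_eq_square algebra_simps)
  finally show ?thesis by (rule power2_le_imp_le) simp
qed

definition geo_convex :: "'x set \<Rightarrow> bool" where
  "geo_convex S \<longleftrightarrow> S \<subseteq> M \<and> (\<forall>x\<in>S. \<forall>y\<in>S. \<forall>t. 0 \<le> t \<longrightarrow> t \<le> 1 \<longrightarrow> geo x y t \<in> S)"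

lemma geo_convex_Inter:
  "\<lbrakk>\<And>S. S \<in> A \<Longrightarrow> geo_convex S; A \<noteq> {}\<rbrakk> \<Longrightarrow> geo_convex (\<Inter>A)"
  by (auto simp: geo_convex_def)

lemma geo_convex_M: "geo_convex M"
  by (auto simp: geo_convex_def geo_in)

text \<open>Contract along the geodesics that end in a chosen point of \<open>S\<close>.\<close>

lemma geo_convex_contractible:
  assumes "geo_convex S"
  shows "contractible_space (subtopology mtopology S)"
proof (cases "S = {}")
  case True
  then show ?thesis by (simp add: contractible_space_empty)
next
  case False
  then obtain a where a: "a \<in> S" by auto
  have SM: "S \<subseteq> M" and cl: "\<And>x y t. \<lbrakk>x \<in> S; y \<in> S; 0 \<le> t; t \<le> 1\<rbrakk> \<Longrightarrow> geo x y t \<in> S"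
    using assms by (auto simp: geo_convex_def)
  let ?X = "subtopology mtopology S"
  let ?P = "prod_topology (top_of_set {0..1::real}) ?X"
  let ?h = "\<lambda>(t, x). geo x a t"
  have ts: "topspace ?X = S" using SM by auto
  have "continuous_map ?P mtopology ?h"
    unfolding continuous_map_to_metric
  proof (intro ballI allI impI)
    fix p and e :: real assume p: "p \<in> topspace ?P" and e: "e > 0"
    obtain t x where px: "p = (t, x)" "0 \<le> t" "t \<le> 1" "x \<in> S"
      using p SM by (cases p) auto
    define D where "D = d x a + e + 1"
    have D: "D > 0" using e by (simp add: D_def add_nonneg_pos)
    let ?U = "({0..1} \<inter> ball t (e / 2 / D)) \<times> (S \<inter> mball x (e / 2))"
    have "openin ?P ?U"
      unfolding openin_prod_Times_iff
    proof (intro disjI2 conjI)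
      show "openin (top_of_set {0..1}) ({0..1} \<inter> ball t (e / 2 / D))"
        by (simp add: openin_open_Int)
      show "openin ?X (S \<inter> mball x (e / 2))"
        by (metis openin_mball openin_subtopology_Int2)
    qed
    moreover have "p \<in> ?U" using px e D SM by auto
    moreover have "?h q \<in> mball (?h p) e" if q: "q \<in> ?U" for q
    proof -
      obtain s y where qs: "q = (s, y)" "0 \<le> s" "s \<le> 1" "y \<in> S" "\<bar>t - s\<bar> < e / 2 / D" "d x y < e / 2"
        using q SM by (cases q) (auto simp: dist_real_def)
      have yM: "y \<in> M" "x \<in> M" "a \<in> M" using qs px a SM by auto
      have "d (geo x a t) (geo y a s) \<le> d (geo x a t) (geo x a s) + d (geo x a s) (geo y a s)"
        by (rule triangle) (rule geo_in; fact yM px qs)+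
      also have "d (geo x a t) (geo x a s) \<le> \<bar>t - s\<bar> * d x a"
        by (rule geo_param) (fact yM px qs)+
      also have "\<bar>t - s\<bar> * d x a \<le> \<bar>t - s\<bar> * D"
        by (rule mult_left_mono) (use e D_def in linarith, rule abs_ge_zero)
      also have "\<bar>t - s\<bar> * D < e / 2"
        using qs(5) by (rule pos_less_divide_eq[OF D, THEN iffD1])
      also have "d (geo x a s) (geo y a s) \<le> (1 - s) * d x y + s * d a a"
        by (rule geo_quadrilateral) (fact yM px qs)+
      also have "(1 - s) * d x y + s * d a a \<le> d x y" 
        using yM(3) mult_left_le_one_le[of "d x y" "1 - s"] qs(2,3) by simp
      also have "d x y < e / 2" by (rule qs(6))
      finally have "d (geo x a t) (geo y a s) < e" by simp
      then show ?thesis using px qs yM geo_in by auto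
    qed
    ultimately show "\<exists>U. openin ?P U \<and> p \<in> U \<and> (\<forall>y\<in>U. ?h y \<in> mball (?h p) e)"
      by blast
  qed
  then have cont: "continuous_map ?P ?X ?h"
    unfolding continuous_map_in_subtopology using SM cl a by auto
  have "homotopic_with (\<lambda>x. True) ?X ?X id (\<lambda>x. a)"
  proof (subst homotopic_with, simp, intro exI[of _ ?h] conjI ballI)
    fix x assume "x \<in> topspace ?X"
    then have x: "x \<in> M" "a \<in> M" using a SM ts by auto
    show "?h (0, x) = id x" using geo_dist(1)[of x a 0] x geo_in[of x a 0] by simp
    show "?h (1, x) = a" using geo_dist(2)[of x a 1] x geo_in[of x a 1] by simp
  qed (use cont in auto)
  then show ?thesis unfolding contractible_space_def by blast
qed


text \<open>A singleton \<open>F\<close> gives nearest point projections, a finite orbit its barycentre.\<close>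

definition sqdist :: "'x set \<Rightarrow> 'x \<Rightarrow> real" where
  "sqdist F x = (\<Sum>z\<in>F. (d z x)\<^sup>2)"

lemma sqdist_nonneg: "sqdist F x \<ge> 0"
  by (simp add: sqdist_def sum_nonneg)

lemma sqdist_midpoint:
  assumes "finite F" "F \<noteq> {}" "F \<subseteq> M" "x \<in> M" "y \<in> M"
  shows "sqdist F (geo x y (1/2)) \<le> (sqdist F x + sqdist F y) / 2 - (d x y)\<^sup>2 / 4"
proof -
  have "sqdist F (geo x y (1/2)) \<le> (\<Sum>z\<in>F. ((d z x)\<^sup>2 + (d z y)\<^sup>2) / 2 - (d x y)\<^sup>2 / 4)"
    unfolding sqdist_def
  proof (rule sum_mono)
    fix z assume "z \<in> F"
    then have "z \<in> M" using assms by auto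
    then show "(d z (geo x y (1/2)))\<^sup>2 \<le> ((d z x)\<^sup>2 + (d z y)\<^sup>2) / 2 - (d x y)\<^sup>2 / 4"
      using geo_cn[of x y z "1/2"] assms(4,5) by (simp add: field_simps)
  qed
  also have "\<dots> = (sqdist F x + sqdist F y) / 2 - real (card F) * ((d x y)\<^sup>2 / 4)"
    by (simp add: sqdist_def sum_subtractf sum.distrib flip: sum_divide_distrib)
  finally have "sqdist F (geo x y (1/2)) \<le> (sqdist F x + sqdist F y) / 2 - real (card F) * ((d x y)\<^sup>2 / 4)" .
  moreover have "1 * ((d x y)\<^sup>2 / 4) \<le> real (card F) * ((d x y)\<^sup>2 / 4)"
    using assms(1,2) by (intro mult_right_mono) (simp_all add: Suc_le_eq card_gt_0_iff)
  ultimately show ?thesis by simp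
qed

text \<open>The parallelogram argument: by \<open>sqdist_midpoint\<close> two points with almost minimal value on a convex set
are close to each other. A constant family \<open>V\<close> yields minimisers on closed convex sets; a decreasing one replaces
compactness, since the limit is a limit of points of every \<open>V k\<close>.\<close>

lemma sqdist_almost_minimising_sequence:
  assumes compl: mcomplete
    and F: "finite F" "F \<noteq> {}" "F \<subseteq> M"
    and V: "\<And>k. V k \<noteq> {}" "\<And>k. geo_convex (V k)" "\<And>k l. k \<le> l \<Longrightarrow> V l \<subseteq> V k"
    and B: "\<And>k. \<exists>x\<in>V k. sqdist F x \<le> B"
  shows "\<exists>s x. limitin mtopology s x sequentially \<and>
           (\<forall>k. s k \<in> V k \<and> (\<forall>y\<in>V k. sqdist F (s k) \<le> sqdist F y + inverse (real (Suc k))))"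
proof -
  define r where "r k = (INF x\<in>V k. sqdist F x)" for k
  have bdd: "bdd_below (sqdist F ` V k)" for k
    by (rule bdd_belowI2[of _ 0]) (rule sqdist_nonneg)
  have r_le: "r k \<le> sqdist F x" if "x \<in> V k" for x k
    unfolding r_def by (rule cINF_lower[OF bdd that])
  have r_mono: "r k \<le> r l" if "k \<le> l" for k l
    unfolding r_def using V that bdd by (intro cINF_superset_mono) auto
  have r_B: "r k \<le> B" for k using B[of k] r_le[of _ k] by force
  have "\<exists>x. x \<in> V k \<and> sqdist F x < r k + inverse (real (Suc k))" for k
  proof -
    have "(INF x\<in>V k. sqdist F x) < r k + inverse (real (Suc k))"
      by (simp add: r_def)
    then show ?thesis using cINF_less_iff[OF V(1) bdd] by auto
  qed
  then obtain s where s: "\<And>k. s k \<in> V k" "\<And>k. sqdist F (s k) < r k + inverse (real (Suc k))"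
    by metis
  have sM: "s k \<in> M" for k using s(1) V(2) by (auto simp: geo_convex_def)
  have key: "(d (s k) (s l))\<^sup>2 \<le> 2 * (r l - r k) + 4 * inverse (real (Suc k))" if "k \<le> l" for k l
  proof -
    have "s l \<in> V k" using s(1)[of l] V(3)[OF that] by auto
    then have "geo (s k) (s l) (1/2) \<in> V k" using V(2)[of k] s(1)[of k] by (auto simp: geo_convex_def)
    then have "r k \<le> sqdist F (geo (s k) (s l) (1/2))" by (rule r_le)
    also have "\<dots> \<le> (sqdist F (s k) + sqdist F (s l)) / 2 - (d (s k) (s l))\<^sup>2 / 4"
      by (rule sqdist_midpoint) (use F sM in auto)
    finally have "(d (s k) (s l))\<^sup>2 \<le> 2 * (sqdist F (s k) + sqdist F (s l)) - 4 * r k"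
      by (simp add: field_simps)
    also have "\<dots> \<le> 2 * (r k + inverse (real (Suc k)) + (r l + inverse (real (Suc l)))) - 4 * r k"
      by (intro diff_right_mono mult_left_mono add_mono less_imp_le[OF s(2)]) auto
    also have "inverse (real (Suc l)) \<le> inverse (real (Suc k))"
      using that by (simp add: field_simps)
    finally show ?thesis by simp
  qed
  have "convergent r"
    unfolding convergent_def
    using incseq_convergent[of r B] r_mono r_B by (metis incseq_def)
  then have "Cauchy r" by (rule convergent_Cauchy)
  have "MCauchy s"
    unfolding MCauchy_def
  proof (intro conjI allI impI)
    show "range s \<subseteq> M" using sM by auto
    fix e :: real assume e: "e > 0"
    then have e2: "e\<^sup>2 / 4 > 0" "e\<^sup>2 / 8 > 0" by auto
    obtain N1 where N1: "\<And>m n. m \<ge> N1 \<Longrightarrow> n \<ge> N1 \<Longrightarrow> dist (r m) (r n) < e\<^sup>2 / 4"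
      using \<open>Cauchy r\<close> e2 unfolding Cauchy_def by meson
    obtain N2 where N2: "inverse (real (Suc N2)) < e\<^sup>2 / 8"
      using reals_Archimedean[OF e2(2)] by auto
    have *: "d (s k) (s l) < e" if "k \<ge> max N1 N2" "k \<le> l" for k l
    proof -
      have "r l - r k < e\<^sup>2 / 4" using N1[of l k] that abs_ge_self[of "r l - r k"] unfolding dist_real_def by force
      moreover have "inverse (real (Suc k)) \<le> inverse (real (Suc N2))"
        using that by (simp add: field_simps)
      ultimately have "(d (s k) (s l))\<^sup>2 < e\<^sup>2" using key[OF that(2)] N2 by argo
      then show ?thesis using e by (simp add: power_less_imp_less_base)
    qed
    show "\<exists>N. \<forall>n n'. N \<le> n \<longrightarrow> N \<le> n' \<longrightarrow> d (s n) (s n') < e"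
    proof (intro exI allI impI)
      fix n n' assume "max N1 N2 \<le> n" "max N1 N2 \<le> n'"
      then show "d (s n) (s n') < e"
        using *[of n n'] *[of n' n] commute[of "s n" "s n'"] by (cases "n \<le> n'") auto
    qed
  qed
  then obtain x where "limitin mtopology s x sequentially"
    using compl unfolding mcomplete_def by blast
  moreover have "sqdist F (s k) \<le> sqdist F y + inverse (real (Suc k))" if "y \<in> V k" for k y
    using s(2)[of k] r_le[OF that] by linarith
  ultimately show ?thesis using s(1) by blast
qed

lemma limitin_dist:
  assumes "limitin mtopology s x sequentially" "z \<in> M"
  shows "(\<lambda>k. d z (s k)) \<longlonglongrightarrow> d z x"
proof -
  have "eventually (\<lambda>k. s k \<in> M) sequentially" "x \<in> M" "(\<lambda>k. d (s k) x) \<longlonglongrightarrow> 0"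
    using assms(1) by (auto simp: limitin_metric_dist_null)
  show ?thesis
  proof (rule LIM_zero_cancel, rule Lim_null_comparison)
    show "\<forall>\<^sub>F k in sequentially. norm (d z (s k) - d z x) \<le> d (s k) x"
      using \<open>eventually (\<lambda>k. s k \<in> M) sequentially\<close>
    proof eventually_elim
      case (elim k)
      then show ?case
        using triangle[of z "s k" x] triangle[of z x "s k"] assms(2) \<open>x \<in> M\<close> commute[of x "s k"] by auto
    qed
  qed fact
qed

lemma limitin_sqdist:
  assumes "limitin mtopology s x sequentially" "F \<subseteq> M"
  shows "(\<lambda>k. sqdist F (s k)) \<longlonglongrightarrow> sqdist F x"
  unfolding sqdist_def using assms by (intro tendsto_intros limitin_dist) auto

lemma limitin_in_closed:
  assumes "limitin mtopology s x sequentially" "closedin mtopology C" "\<And>k. s k \<in> C"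
  shows "x \<in> C"
  using limitin_closedin[OF assms(1,2)] assms(3) by simp

lemma sqdist_minimiser:
  assumes compl: mcomplete
    and F: "finite F" "F \<noteq> {}" "F \<subseteq> M"
    and C: "C \<noteq> {}" "geo_convex C" "closedin mtopology C"
  shows "\<exists>!x. x \<in> C \<and> (\<forall>y\<in>C. sqdist F x \<le> sqdist F y)"
proof -
  obtain c where c: "c \<in> C" using C by auto
  have CM: "C \<subseteq> M" using C by (auto simp: geo_convex_def)
  have "\<exists>s x. limitin mtopology s x sequentially \<and>
           (\<forall>k. s k \<in> C \<and> (\<forall>y\<in>C. sqdist F (s k) \<le> sqdist F y + inverse (real (Suc k))))"
    by (rule sqdist_almost_minimising_sequence[where B = "sqdist F c"]) (use compl F C c in auto)
  then obtain s x where s: "limitin mtopology s x sequentially" "\<And>k. s k \<in> C"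
    "\<And>k y. y \<in> C \<Longrightarrow> sqdist F (s k) \<le> sqdist F y + inverse (real (Suc k))" by blast
  have x: "x \<in> C" by (rule limitin_in_closed[OF s(1) C(3) s(2)])
  have "sqdist F x \<le> sqdist F y" if "y \<in> C" for y
  proof (rule LIMSEQ_le[OF limitin_sqdist[OF s(1) F(3)]])
    show "(\<lambda>k. sqdist F y + inverse (real (Suc k))) \<longlonglongrightarrow> sqdist F y"
      using tendsto_add[OF tendsto_const LIMSEQ_inverse_real_of_nat] by fastforce
  qed (use s(3)[OF that] in auto)
  moreover have "z = x" if z: "z \<in> C" "\<forall>y\<in>C. sqdist F z \<le> sqdist F y" for z
  proof -
    have m: "geo z x (1/2) \<in> C" using C(2) z x by (auto simp: geo_convex_def)
    have "sqdist F (geo z x (1/2)) \<le> (sqdist F z + sqdist F x) / 2 - (d z x)\<^sup>2 / 4"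
      by (rule sqdist_midpoint) (use F z x CM in auto)
    moreover have "sqdist F z \<le> sqdist F x" "sqdist F z \<le> sqdist F (geo z x (1/2))"
      "sqdist F x \<le> sqdist F z"
      using z x m calculation(1) \<open>\<And>y. y \<in> C \<Longrightarrow> sqdist F x \<le> sqdist F y\<close> by auto
    ultimately have "(d z x)\<^sup>2 \<le> 0" by argo
    then have "d z x = 0" by simp
    moreover have "z \<in> M" "x \<in> M" using z(1) x CM by auto
    ultimately show ?thesis by simp
  qed
  ultimately show ?thesis using x by blast
qed

definition isometric_map :: "('x \<Rightarrow> 'x) \<Rightarrow> bool" where
  "isometric_map g \<longleftrightarrow> g ` M \<subseteq> M \<and> (\<forall>x\<in>M. \<forall>y\<in>M. d (g x) (g y) = d x y)"

lemma isometric_map_sqdist: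
  assumes "isometric_map g" "finite F" "F \<subseteq> M" "g ` F \<subseteq> F" "x \<in> M"
  shows "sqdist F (g x) = sqdist F x"
proof -
  have inj: "inj_on g F"
  proof (rule inj_onI)
    fix a b assume ab: "a \<in> F" "b \<in> F" "g a = g b"
    then have abM: "a \<in> M" "b \<in> M" using assms by auto
    then have "d a b = d (g a) (g b)" using assms(1) by (simp add: isometric_map_def)
    also have "\<dots> = 0" using ab(3) abM assms(1) by (auto simp: isometric_map_def)
    finally show "a = b" using abM by simp
  qed
  then have "g ` F = F" using assms by (intro endo_inj_surj) auto
  then have "sqdist F (g x) = (\<Sum>z\<in>g ` F. (d z (g x))\<^sup>2)" by (simp add: sqdist_def)
  also have "\<dots> = (\<Sum>z\<in>F. (d (g z) (g x))\<^sup>2)" by (simp add: sum.reindex[OF inj])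
  also have "\<dots> = sqdist F x"
    unfolding sqdist_def using assms by (intro sum.cong) (auto simp: isometric_map_def)
  finally show ?thesis .
qed

text \<open>The minimiser of \<open>sqdist F\<close> on \<open>C\<close> is unique, and \<open>sqdist F\<close> and \<open>C\<close> are invariant. For \<open>F\<close> a fixed point of
\<open>g\<close> this says that the projection of that point to an invariant \<open>C\<close> is fixed, too.\<close>

lemma fixed_point_invariant_set:
  assumes compl: mcomplete
    and F: "finite F" "F \<noteq> {}" "F \<subseteq> M"
    and C: "C \<noteq> {}" "geo_convex C" "closedin mtopology C"
    and G: "\<And>g. g \<in> G \<Longrightarrow> isometric_map g" "\<And>g. g \<in> G \<Longrightarrow> g ` F \<subseteq> F" "\<And>g. g \<in> G \<Longrightarrow> g ` C \<subseteq> C"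
  shows "\<exists>x\<in>C. \<forall>g\<in>G. g x = x"
proof -
  obtain x where x: "x \<in> C" "\<And>y. y \<in> C \<Longrightarrow> sqdist F x \<le> sqdist F y"
    and u: "\<And>z. z \<in> C \<Longrightarrow> (\<forall>y\<in>C. sqdist F z \<le> sqdist F y) \<Longrightarrow> z = x"
    using sqdist_minimiser[OF compl F C] by blast
  have "g x = x" if g: "g \<in> G" for g
  proof (rule u)
    show "g x \<in> C" using G(3)[OF g] x by auto
    have "sqdist F (g x) = sqdist F x"
      by (rule isometric_map_sqdist) (use G g F x C in \<open>auto simp: geo_convex_def\<close>)
    then show "\<forall>y\<in>C. sqdist F (g x) \<le> sqdist F y" using x by simp
  qed
  then show ?thesis using x by auto
qed

definition fixed_points :: "('x \<Rightarrow> 'x) \<Rightarrow> 'x set" where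
  "fixed_points g = {x \<in> M. g x = x}"

lemma isometric_map_geo:
  assumes "isometric_map g" "x \<in> M" "y \<in> M" "0 \<le> t" "t \<le> 1"
  shows "g (geo x y t) = geo (g x) (g y) t"
proof (rule geo_unique)
  have z: "geo x y t \<in> M" by (rule geo_in) fact+
  show "g x \<in> M" "g y \<in> M" "g (geo x y t) \<in> M" using assms z by (auto simp: isometric_map_def)
  show "d (g x) (g (geo x y t)) = t * d (g x) (g y)" "d (g (geo x y t)) (g y) = (1 - t) * d (g x) (g y)"
    using assms z geo_dist[OF assms(2-5)] by (auto simp: isometric_map_def)
qed fact+

lemma geo_convex_fixed_points: "isometric_map g \<Longrightarrow> geo_convex (fixed_points g)"
  by (auto simp: geo_convex_def fixed_points_def isometric_map_geo geo_in)

lemma closedin_fixed_points: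
  assumes "isometric_map g"
  shows "closedin mtopology (fixed_points g)"
  unfolding closedin_metric
proof (intro conjI allI impI)
  show "fixed_points g \<subseteq> M" by (auto simp: fixed_points_def)
  fix x assume x: "x \<in> M - fixed_points g"
  then have gx: "g x \<in> M" "g x \<noteq> x" using assms by (auto simp: fixed_points_def isometric_map_def)
  have "disjnt (fixed_points g) (mball x (d x (g x) / 2))"
    unfolding disjnt_iff
  proof (intro allI notI)
    fix y assume y: "y \<in> fixed_points g \<and> y \<in> mball x (d x (g x) / 2)"
    then have "y \<in> M" "g y = y" "d x y < d x (g x) / 2" by (auto simp: fixed_points_def)
    moreover from this have "d y (g x) = d y x" using assms x unfolding isometric_map_def by (metis DiffE)
    ultimately show False using triangle[of x y "g x"] x gx commute[of y x] by auto
  qed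
  moreover have "d x (g x) / 2 > 0" using x gx by auto
  ultimately show "\<exists>r>0. disjnt (fixed_points g) (mball x r)" by blast
qed

text \<open>The midpoint of \<open>x\<close> and \<open>g x\<close> is mapped to the midpoint of \<open>g x\<close> and \<open>g (g x)\<close>; by comparison at the common
vertex \<open>g x\<close> these midpoints have distance at most half of \<open>d x (g (g x))\<close>.\<close>

lemma displacement_doubles:
  assumes g: "isometric_map g" and L: "\<And>x. x \<in> M \<Longrightarrow> L \<le> d x (g x)" and x: "x \<in> M"
  shows "2 * L \<le> d x (g (g x))"
proof -
  have "\<And>y. y \<in> M \<Longrightarrow> g y \<in> M" using g by (auto simp: isometric_map_def)
  then have gM: "g x \<in> M" "g (g x) \<in> M" using x by blast+
  let ?m = "geo x (g x) (1/2)"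
  have m: "?m \<in> M" using x gM by (intro geo_in) auto
  have "L \<le> d ?m (g ?m)" by (rule L[OF m])
  also have "g ?m = geo (g x) (g (g x)) (1/2)" using g x gM by (intro isometric_map_geo) auto
  also have "?m = geo (g x) x (1/2)" using geo_sym[of x "g x" "1/2"] x gM by simp
  also have "d (geo (g x) x (1/2)) (geo (g x) (g (g x)) (1/2)) \<le> 1/2 * d x (g (g x))"
    using x gM by (intro geo_same_start) auto
  finally show ?thesis by simp
qed

lemma displacement_power:
  assumes g: "isometric_map g" and L: "\<And>x. x \<in> M \<Longrightarrow> L \<le> d x (g x)" and x: "x \<in> M"
  shows "2 ^ k * L \<le> d x ((g ^^ (2 ^ k)) x)"
  using assms
proof (induction k arbitrary: g L)
  case 0
  then show ?case by simp
next
  case (Suc k)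
  have "isometric_map (g \<circ> g)" using Suc.prems(1) by (auto simp: isometric_map_def image_subset_iff)
  moreover have "2 * L \<le> d y ((g \<circ> g) y)" if "y \<in> M" for y
    using displacement_doubles[OF Suc.prems(1,2) that] by simp
  ultimately have "2 ^ k * (2 * L) \<le> d x (((g \<circ> g) ^^ (2 ^ k)) x)"
    using Suc.prems(3) by (intro Suc.IH) blast+
  also have "g \<circ> g = g ^^ 2" by (simp add: numeral_2_eq_2)
  also have "((g ^^ 2) ^^ (2 ^ k)) = g ^^ (2 ^ Suc k)" by (simp add: funpow_mult mult.commute)
  finally show ?case by (simp add: mult.commute mult.left_commute)
qed


lemma geo_convex_inter: "geo_convex S \<Longrightarrow> geo_convex T \<Longrightarrow> geo_convex (S \<inter> T)"
  by (auto simp: geo_convex_def)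

lemma geo_convex_mball:
  assumes "z \<in> M" shows "geo_convex (mball z r)"
  unfolding geo_convex_def
proof (intro conjI ballI allI impI)
  fix x y and t :: real assume xy: "x \<in> mball z r" "y \<in> mball z r" "0 \<le> t" "t \<le> 1"
  then have M: "x \<in> M" "y \<in> M" "geo x y t \<in> M" by (auto simp: geo_in)
  have "z = geo z z t" using assms xy by (intro geo_unique) auto
  then have "d z (geo x y t) \<le> (1 - t) * d z x + t * d z y"
    using geo_quadrilateral[of z z x y t] M assms xy by simp
  also have "\<dots> \<le> max (d z x) (d z y)" using xy
    by (intro convex_bound_le) auto
  also have "\<dots> < r" using xy by auto
  finally show "geo x y t \<in> mball z r" using M assms by simp
qed auto

definition open_nbhd :: "real \<Rightarrow> 'x set \<Rightarrow> 'x set" where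
  "open_nbhd e C = (\<Union>c\<in>C. mball c e)"

lemma openin_open_nbhd: "openin mtopology (open_nbhd e C)"
  unfolding open_nbhd_def by (auto intro: openin_Union)

lemma geo_convex_open_nbhd:
  assumes "geo_convex C" shows "geo_convex (open_nbhd e C)"
  unfolding geo_convex_def
proof (intro conjI ballI allI impI)
  fix x y and t :: real assume xy: "x \<in> open_nbhd e C" "y \<in> open_nbhd e C" "0 \<le> t" "t \<le> 1"
  then obtain a b where ab: "a \<in> C" "b \<in> C" "a \<in> M" "b \<in> M" "x \<in> M" "y \<in> M" "d a x < e" "d b y < e"
    by (auto simp: open_nbhd_def)
  have "d (geo a b t) (geo x y t) \<le> (1 - t) * d a x + t * d b y"
    using ab xy by (intro geo_quadrilateral) auto
  also have "\<dots> \<le> max (d a x) (d b y)" using xy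
    by (intro convex_bound_le) auto
  also have "\<dots> < e" using ab by auto
  finally have "d (geo a b t) (geo x y t) < e" .
  moreover have "geo a b t \<in> C" using assms ab xy by (auto simp: geo_convex_def)
  ultimately show "geo x y t \<in> open_nbhd e C" using ab xy unfolding open_nbhd_def
    by (intro UN_I[of "geo a b t"]) (auto simp: geo_in)
qed (auto simp: open_nbhd_def)

lemma limit_of_shrinking_nbhds:
  assumes C: "closedin mtopology C"
    and lim: "limitin mtopology s x sequentially" and s: "\<And>k. s k \<in> open_nbhd (inverse (real (Suc k))) C"
  shows "x \<in> C"
proof -
  have "\<exists>c. c \<in> C \<and> s k \<in> mball c (inverse (real (Suc k)))" for k
    using s[of k] by (auto simp: open_nbhd_def)
  then obtain c where c: "\<And>k. c k \<in> C" "\<And>k. s k \<in> mball (c k) (inverse (real (Suc k)))" by metis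
  have cM: "c k \<in> M" "s k \<in> M" "d (c k) (s k) < inverse (real (Suc k))" for k using c(2)[of k] by auto
  have x: "x \<in> M" "(\<lambda>k. d (s k) x) \<longlonglongrightarrow> 0" using lim by (auto simp: limitin_metric_dist_null)
  have "(\<lambda>k. d (c k) x) \<longlonglongrightarrow> 0"
  proof (rule tendsto_sandwich[of "\<lambda>_. 0"])
    show "(\<lambda>k. inverse (real (Suc k)) + d (s k) x) \<longlonglongrightarrow> 0"
      using tendsto_add[OF LIMSEQ_inverse_real_of_nat x(2)] by simp
    show "\<forall>\<^sub>F k in sequentially. d (c k) x \<le> inverse (real (Suc k)) + d (s k) x"
    proof (rule always_eventually, rule allI)
      fix k show "d (c k) x \<le> inverse (real (Suc k)) + d (s k) x"
        using triangle[OF cM(1)[of k] cM(2)[of k] x(1)] cM(3)[of k] by linarith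
    qed
  qed auto
  then have "limitin mtopology c x sequentially"
    using x cM(1) by (auto simp: limitin_metric_dist_null)
  then show ?thesis using limitin_in_closed C c(1) by blast
qed

text \<open>Helly's theorem, where the vanishing of homology in degree \<open>m\<close> takes the place of an embedding in a space of
dimension \<open>m\<close>. The homology argument needs open sets, so the sets are replaced by their neighbourhoods within
a fixed ball. The ball keeps the neighbourhoods bounded: if these met for every radius, a limit of common
points would lie in all the closed sets.\<close>

lemma helly:
  assumes compl: mcomplete
    and dim: "\<And>Y. openin mtopology Y \<Longrightarrow>
                trivial_group (reduced_homology_group (int m) (subtopology mtopology Y))"
    and I: "finite I" "card I = m + 2"
    and C: "\<And>i. i \<in> I \<Longrightarrow> geo_convex (C i)" "\<And>i. i \<in> I \<Longrightarrow> closedin mtopology (C i)"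
    and meet: "\<And>i. i \<in> I \<Longrightarrow> \<exists>p\<in>M. \<forall>j\<in>I - {i}. p \<in> C j"
  shows "(\<Inter>i\<in>I. C i) \<noteq> {}"
proof
  assume empty: "(\<Inter>i\<in>I. C i) = {}"
  have "\<forall>i\<in>I. \<exists>p. p \<in> M \<and> (\<forall>j\<in>I - {i}. p \<in> C j)" using meet by blast
  then obtain p where p': "\<forall>i\<in>I. p i \<in> M \<and> (\<forall>j\<in>I - {i}. p i \<in> C j)"
    by (rule bchoice[THEN exE])
  then have p: "\<And>i. i \<in> I \<Longrightarrow> p i \<in> M" "\<And>i j. i \<in> I \<Longrightarrow> j \<in> I \<Longrightarrow> j \<noteq> i \<Longrightarrow> p i \<in> C j"
    by auto
  have ne: "I \<noteq> {}" using I(2) by auto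
  then obtain i0 where i0: "i0 \<in> I" by auto
  define o' where "o' = p i0"
  have o: "o' \<in> M" using p i0 by (simp add: o'_def)
  (* all p i lie in the open ball of radius \<rho> around o' *)
  define \<rho> where "\<rho> = Max ((\<lambda>i. d o' (p i)) ` I) + 1"
  have \<rho>: "d o' (p i) < \<rho>" if "i \<in> I" for i
  proof -
    have "d o' (p i) \<le> Max ((\<lambda>i. d o' (p i)) ` I)" using I that by (intro Max_ge) auto
    then show ?thesis by (simp add: \<rho>_def)
  qed
  define U where "U k i = mball o' \<rho> \<inter> open_nbhd (inverse (real (Suc k))) (C i)" for k i
  have U_conv: "geo_convex (U k i)" if "i \<in> I" for k i
    unfolding U_def using C that o by (intro geo_convex_inter geo_convex_mball geo_convex_open_nbhd)
  have pU: "p i \<in> U k j" if "i \<in> I" "j \<in> I" "j \<noteq> i" for i j k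
  proof -
    have "p i \<in> mball (p i) (inverse (real (Suc k)))" using p(1) that(1) by simp
    moreover have "p i \<in> C j" using p(2) that by blast
    ultimately have "p i \<in> open_nbhd (inverse (real (Suc k))) (C j)" by (auto simp only: open_nbhd_def)
    moreover have "p i \<in> mball o' \<rho>" using p(1) \<rho> o that by simp
    ultimately show ?thesis by (simp add: U_def)
  qed
  have "\<exists>k. (\<Inter>i\<in>I. U k i) = {}"
  proof (rule ccontr)
    assume "\<nexists>k. (\<Inter>i\<in>I. U k i) = {}"
    then have V: "(\<Inter>i\<in>I. U k i) \<noteq> {}" for k by auto
    have "\<exists>s x. limitin mtopology s x sequentially \<and> (\<forall>k. s k \<in> (\<Inter>i\<in>I. U k i) \<and>
       (\<forall>y\<in>(\<Inter>i\<in>I. U k i). sqdist {o'} (s k) \<le> sqdist {o'} y + inverse (real (Suc k))))"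
    proof (rule sqdist_almost_minimising_sequence[where B = "\<rho>\<^sup>2"])
      show "geo_convex (\<Inter>i\<in>I. U k i)" for k
        by (rule geo_convex_Inter) (use U_conv ne in auto)
      fix k l :: nat assume "k \<le> l"
      then have "inverse (real (Suc l)) \<le> inverse (real (Suc k))" by (simp add: field_simps)
      then have "open_nbhd (inverse (real (Suc l))) (C i) \<subseteq> open_nbhd (inverse (real (Suc k))) (C i)" for i
        unfolding open_nbhd_def by (intro UN_mono mball_subset_concentric) auto
      then show "(\<Inter>i\<in>I. U l i) \<subseteq> (\<Inter>i\<in>I. U k i)" unfolding U_def by blast
    next
      fix k obtain x where x: "x \<in> (\<Inter>i\<in>I. U k i)" using V[of k] by auto
      then have "x \<in> U k i0" using i0 by blast
      then have "d o' x < \<rho>" by (simp add: U_def)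
      then have "sqdist {o'} x \<le> \<rho>\<^sup>2" by (simp add: sqdist_def power_mono)
      then show "\<exists>x\<in>(\<Inter>i\<in>I. U k i). sqdist {o'} x \<le> \<rho>\<^sup>2" using x by blast
    qed (use compl o V in auto)
    then obtain s x where s: "limitin mtopology s x sequentially" "\<And>k. s k \<in> (\<Inter>i\<in>I. U k i)" by blast
    have "x \<in> C i" if "i \<in> I" for i
    proof (rule limit_of_shrinking_nbhds[OF C(2)[OF that] s(1)])
      fix k have "s k \<in> U k i" using s(2)[of k] that by blast
      then show "s k \<in> open_nbhd (inverse (real (Suc k))) (C i)" by (simp add: U_def)
    qed
    then show False using empty by auto
  qed
  then obtain k where k: "(\<Inter>i\<in>I. U k i) = {}" by blast
  have op: "openin mtopology (U k i)" for i
    unfolding U_def by (intro openin_Int openin_open_nbhd openin_mball)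
  have "\<not> trivial_group (reduced_homology_group (int m) (subtopology mtopology (\<Union>(U k ` I))))"
  proof (rule nontrivial_homology_nerve)
    fix J assume J: "J \<subset> I" "J \<noteq> {}"
    then obtain i where "i \<in> I" "i \<notin> J" by auto
    then have "p i \<in> \<Inter>(U k ` J)" using pU J by blast
    moreover have "geo_convex (\<Inter>(U k ` J))"
      by (rule geo_convex_Inter) (use U_conv J in auto)
    ultimately show "\<Inter>(U k ` J) \<noteq> {} \<and> acyclic_in mtopology (\<Inter>(U k ` J))"
      using geo_convex_contractible trivial_reduced_homology_group_contractible_space
      unfolding acyclic_in_def by blast
  qed (use I op k in auto)
  moreover have "openin mtopology (\<Union>(U k ` I))" using op by auto
  ultimately show False using dim by blast
qed

end

section \<open>From comparison triangles to the CAT(0) inequality\<close>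

lemma exists_comparison_triangle:
  fixes a b c :: real
  assumes "a \<le> b + c" "b \<le> a + c" "c \<le> a + b"
  shows "\<exists>p q r :: real^2. dist p q = a \<and> dist q r = b \<and> dist r p = c"
proof -
  have nn: "a \<ge> 0" "b \<ge> 0" "c \<ge> 0" using assms by linarith+
  show ?thesis
  proof (cases "a = 0")
    case True
    then have "b = c" using assms by linarith
    have "dist (vector [0,0] :: real^2) (vector [c, 0]) = c"
      using nn by (simp add: dist_vec_def L2_set_def sum_2)
    then show ?thesis using True \<open>b = c\<close> by (metis dist_commute dist_self)
  next
    case False
    then have a: "a > 0" using nn by simp
    (* (u, v) is the third vertex when the other two are (0, 0) and (a, 0) *)
    define u where "u = (a\<^sup>2 + c\<^sup>2 - b\<^sup>2) / (2 * a)"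
    have ua: "2 * a * u = a\<^sup>2 + c\<^sup>2 - b\<^sup>2" using a by (simp add: u_def)
    have "\<bar>2 * a * u\<bar> \<le> 2 * a * c"
    proof -
      have "0 \<le> (b - (a - c)) * (b + (a - c))" "0 \<le> (a + c - b) * (a + c + b)"
        using assms nn by auto
      then show ?thesis unfolding ua by (auto simp: abs_le_iff algebra_simps power2_eq_square)
    qed
    then have "\<bar>u\<bar> \<le> c" using a by (simp add: abs_mult)
    then have v: "u\<^sup>2 \<le> c\<^sup>2" using nn abs_le_square_iff[of u c] by simp
    define v where "v = sqrt (c\<^sup>2 - u\<^sup>2)"
    have vv: "v\<^sup>2 = c\<^sup>2 - u\<^sup>2" using v by (simp add: v_def)
    let ?p = "vector [0, 0] :: real^2" and ?q = "vector [a, 0] :: real^2" and ?r = "vector [u, v] :: real^2"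
    have "dist ?p ?q = a" using nn by (simp add: dist_vec_def L2_set_def sum_2)
    moreover have "dist ?r ?p = c" using nn vv by (simp add: dist_vec_def L2_set_def sum_2 dist_real_def)
    moreover have "dist ?q ?r = b"
    proof -
      have "(a - u)\<^sup>2 + v\<^sup>2 = b\<^sup>2" unfolding vv using ua by (simp add: power2_eq_square algebra_simps)
      then show ?thesis using nn by (simp add: dist_vec_def L2_set_def sum_2 dist_real_def)
    qed
    ultimately show ?thesis by blast
  qed
qed

lemma stewart_identity:
  fixes p q r :: "'a::real_inner"
  shows "(dist r (p + t *\<^sub>R (q - p)))\<^sup>2 = (1 - t) * (dist r p)\<^sup>2 + t * (dist r q)\<^sup>2 - t * (1 - t) * (dist p q)\<^sup>2"
  unfolding dist_norm power2_norm_eq_inner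
  by (simp add: inner_simps inner_commute algebra_simps power2_eq_square)

lemma CAT0_inequality:
  fixes X :: "'x metric"
  assumes X: "CAT0_space X" and xy: "x \<in> mspace X" "y \<in> mspace X" and t: "0 \<le> t" "t \<le> 1"
  shows "\<exists>z\<in>mspace X. \<forall>w\<in>mspace X. (mdist X w z)\<^sup>2 \<le>
           (1 - t) * (mdist X w x)\<^sup>2 + t * (mdist X w y)\<^sup>2 - t * (1 - t) * (mdist X x y)\<^sup>2"
proof -
  interpret Metric_space "mspace X" "mdist X" by (rule Metric_space_mspace_mdist)
  have geod: "\<exists>c. geodesic_path X a b c" if "a \<in> mspace X" "b \<in> mspace X" for a b
    using X that by (auto simp: CAT0_space_def geodesic_space_def geodesic_segment_def)
  obtain c where c: "geodesic_path X x y c" using geod xy by blast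
  let ?D = "mdist X x y"
  have tD: "t * ?D \<in> {0..?D}" "0 \<in> {0..?D}" using t by (auto simp: mult_left_le_one_le)
  let ?z = "c (t * ?D)"
  have z: "?z \<in> mspace X" using c tD by (auto simp: geodesic_path_def)
  have "mdist X (c 0) ?z = \<bar>0 - t * ?D\<bar>" using c tD unfolding geodesic_path_def by blast
  then have xz: "mdist X x ?z = t * ?D" using c t by (simp add: geodesic_path_def)
  have "(mdist X w ?z)\<^sup>2 \<le>
           (1 - t) * (mdist X w x)\<^sup>2 + t * (mdist X w y)\<^sup>2 - t * (1 - t) * ?D\<^sup>2" if w: "w \<in> mspace X" for w
  proof -
    obtain c2 where c2: "geodesic_path X y w c2" using geod xy w by blast
    obtain c3 where c3: "geodesic_path X w x c3" using geod xy w by blast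
    let ?A = "c ` {0..?D}" and ?B = "c2 ` {0..mdist X y w}" and ?C = "c3 ` {0..mdist X w x}"
    have tri: "geodesic_triangle X x y w ?A ?B ?C"
      using xy w c c2 c3 by (auto simp: geodesic_triangle_def geodesic_segment_def)
    obtain p q r :: "real^2" where pqr: "dist p q = ?D" "dist q r = mdist X y w" "dist r p = mdist X w x"
      using exists_comparison_triangle[of ?D "mdist X y w" "mdist X w x"] xy w
        triangle[of x w y] triangle[of y x w] triangle[of w y x]
      by (auto simp: commute add.commute)
    have comp: "comparison_triangle X x y w p q r" using pqr by (simp add: comparison_triangle_def)
    let ?z' = "p + t *\<^sub>R (q - p)"
    have "(?z, ?z') \<in> comparison_points X x ?A p q"
    proof -
      have "?z' \<in> closed_segment p q"
        using t by (auto simp: closed_segment_def algebra_simps intro!: exI[of _ t])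
      moreover have "dist p ?z' = mdist X x ?z"
        using t xz pqr by (simp add: dist_norm norm_minus_commute)
      ultimately show ?thesis using tD by (auto simp: comparison_points_def)
    qed
    moreover have "(w, r) \<in> comparison_points X w ?C r p"
    proof -
      have "w = c3 0" "0 \<in> {0..mdist X w x}" using c3 by (auto simp: geodesic_path_def)
      then have "w \<in> ?C" by blast
      then show ?thesis using w by (auto simp: comparison_points_def)
    qed
    ultimately have "mdist X w ?z \<le> dist r ?z'"
      using X tri comp unfolding CAT0_space_def Let_def by (fastforce simp: commute dist_commute)
    then have "(mdist X w ?z)\<^sup>2 \<le> (dist r ?z')\<^sup>2" by (intro power_mono) auto
    also have "\<dots> = (1 - t) * (mdist X w x)\<^sup>2 + t * (mdist X w y)\<^sup>2 - t * (1 - t) * ?D\<^sup>2"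
      unfolding stewart_identity pqr using pqr(2) by (simp add: dist_commute commute)
    finally show ?thesis .
  qed
  then show ?thesis using z by blast
qed

lemma CAT0_space_imp_cat0:
  assumes "CAT0_space X"
  shows "\<exists>geo. cat0 (mspace X) (mdist X) geo"
proof -
  have "\<forall>x y t. \<exists>z. x \<in> mspace X \<longrightarrow> y \<in> mspace X \<longrightarrow> 0 \<le> t \<longrightarrow> t \<le> 1 \<longrightarrow> z \<in> mspace X \<and> (\<forall>w\<in>mspace X. (mdist X w z)\<^sup>2 \<le>
           (1 - t) * (mdist X w x)\<^sup>2 + t * (mdist X w y)\<^sup>2 - t * (1 - t) * (mdist X x y)\<^sup>2)"
    using CAT0_inequality[OF assms] by blast
  then obtain geo where geo: "\<And>x y t. x \<in> mspace X \<Longrightarrow> y \<in> mspace X \<Longrightarrow> 0 \<le> t \<Longrightarrow> t \<le> 1 \<Longrightarrow>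
       geo x y t \<in> mspace X \<and> (\<forall>w\<in>mspace X. (mdist X w (geo x y t))\<^sup>2 \<le>
           (1 - t) * (mdist X w x)\<^sup>2 + t * (mdist X w y)\<^sup>2 - t * (1 - t) * (mdist X x y)\<^sup>2)"
    by metis
  have "cat0 (mspace X) (mdist X) geo"
    by (intro cat0.intro Metric_space_mspace_mdist cat0_axioms.intro) (use geo in blast)+
  then show ?thesis by blast
qed

section \<open>Torsion and finite index in groups\<close>

context Group.group begin

definition lprod :: "'a list \<Rightarrow> 'a" where
  "lprod xs = foldr (\<otimes>) xs \<one>"

lemma lprod_simps [simp]: "lprod [] = \<one>" "lprod (x # xs) = x \<otimes> lprod xs"
  by (simp_all add: lprod_def)

lemma lprod_closed [simp]: "set xs \<subseteq> carrier G \<Longrightarrow> lprod xs \<in> carrier G"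
  by (induction xs) auto

lemma lprod_append: "set xs \<subseteq> carrier G \<Longrightarrow> set ys \<subseteq> carrier G \<Longrightarrow> lprod (xs @ ys) = lprod xs \<otimes> lprod ys"
  by (induction xs) (auto simp: m_assoc)

lemma lprod_conj:
  assumes "s \<in> carrier G" "set xs \<subseteq> carrier G"
  shows "lprod xs \<otimes> s = s \<otimes> lprod (map (\<lambda>t. inv s \<otimes> t \<otimes> s) xs)"
  using assms(2)
proof (induction xs)
  case (Cons x xs)
  let ?P = "lprod (map (\<lambda>t. inv s \<otimes> t \<otimes> s) xs)"
  have c: "x \<in> carrier G" "lprod xs \<in> carrier G" "?P \<in> carrier G"
    using Cons.prems assms(1) by (auto intro!: lprod_closed m_closed)
  have "lprod (x # xs) \<otimes> s = x \<otimes> (s \<otimes> ?P)" using Cons c assms(1) by (simp add: m_assoc)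
  also have "\<dots> = (s \<otimes> inv s) \<otimes> (x \<otimes> (s \<otimes> ?P))" using c assms(1) by simp
  also have "\<dots> = s \<otimes> (inv s \<otimes> x \<otimes> s \<otimes> ?P)" using c assms(1) by (simp only: m_assoc m_closed inv_closed)
  finally show ?case by simp
qed (use assms in simp)

text \<open>Move the occurrences of \<open>s\<close> to the front one by one. The factors that are passed get conjugated by \<open>s\<close> and
stay in \<open>S\<close>; taking the leftmost occurrence first, the later ones are not affected.\<close>

lemma lprod_collect:
  assumes S: "S \<subseteq> carrier G" "\<And>s g. s \<in> S \<Longrightarrow> g \<in> carrier G \<Longrightarrow> inv g \<otimes> s \<otimes> g \<in> S" and s: "s \<in> S"
  shows "set xs \<subseteq> S \<Longrightarrow> k \<le> count_list xs s \<Longrightarrow>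
    \<exists>ys. set ys \<subseteq> S \<and> length ys + k = length xs \<and> lprod xs = s [^] k \<otimes> lprod ys"
proof (induction k arbitrary: xs)
  case 0
  then have "lprod xs \<in> carrier G" using S(1) by (intro lprod_closed) auto
  then show ?case using 0 by (intro exI[of _ xs]) auto
next
  case (Suc k)
  then have "s \<in> set xs" by (metis count_list_0_iff not_less_eq_eq zero_le)
  then obtain us vs where xs: "xs = us @ s # vs" "s \<notin> set us" by (meson split_list_first)
  let ?us = "map (\<lambda>t. inv s \<otimes> t \<otimes> s) us"
  have sc: "s \<in> carrier G" using s S by auto
  have us: "set ?us \<subseteq> S" using Suc.prems(1) xs S sc by auto
  have c: "set us \<subseteq> carrier G" "set vs \<subseteq> carrier G" "set ?us \<subseteq> carrier G" using Suc.prems(1) xs S us by auto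
  have "k \<le> count_list (?us @ vs) s" using Suc.prems(2) xs(1) count_list_0_iff[of us s] xs(2) by simp
  moreover have "set (?us @ vs) \<subseteq> S" using us Suc.prems(1) xs by auto
  ultimately obtain ys where ys: "set ys \<subseteq> S" "length ys + k = length (?us @ vs)" "lprod (?us @ vs) = s [^] k \<otimes> lprod ys"
    using Suc.IH by blast
  have yc: "lprod ys \<in> carrier G" using ys(1) S by (intro lprod_closed) auto
  have "lprod xs = (lprod us \<otimes> s) \<otimes> lprod vs" using c sc by (simp add: xs lprod_append m_assoc)
  also have "\<dots> = s \<otimes> lprod (?us @ vs)" unfolding lprod_conj[OF sc c(1)] lprod_append[OF c(3,2)]
    using c(2,3) sc by (intro m_assoc) (auto intro!: lprod_closed)
  also have "\<dots> = s \<otimes> s [^] k \<otimes> lprod ys" unfolding ys(3) using sc yc by (simp add: m_assoc)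
  also have "s \<otimes> s [^] k = s [^] Suc k" using sc by (metis nat_pow_Suc2)
  finally show ?case using ys(1,2) xs by (intro exI[of _ ys]) auto
qed

text \<open>Dietzmann's lemma. If a word has more than \<open>m * card S\<close> letters, one letter occurs \<open>m\<close> times and
can be collected and cancelled. So words of bounded length represent all elements.\<close>

lemma dietzmann:
  assumes fin: "finite S" and S: "S \<subseteq> carrier G" "\<And>s g. s \<in> S \<Longrightarrow> g \<in> carrier G \<Longrightarrow> inv g \<otimes> s \<otimes> g \<in> S"
    and m: "m > 0" "\<And>s. s \<in> S \<Longrightarrow> s [^] (m::nat) = \<one>" and gen: "carrier G \<subseteq> generate G S"
  shows "finite (carrier G)"
proof -
  have short: "\<exists>ys. set ys \<subseteq> S \<and> length ys \<le> card S * m \<and> lprod ys = lprod xs" if "set xs \<subseteq> S" for xs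
    using that
  proof (induction "length xs" arbitrary: xs rule: less_induct)
    case less
    show ?case
    proof (cases "length xs \<le> card S * m")
      case False
      have "\<exists>s\<in>S. m \<le> count_list xs s"
      proof (rule ccontr)
        assume "\<not> ?thesis"
        then have "sum (count_list xs) S \<le> sum (\<lambda>_. m) S" by (intro sum_mono) auto
        then show False using False sum_count_set[OF less.prems fin] by simp
      qed
      then obtain s where s: "s \<in> S" "m \<le> count_list xs s" by blast
      obtain ys where ys: "set ys \<subseteq> S" "length ys + m = length xs" "lprod xs = s [^] m \<otimes> lprod ys"
        using lprod_collect[OF S s(1) less.prems s(2)] by blast
      have "lprod ys \<in> carrier G" using ys(1) S by (intro lprod_closed) auto
      then have "lprod xs = lprod ys" using ys(3) m(2)[OF s(1)] by simp
      moreover have "length ys < length xs" using ys(2) m(1) by simp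
      ultimately show ?thesis using less.hyps[of ys] ys(1) by metis
    qed (use less.prems in blast)
  qed
  have "\<exists>xs. set xs \<subseteq> S \<and> lprod xs = g" if "g \<in> generate G S" for g
    using that
  proof (induction rule: generate.induct)
    case one
    show ?case by (rule exI[of _ "[]"]) simp
  next
    case (incl h)
    then show ?case using S by (intro exI[of _ "[h]"]) auto
  next
    case (inv h)
    then have h: "h \<in> carrier G" using S by auto
    have r: "lprod (replicate k h) = h [^] k" for k
      by (induction k) (use h in \<open>simp_all add: nat_pow_Suc2[symmetric] del: nat_pow_Suc\<close>)
    have "h [^] (m - 1) \<otimes> h = \<one>" using m(1) m(2)[OF inv] nat_pow_Suc[of h "m - 1"] by simp
    then have "inv h = h [^] (m - 1)" using h by (intro inv_equality) auto
    then show ?case using r inv by (intro exI[of _ "replicate (m - 1) h"]) auto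
  next
    case (eng h1 h2)
    then obtain xs ys where "set xs \<subseteq> S" "lprod xs = h1" "set ys \<subseteq> S" "lprod ys = h2" by blast
    then show ?case using S by (intro exI[of _ "xs @ ys"]) (auto simp: lprod_append)
  qed
  then have "carrier G \<subseteq> lprod ` {xs. set xs \<subseteq> S \<and> length xs \<le> card S * m}"
    using gen short by (force simp: image_iff)
  moreover have "finite {xs. set xs \<subseteq> S \<and> length xs \<le> card S * m}"
    by (rule finite_lists_length_le[OF fin])
  ultimately show ?thesis by (meson finite_imageI finite_subset)
qed

text \<open>Among the powers of \<open>g\<close> with exponent up to the index two lie in the same coset, and their quotient is a
power in \<open>H\<close> whose exponent divides the factorial.\<close>

lemma finite_index_power:
  assumes H: "subgroup H G" and fin: "finite (rcosets H)" and g: "g \<in> carrier G"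
  shows "g [^] (fact (card (rcosets H)) :: nat) \<in> H"
proof -
  interpret H: subgroup H G by fact
  let ?d = "card (rcosets H)"
  let ?f = "\<lambda>k::nat. H #> (g [^] k)"
  have "?f ` {0..?d} \<subseteq> rcosets H" using g by (auto simp: RCOSETS_def)
  then have "card (?f ` {0..?d}) \<le> ?d" by (rule card_mono[OF fin])
  then have "\<not> inj_on ?f {0..?d}" using card_image[of ?f "{0..?d}"] by auto
  then obtain i j where "i \<in> {0..?d}" "j \<in> {0..?d}" "i < j" "?f i = ?f j"
    unfolding inj_on_def by (metis linorder_neqE_nat)
  then have ij: "i < j" "j \<le> ?d" "?f i = ?f j" by auto
  have "g [^] j \<in> H #> g [^] j" using g H by (intro rcos_self) auto
  then have "g [^] j \<in> H #> g [^] i" using ij(3) by simp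
  then obtain h where h: "h \<in> H" "g [^] j = h \<otimes> g [^] i" by (auto simp: r_coset_def)
  have "g [^] (j - i) \<otimes> g [^] i = g [^] j" using g ij(1) by (simp add: nat_pow_mult)
  then have "g [^] (j - i) = h" using h g H.mem_carrier[OF h(1)] right_cancel[of "g [^] i" "g [^] (j - i)" h] by simp
  then have gH: "g [^] (j - i) \<in> H" using h by simp
  have "(j - i) dvd fact ?d" using ij by (intro dvd_fact) auto
  then obtain m where "fact ?d = (j - i) * m" by blast
  then have "g [^] (fact ?d :: nat) = (g [^] (j - i)) [^] m" using g by (simp add: nat_pow_pow)
  also have "\<dots> \<in> H" by (induction m) (use gH in auto)
  finally show ?thesis .
qed

end

lemma finite_image_if_key:
  assumes fin: "finite (k ` D)" and key: "\<And>x y. x \<in> D \<Longrightarrow> y \<in> D \<Longrightarrow> k x = k y \<Longrightarrow> f x = f y"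
  shows "finite (f ` D)"
proof -
  have "f ` D \<subseteq> (\<lambda>c. f (SOME x. x \<in> D \<and> k x = c)) ` k ` D"
  proof
    fix y assume "y \<in> f ` D"
    then obtain x where x: "x \<in> D" "y = f x" by blast
    then have "(SOME z. z \<in> D \<and> k z = k x) \<in> D \<and> k (SOME z. z \<in> D \<and> k z = k x) = k x"
      by (intro someI[where P = "\<lambda>z. z \<in> D \<and> k z = k x"]) simp
    then have "y = f (SOME z. z \<in> D \<and> k z = k x)" using key x by metis
    then show "y \<in> (\<lambda>c. f (SOME x. x \<in> D \<and> k x = c)) ` k ` D" using x by blast
  qed
  then show ?thesis using fin by (meson finite_imageI finite_subset)
qed

text \<open>Dividing \<open>N\<close> by common divisors with \<open>p\<close> as long as there are any leaves \<open>N'\<close>.\<close>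

lemma coprime_part:
  fixes N p :: nat assumes "N > 0" "p > 0"
  shows "\<exists>N' k. N' > 0 \<and> coprime N' p \<and> N dvd N' * p ^ k"
  using assms(1)
proof (induction N rule: less_induct)
  case (less N)
  show ?case
  proof (cases "coprime N p")
    case True
    then show ?thesis using less.prems by (intro exI[of _ N] exI[of _ 0]) auto
  next
    case False
    define g where "g = gcd N p"
    have g: "g > 1" "g dvd N" "g dvd p"
    proof -
      have "gcd N p \<noteq> 1" using False by (simp add: coprime_iff_gcd_eq_1)
      moreover have "gcd N p > 0" using less.prems by simp
      ultimately show "g > 1" unfolding g_def by linarith
    qed (simp_all add: g_def)
    then obtain m where m: "N = g * m" by blast
    have "m < N" "m > 0" using m g less.prems by (auto simp: n_less_m_mult_n)
    then obtain N' k where N': "N' > 0" "coprime N' p" "m dvd N' * p ^ k" using less.IH by blast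
    have "N dvd p * (N' * p ^ k)" unfolding m using g(3) N'(3) by (intro mult_dvd_mono)
    then have "N dvd N' * p ^ Suc k" by (simp add: algebra_simps)
    then show ?thesis using N' by blast
  qed
qed

section \<open>Transvections\<close>

(* entries of products are computed with sums instead of scalar products, see mult_mat_index *)
declare index_mult_mat(1) [simp del]

abbreviation ebasis :: "nat \<Rightarrow> nat \<Rightarrow> 'a::comm_ring_1" where
  "ebasis i \<equiv> (\<lambda>k. if k = i then 1 else 0)"

definition pairing :: "nat \<Rightarrow> (nat \<Rightarrow> 'a::comm_ring_1) \<Rightarrow> (nat \<Rightarrow> 'a) \<Rightarrow> 'a" where
  "pairing n v u = (\<Sum>k<n. v k * u k)"

text \<open>The matrix \<open>1 + u v\<^sup>T\<close>, a transvection when \<open>pairing n v u = 0\<close>. Vectors are functions of which only the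
values below \<open>n\<close> matter.\<close>

definition transv :: "nat \<Rightarrow> (nat \<Rightarrow> 'a::comm_ring_1) \<Rightarrow> (nat \<Rightarrow> 'a) \<Rightarrow> 'a mat" where
  "transv n u v = Matrix.mat n n (\<lambda>(i, j). (if i = j then 1 else 0) + u i * v j)"

definition elmat :: "nat \<Rightarrow> nat \<Rightarrow> nat \<Rightarrow> 'a::comm_ring_1 \<Rightarrow> 'a mat" where
  "elmat n i j a = transv n (ebasis i) (\<lambda>k. a * ebasis j k)"

lemma transv_carrier [simp]: "transv n u v \<in> carrier_mat n n" "dim_row (transv n u v) = n" "dim_col (transv n u v) = n"
  by (simp_all add: transv_def)

lemma transv_index [simp]: "i < n \<Longrightarrow> j < n \<Longrightarrow> transv n u v $$ (i, j) = (if i = j then 1 else 0) + u i * v j"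
  by (simp add: transv_def)

lemma transv_cong:
  "(\<And>i j. i < n \<Longrightarrow> j < n \<Longrightarrow> u i * v j = u' i * v' j) \<Longrightarrow> transv n u v = transv n u' v'"
  by (intro eq_matI) auto

lemma elmat_eq_addrow: "i \<noteq> j \<Longrightarrow> elmat n i j a = addrow_mat n a i j"
  by (intro eq_matI) (auto simp: addrow_mat_def elmat_def)

lemma elmat_carrier [simp]: "elmat n i j a \<in> carrier_mat n n" "dim_row (elmat n i j a) = n" "dim_col (elmat n i j a) = n"
  by (simp_all add: elmat_def)

lemma elmat_index [simp]: "k < n \<Longrightarrow> l < n \<Longrightarrow> elmat n i j a $$ (k, l) = (if k = l then 1 else 0) + (if k = i \<and> l = j then a else 0)"
  by (auto simp: elmat_def)

lemma det_elmat: "i \<noteq> j \<Longrightarrow> Determinant.det (elmat n i j a) = 1"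
  by (simp add: elmat_eq_addrow det_addrow_mat)

lemma mult_mat_index:
  "A \<in> carrier_mat n n \<Longrightarrow> B \<in> carrier_mat n n \<Longrightarrow> i < n \<Longrightarrow> j < n \<Longrightarrow>
    (A * B) $$ (i, j) = (\<Sum>k<n. A $$ (i, k) * B $$ (k, j))"
  by (simp add: index_mult_mat(1) scalar_prod_def lessThan_atLeast0)

lemma transv_mult_index:
  assumes "A \<in> carrier_mat n n" "i < n" "j < n"
  shows "(transv n u v * A) $$ (i, j) = A $$ (i, j) + u i * (\<Sum>k<n. v k * A $$ (k, j))"
proof -
  have "(transv n u v * A) $$ (i, j) = (\<Sum>k<n. (if i = k then A $$ (k, j) else 0) + u i * (v k * A $$ (k, j)))"
    unfolding mult_mat_index[OF transv_carrier(1) assms] using assms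
    by (intro sum.cong) (auto simp: algebra_simps)
  also have "\<dots> = A $$ (i, j) + u i * (\<Sum>k<n. v k * A $$ (k, j))"
    using assms by (simp add: sum.distrib sum_distrib_left)
  finally show ?thesis .
qed

lemma mult_transv_index:
  assumes "A \<in> carrier_mat n n" "i < n" "j < n"
  shows "(A * transv n u v) $$ (i, j) = A $$ (i, j) + (\<Sum>k<n. A $$ (i, k) * u k) * v j"
proof -
  have "(A * transv n u v) $$ (i, j) = (\<Sum>k<n. (if j = k then A $$ (i, k) else 0) + (A $$ (i, k) * u k) * v j)"
    unfolding mult_mat_index[OF assms(1) transv_carrier(1) assms(2,3)] using assms
    by (intro sum.cong) (auto simp: algebra_simps)
  also have "\<dots> = A $$ (i, j) + (\<Sum>k<n. A $$ (i, k) * u k) * v j"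
    using assms by (simp add: sum.distrib sum_distrib_right)
  finally show ?thesis .
qed

lemma pairing_ebasis [simp]: "k < n \<Longrightarrow> pairing n v (ebasis k) = v k" "k < n \<Longrightarrow> pairing n (ebasis k) u = u k"
  by (simp_all add: pairing_def if_distrib[of "\<lambda>x. _ * x"] if_distrib[of "\<lambda>x. x * _"] cong: if_cong)

lemma pairing_scale [simp]: "pairing n (\<lambda>k. a * v k) u = a * pairing n v u" "pairing n v (\<lambda>k. a * u k) = a * pairing n v u"
  by (simp_all add: pairing_def sum_distrib_left algebra_simps)

lemma transv_mult_transv_index:
  assumes "i < n" "j < n"
  shows "(transv n u v * transv n u' v') $$ (i, j) =
    (if i = j then 1 else 0) + u i * v j + u' i * v' j + u i * pairing n v u' * v' j"
proof -
  have "(\<Sum>k<n. v k * transv n u' v' $$ (k, j)) = (\<Sum>k<n. (if k = j then v j else 0) + v k * u' k * v' j)"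
    using assms by (intro sum.cong) (auto simp: algebra_simps)
  also have "\<dots> = v j + pairing n v u' * v' j"
    using assms by (simp add: sum.distrib sum_distrib_right pairing_def)
  finally show ?thesis
    unfolding transv_mult_index[OF transv_carrier(1) assms] using assms by (simp add: algebra_simps)
qed

lemma transv_add_right:
  "pairing n v u = 0 \<Longrightarrow> transv n u v * transv n u w = transv n u (\<lambda>k. v k + w k)"
  by (intro eq_matI) (auto simp: transv_mult_transv_index algebra_simps)

lemma transv_add_left:
  "pairing n v w = 0 \<Longrightarrow> transv n u v * transv n w v = transv n (\<lambda>k. u k + w k) v"
  by (intro eq_matI) (auto simp: transv_mult_transv_index algebra_simps)

lemma transv_zero [simp]: "transv n (\<lambda>k. 0) v = 1\<^sub>m n" "transv n u (\<lambda>k. 0) = 1\<^sub>m n"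
  by (intro eq_matI; simp)+

lemma elmat_add: "i \<noteq> j \<Longrightarrow> i < n \<Longrightarrow> elmat n i j a * elmat n i j b = elmat n i j (a + b)"
  unfolding elmat_def by (subst transv_add_right) (simp_all add: algebra_simps)

text \<open>Up to order, this says that the commutator of the matrices on the left is \<open>transv n x v\<close>; it is stated
without inverses so that it needs no invertibility.\<close>

lemma transv_commutator:
  assumes "pairing n v x = 0" "k < n"
  shows "transv n x (ebasis k) * transv n (ebasis k) v
       = transv n (ebasis k) v * (transv n x v * transv n x (ebasis k))"
proof -
  have 1: "transv n x v * transv n x (ebasis k) = transv n x (\<lambda>j. v j + ebasis k j)"
    by (rule transv_add_right[OF assms(1)])
  have "pairing n v x = 0" by fact
  then show ?thesis unfolding 1
    using assms(2) by (intro eq_matI) (auto simp: transv_mult_transv_index assms(1) algebra_simps)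
qed

lemma transv_commute:
  assumes "pairing n v u' = 0" "pairing n v' u = 0"
  shows "transv n u v * transv n u' v' = transv n u' v' * transv n u v"
  by (intro eq_matI) (auto simp: transv_mult_transv_index assms)

lemma transv_conj:
  assumes A: "A \<in> carrier_mat n n" "B \<in> carrier_mat n n" "A * B = 1\<^sub>m n"
  shows "A * transv n u v * B = transv n (\<lambda>i. \<Sum>k<n. A $$ (i, k) * u k) (\<lambda>j. \<Sum>k<n. v k * B $$ (k, j))"
    (is "_ = transv n ?u ?v")
proof (rule eq_matI)
  fix i j assume "i < dim_row (transv n ?u ?v)" "j < dim_col (transv n ?u ?v)"
  then have ij: "i < n" "j < n" by auto
  have c: "A * transv n u v \<in> carrier_mat n n" using A by (intro mult_carrier_mat) auto
  have "(A * transv n u v * B) $$ (i, j) = (\<Sum>k<n. (A $$ (i, k) + ?u i * v k) * B $$ (k, j))"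
    unfolding mult_mat_index[OF c A(2) ij]
    using A ij by (intro sum.cong refl) (simp add: mult_transv_index)
  also have "\<dots> = (\<Sum>k<n. A $$ (i, k) * B $$ (k, j)) + ?u i * ?v j"
    by (simp add: sum.distrib sum_distrib_left algebra_simps)
  also have "(\<Sum>k<n. A $$ (i, k) * B $$ (k, j)) = (A * B) $$ (i, j)"
    by (rule mult_mat_index[OF A(1,2) ij, symmetric])
  finally show "(A * transv n u v * B) $$ (i, j) = transv n ?u ?v $$ (i, j)" using ij A(3) by simp
qed (use A in auto)

lemma elmat_0 [simp]: "elmat n i j 0 = 1\<^sub>m n"
  by (simp add: elmat_def)

section \<open>The special linear group\<close>

text \<open>Both rings at once: \<open>ip\<close> is the inverse of \<open>p\<close>, and \<open>p = 1\<close> gives the integers.\<close>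

locale sl_ring =
  fixes R :: "'a::comm_ring_1 set" and p :: nat and ip :: 'a and n :: nat
  assumes n3: "n \<ge> 3" and pip: "of_nat p * ip = 1" and R_def: "R = {of_int a * ip ^ k | a k. True}"
begin

lemma ppow: "of_nat p ^ k * ip ^ k = 1"
  by (metis pip power_mult_distrib power_one)

lemma R_I: "of_int a * ip ^ k \<in> R"
  by (auto simp: R_def)

lemma R_of_int [simp]: "of_int a \<in> R"
  using R_I[of a 0] by simp

lemma R_0 [simp]: "0 \<in> R" and R_1 [simp]: "1 \<in> R" and R_of_nat [simp]: "of_nat m \<in> R" and R_ip [simp]: "ip \<in> R"
  using R_of_int[of 0] R_of_int[of 1] R_of_int[of "int m"] R_I[of 1 1] by (simp_all del: R_of_int)

lemma R_mult [simp]: assumes "x \<in> R" "y \<in> R" shows "x * y \<in> R"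
proof -
  obtain a k b l where "x = of_int a * ip ^ k" "y = of_int b * ip ^ l" using assms by (auto simp: R_def)
  then have "x * y = of_int (a * b) * ip ^ (k + l)" by (simp add: power_add algebra_simps)
  then show ?thesis by (simp only: R_I)
qed

lemma R_raise: "of_int a * ip ^ k = of_int (a * int p ^ l) * ip ^ (k + l)"
proof -
  have "of_int (a * int p ^ l) * ip ^ (k + l) = of_int a * ip ^ k * (of_nat p ^ l * ip ^ l)"
    by (simp add: power_add algebra_simps)
  then show ?thesis by (simp add: ppow)
qed

lemma R_add [simp]: assumes "x \<in> R" "y \<in> R" shows "x + y \<in> R"
proof -
  obtain a k b l where "x = of_int a * ip ^ k" "y = of_int b * ip ^ l" using assms by (auto simp: R_def)
  then have "x + y = of_int (a * int p ^ l + b * int p ^ k) * ip ^ (k + l)"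
    using R_raise[of a k l] R_raise[of b l k] by (simp add: algebra_simps)
  then show ?thesis by (simp only: R_I)
qed

lemma R_uminus [simp]: "x \<in> R \<Longrightarrow> - x \<in> R"
  using R_mult[of "-1" x] R_of_int[of "-1"] by simp

lemma R_diff [simp]: "x \<in> R \<Longrightarrow> y \<in> R \<Longrightarrow> x - y \<in> R"
  using R_add[of x "- y"] by simp

lemma R_sum [simp]: "(\<And>i. i \<in> I \<Longrightarrow> f i \<in> R) \<Longrightarrow> sum f I \<in> R"
  by (induction I rule: infinite_finite_induct) auto

lemma R_prod [simp]: "(\<And>i. i \<in> I \<Longrightarrow> f i \<in> R) \<Longrightarrow> prod f I \<in> R"
  by (induction I rule: infinite_finite_induct) auto

abbreviation "G \<equiv> SL n R"
abbreviation "ginv \<equiv> m_inv (SL n R)"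

lemma carrier_G: "A \<in> carrier G \<longleftrightarrow> A \<in> carrier_mat n n \<and> (\<forall>i<n. \<forall>j<n. A $$ (i, j) \<in> R) \<and> Determinant.det A = 1"
  by (auto simp: SL_def dest!: elements_matD intro: elements_matI)

lemma mult_G [simp]: "x \<otimes>\<^bsub>G\<^esub> y = x * y" and one_G [simp]: "\<one>\<^bsub>G\<^esub> = 1\<^sub>m n"
  by (simp_all add: SL_def)

lemma det_in_R:
  assumes "A \<in> carrier_mat m m" "\<And>i j. i < m \<Longrightarrow> j < m \<Longrightarrow> A $$ (i, j) \<in> R"
  shows "Determinant.det A \<in> R"
proof -
  have "signof q \<in> R" for q by (simp add: sign_def)
  then show ?thesis unfolding det_def'[OF assms(1)] using assms(2)
    by (intro R_sum R_mult R_prod) (auto dest: permutes_in_image)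
qed

lemma adj_in_R:
  assumes "A \<in> carrier G" "i < n" "j < n"
  shows "adj_mat A $$ (i, j) \<in> R"
proof -
  have A: "A \<in> carrier_mat n n" "\<And>i j. i < n \<Longrightarrow> j < n \<Longrightarrow> A $$ (i, j) \<in> R" using assms by (auto simp: carrier_G)
  have "Determinant.det (mat_delete A j i) \<in> R"
  proof (rule det_in_R)
    show "mat_delete A j i \<in> carrier_mat (n - 1) (n - 1)" using mat_delete_carrier[OF A(1)] .
    show "mat_delete A j i $$ (k, l) \<in> R" if "k < n - 1" "l < n - 1" for k l
      using A that by (auto simp: mat_delete_def)
  qed
  moreover have "(- 1) ^ m \<in> R" for m by (induction m) auto
  ultimately show ?thesis using A assms by (simp add: adj_mat_def cofactor_def)
qed

sublocale G: Group.group G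
proof (rule groupI)
  fix x y assume "x \<in> carrier G" "y \<in> carrier G"
  then show "x \<otimes>\<^bsub>G\<^esub> y \<in> carrier G"
    by (auto simp: carrier_G mult_mat_index det_mult[of _ n] intro!: R_sum R_mult)
next
  fix x assume x: "x \<in> carrier G"
  then have xc: "x \<in> carrier_mat n n" "Determinant.det x = 1" by (auto simp: carrier_G)
  have inv: "adj_mat x * x = 1\<^sub>m n" using adj_mat(3)[OF xc(1)] xc(2) by auto
  then have "Determinant.det (adj_mat x) * Determinant.det x = 1"
    using det_mult[OF adj_mat(1)[OF xc(1)] xc(1)] by simp
  then have "adj_mat x \<in> carrier G" using adj_in_R[OF x] adj_mat(1)[OF xc(1)] xc(2) by (auto simp: carrier_G)
  then show "\<exists>y\<in>carrier G. y \<otimes>\<^bsub>G\<^esub> x = \<one>\<^bsub>G\<^esub>" using inv by auto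
qed (auto simp: carrier_G assoc_mult_mat[of _ n n _ n _ n])

lemma elmat_in_G: "i \<noteq> j \<Longrightarrow> a \<in> R \<Longrightarrow> elmat n i j a \<in> carrier G"
  by (simp add: carrier_G det_elmat)

lemma G_carrier_mat: "x \<in> carrier G \<Longrightarrow> x \<in> carrier_mat n n"
  by (simp add: carrier_G)

lemma transv_commutator_mem:
  assumes M: "subgroup M G" and a: "transv n x (ebasis k) \<in> M" and b: "transv n (ebasis k) v \<in> M"
    and vx: "pairing n v x = 0" and k: "k < n"
  shows "transv n x v \<in> M"
proof -
  interpret M: subgroup M G by fact
  let ?a = "transv n x (ebasis k)" and ?b = "transv n (ebasis k) v" and ?c = "transv n x v"
  have ab: "?a \<in> carrier G" "?b \<in> carrier G" using a b M.subset by auto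
  have eq: "?a * ?b = ?b * (?c * ?a)" by (rule transv_commutator[OF vx k])
  have inva: "?a * (ginv ?a) = 1\<^sub>m n" and invb: "(ginv ?b) * ?b = 1\<^sub>m n"
    using G.r_inv[OF ab(1)] G.l_inv[OF ab(2)] by simp_all
  have cm: "ginv ?a \<in> carrier_mat n n" "ginv ?b \<in> carrier_mat n n"
    using ab by (auto intro!: G_carrier_mat)
  have "ginv ?b * (?a * ?b) * ginv ?a = (ginv ?b * ?b) * ?c * (?a * ginv ?a)"
    unfolding eq using cm
    by (simp add: assoc_mult_mat[of _ n n _ n _ n] mult_carrier_mat[of _ n n _ n])
  also have "\<dots> = ?c" unfolding inva invb by simp
  finally have "?c = ginv ?b * (?a * ?b) * ginv ?a" by simp
  also have "\<dots> \<in> M" using M.m_closed a b M.m_inv_closed by (metis mult_G)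
  finally show ?thesis .
qed

lemma transv_sum_right_mem:
  assumes M: "subgroup M G" and "finite I"
    and "\<And>i. i \<in> I \<Longrightarrow> transv n u (v i) \<in> M" "\<And>i. i \<in> I \<Longrightarrow> pairing n (v i) u = 0"
  shows "transv n u (\<lambda>k. \<Sum>i\<in>I. v i k) \<in> M"
  using assms(2-)
proof (induction I)
  case empty
  then show ?case using subgroup.one_closed[OF M] by simp
next
  case (insert i I)
  then have "transv n u (v i) * transv n u (\<lambda>k. \<Sum>i\<in>I. v i k) \<in> M"
    using subgroup.m_closed[OF M, of "transv n u (v i)" "transv n u (\<lambda>k. \<Sum>i\<in>I. v i k)"] by simp
  then show ?case using insert by (simp add: transv_add_right)
qed

lemma transv_sum_left_mem:
  assumes M: "subgroup M G" and "finite I"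
    and "\<And>i. i \<in> I \<Longrightarrow> transv n (u i) v \<in> M" "\<And>i. i \<in> I \<Longrightarrow> pairing n v (u i) = 0"
  shows "transv n (\<lambda>k. \<Sum>i\<in>I. u i k) v \<in> M"
  using assms(2-)
proof (induction I)
  case empty
  then show ?case using subgroup.one_closed[OF M] by simp
next
  case (insert i I)
  have "pairing n v (\<lambda>k. \<Sum>i\<in>I. u i k) = (\<Sum>i\<in>I. pairing n v (u i))"
    unfolding pairing_def by (simp add: sum_distrib_left) (rule sum.swap)
  then have 0: "pairing n v (\<lambda>k. \<Sum>i\<in>I. u i k) = 0" using insert.prems by simp
  have "transv n (u i) v * transv n (\<lambda>k. \<Sum>i\<in>I. u i k) v \<in> M"
    using insert subgroup.m_closed[OF M, of "transv n (u i) v" "transv n (\<lambda>k. \<Sum>i\<in>I. u i k) v"] by simp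
  then show ?case using insert 0 by (simp add: transv_add_left)
qed

lemma elmat_commutator_mem:
  assumes M: "subgroup M G" and "elmat n i k a \<in> M" "elmat n k j b \<in> M" "i \<noteq> k" "k \<noteq> j" "i \<noteq> j" "i < n" "k < n" "j < n"
  shows "elmat n i j (a * b) \<in> M"
proof -
  have "transv n (\<lambda>l. a * ebasis i l) (ebasis k) \<in> M"
    using assms(2) unfolding elmat_def by (subst transv_cong[where u' = "ebasis i" and v' = "\<lambda>l. a * ebasis k l"]) auto
  then have "transv n (\<lambda>l. a * ebasis i l) (\<lambda>l. b * ebasis j l) \<in> M"
    by (rule transv_commutator_mem[OF M _ assms(3)[unfolded elmat_def]]) (use assms in simp_all)
  then show ?thesis unfolding elmat_def
    by (subst transv_cong[where u' = "\<lambda>l. a * ebasis i l" and v' = "\<lambda>l. b * ebasis j l"]) auto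
qed


section \<open>Generation by elementary matrices\<close>

lemma common_denominator:
  assumes "finite I" "\<And>i. i \<in> I \<Longrightarrow> c i \<in> R"
  shows "\<exists>k z. \<forall>i\<in>I. c i = of_int (z i) * ip ^ k"
  using assms
proof (induction I)
  case (insert x I)
  then obtain k z where kz: "\<And>i. i \<in> I \<Longrightarrow> c i = of_int (z i) * ip ^ k" by auto
  have "c x \<in> R" using insert.prems by simp
  then obtain a l where al: "c x = of_int a * ip ^ l" by (auto simp: R_def)
  have "c i = of_int ((if i = x then a * int p ^ k else z i * int p ^ l)) * ip ^ (k + l)" if "i \<in> insert x I" for i
    using that insert.hyps kz[of i] al R_raise[of "z i" k l] R_raise[of a l k] by (auto simp: add.commute)
  then show ?case by (intro exI[of _ "k + l"] exI[of _ "\<lambda>i. if i = x then a * int p ^ k else z i * int p ^ l"]) blast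
qed auto

lemma euclid_step: 
  fixes x y :: int
  assumes "y \<noteq> 0" "\<bar>y\<bar> \<le> \<bar>x\<bar>"
  shows "\<exists>s. \<bar>x + s * y\<bar> < \<bar>x\<bar>"
proof (cases "(x > 0) = (y > 0)")
  case True then show ?thesis using assms by (intro exI[of _ "-1"]) auto
next
  case False then show ?thesis using assms by (intro exI[of _ 1]) auto
qed

text \<open>The Euclidean algorithm as an induction rule for predicates on vectors: if a predicate is inherited backwards
along elementary row operations, it suffices to prove it for vectors with at most one nonzero entry. The
measure is the sum of the absolute values of the numerators over a common denominator.\<close>

lemma euclid_induct [consumes 3, case_names step base]:
  assumes fin: "finite I" and a: "a \<in> I" and c: "\<And>i. i \<in> I \<Longrightarrow> c i \<in> R"
    and step: "\<And>c i j r. \<lbrakk>i \<in> I; j \<in> I; i \<noteq> j; r \<in> R; \<And>i. i \<in> I \<Longrightarrow> c i \<in> R; Q (c(i := c i + r * c j))\<rbrakk> \<Longrightarrow> Q c"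
    and base: "\<And>c. \<lbrakk>\<And>i. i \<in> I \<Longrightarrow> c i \<in> R; \<And>i. i \<in> I \<Longrightarrow> i \<noteq> a \<Longrightarrow> c i = 0\<rbrakk> \<Longrightarrow> Q c"
  shows "Q c"
proof -
  obtain k z where "\<And>i. i \<in> I \<Longrightarrow> c i = of_int (z i) * ip ^ k"
    using common_denominator[of I c] fin c by blast
  then show ?thesis
  proof (induction "\<Sum>i\<in>I. nat \<bar>z i\<bar>" arbitrary: z c rule: less_induct)
    case less
    have cR: "c i \<in> R" if "i \<in> I" for i using less.prems[OF that] R_I by simp
    show ?case
    proof (cases "\<exists>i\<in>I. \<exists>j\<in>I. i \<noteq> j \<and> z i \<noteq> 0 \<and> z j \<noteq> 0")
      case True
      then obtain i j where ij: "i \<in> I" "j \<in> I" "i \<noteq> j" "z j \<noteq> 0" "\<bar>z j\<bar> \<le> \<bar>z i\<bar>"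
        by (metis linear)
      obtain s where s: "\<bar>z i + s * z j\<bar> < \<bar>z i\<bar>" using euclid_step[OF ij(4,5)] by blast
      let ?z = "z(i := z i + s * z j)"
      have "(\<Sum>l\<in>I. nat \<bar>?z l\<bar>) < (\<Sum>l\<in>I. nat \<bar>z l\<bar>)"
        by (rule sum_strict_mono_ex1) (use fin ij s in auto)
      moreover have "(c(i := c i + of_int s * c j)) l = of_int (?z l) * ip ^ k" if "l \<in> I" for l
        using less.prems ij that by (simp add: algebra_simps)
      ultimately have "Q (c(i := c i + of_int s * c j))" by (rule less.hyps)
      then show ?thesis by (rule step[rotated 5]) (use ij cR in auto)
    next
      case False
      show ?thesis
      proof (cases "\<exists>j\<in>I. j \<noteq> a \<and> z j \<noteq> 0")
        case True
        then obtain j where j: "j \<in> I" "j \<noteq> a" "z j \<noteq> 0" by blast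
        (* the only nonzero entry is in the wrong place; two row operations move it from j to a *)
        have z0: "z i = 0" if "i \<in> I" "i \<noteq> j" for i using False j that by blast
        let ?c = "c(a := c a + 1 * c j)"
        let ?c' = "?c(j := ?c j + (-1) * ?c a)"
        have "Q ?c'"
        proof (rule base)
          fix i assume "i \<in> I" then show "?c' i \<in> R" using j a cR by auto
          assume "i \<noteq> a"
          then show "?c' i = 0"
            using \<open>i \<in> I\<close> z0[of i] less.prems[of i] less.prems[of a] z0[of a] a j(1,2) by (cases "i = j") simp_all
        qed
        then have "Q ?c" by (rule step[rotated 5]) (use j a cR in auto)
        then show ?thesis by (rule step[rotated 5]) (use j a cR in auto)
      next
        case False
        then show ?thesis using less.prems cR by (intro base) auto
      qed
    qed
  qed
qed

lemma elmat_mult_index: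
  assumes "A \<in> carrier_mat n n" "k < n" "l < n" "j < n"
  shows "(elmat n i j r * A) $$ (k, l) = A $$ (k, l) + (if k = i then r * A $$ (j, l) else 0)"
proof -
  have "(\<Sum>m<n. r * ebasis j m * A $$ (m, l)) = (\<Sum>m<n. if m = j then r * A $$ (j, l) else 0)"
    by (intro sum.cong) auto
  then show ?thesis unfolding elmat_def transv_mult_index[OF assms(1-3)] using assms by simp
qed

lemma mult_elmat_index:
  assumes "A \<in> carrier_mat n n" "k < n" "l < n" "i < n"
  shows "(A * elmat n i j r) $$ (k, l) = A $$ (k, l) + (if l = j then r * A $$ (k, i) else 0)"
proof -
  have "(\<Sum>m<n. A $$ (k, m) * ebasis i m) = (\<Sum>m<n. if m = i then A $$ (k, i) else 0)"
    by (intro sum.cong) auto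
  then show ?thesis unfolding elmat_def mult_transv_index[OF assms(1-3)] using assms by simp
qed

lemma left_mult_mem:
  assumes "subgroup M G" "g \<in> M" "x \<in> carrier G" "g * x \<in> M"
  shows "x \<in> M"
proof -
  interpret M: subgroup M G by fact
  have g: "g \<in> carrier G" using assms M.subset by auto
  have "x = ginv g \<otimes>\<^bsub>G\<^esub> (g \<otimes>\<^bsub>G\<^esub> x)" using g assms(3) by (simp only: G.inv_solve_left' G.m_assoc[symmetric] G.inv_closed G.l_inv G.l_one)
  also have "\<dots> \<in> M" using assms M.m_inv_closed M.m_closed by simp
  finally show ?thesis .
qed

lemma transv_column_mem:
  assumes M: "subgroup M G" and "\<And>i. i < n \<Longrightarrow> i \<noteq> k \<Longrightarrow> elmat n i k (x i) \<in> M" and "k < n" and "x k = 0"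
  shows "transv n x (ebasis k) \<in> M"
proof -
  have "transv n (\<lambda>l. \<Sum>i\<in>{..<n}-{k}. x i * ebasis i l) (ebasis k) \<in> M"
  proof (rule transv_sum_left_mem[OF M])
    fix i assume i: "i \<in> {..<n} - {k}"
    then have "elmat n i k (x i) \<in> M" using assms by auto
    then show "transv n (\<lambda>l. x i * ebasis i l) (ebasis k) \<in> M"
      unfolding elmat_def by (subst transv_cong[where u' = "ebasis i" and v' = "\<lambda>l. x i * ebasis k l"]) auto
    show "pairing n (ebasis k) (\<lambda>l. x i * ebasis i l) = 0" using i assms by simp
  qed auto
  moreover have "(\<Sum>i\<in>{..<n}-{k}. x i * ebasis i l) = x l" if "l < n" for l
  proof -
    have "(\<Sum>i\<in>{..<n}-{k}. x i * ebasis i l) = (\<Sum>i\<in>{..<n}-{k}. if i = l then x l else 0)"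
      by (intro sum.cong) auto
    then show ?thesis using that assms by (auto simp: sum.delta)
  qed
  ultimately show ?thesis
    by (subst transv_cong[where u' = "\<lambda>l. \<Sum>i\<in>{..<n}-{k}. x i * ebasis i l" and v' = "ebasis k"]) auto
qed

lemma transv_row_mem:
  assumes M: "subgroup M G" and "\<And>j. j < n \<Longrightarrow> j \<noteq> k \<Longrightarrow> elmat n k j (y j) \<in> M" and "k < n" and "y k = 0"
  shows "transv n (ebasis k) y \<in> M"
proof -
  have "transv n (ebasis k) (\<lambda>l. \<Sum>i\<in>{..<n}-{k}. y i * ebasis i l) \<in> M"
  proof (rule transv_sum_right_mem[OF M])
    fix i assume i: "i \<in> {..<n} - {k}"
    then show "transv n (ebasis k) (\<lambda>l. y i * ebasis i l) \<in> M"
      using assms(2)[of i] unfolding elmat_def by auto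
    show "pairing n (\<lambda>l. y i * ebasis i l) (ebasis k) = 0" using i assms by simp
  qed auto
  moreover have "(\<Sum>i\<in>{..<n}-{k}. y i * ebasis i l) = y l" if "l < n" for l
  proof -
    have "(\<Sum>i\<in>{..<n}-{k}. y i * ebasis i l) = (\<Sum>i\<in>{..<n}-{k}. if i = l then y l else 0)"
      by (intro sum.cong) auto
    then show ?thesis using that assms by (auto simp: sum.delta)
  qed
  ultimately show ?thesis
    by (subst transv_cong[where u' = "ebasis k" and v' = "\<lambda>l. \<Sum>i\<in>{..<n}-{k}. y i * ebasis i l"]) auto
qed

text \<open>Row operations make the columns standard one after the other. The Euclidean algorithm on the rows from \<open>k\<close>
on leaves a single entry there, which is a unit by the inverse matrix; with another row below it, two
operations turn it into \<open>1\<close>, and for the last column it is \<open>1\<close> because of the determinant.\<close>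

lemma SL_generated_by_elementary:
  assumes M: "subgroup M G" and el: "\<And>i j r. \<lbrakk>i < n; j < n; i \<noteq> j; r \<in> R\<rbrakk> \<Longrightarrow> elmat n i j r \<in> M"
  shows "carrier G \<subseteq> M"
proof -
  have main: "\<forall>g\<in>carrier G. (\<forall>j<k. \<forall>i<n. g $$ (i, j) = ebasis j i) \<longrightarrow> g \<in> M" if "k \<le> n" for k
    using that
  proof (induction k rule: inc_induct)
    case base
    show ?case
    proof (intro ballI impI)
      fix g assume g: "g \<in> carrier G" "\<forall>j<n. \<forall>i<n. g $$ (i, j) = ebasis j i"
      then have "g = 1\<^sub>m n" by (intro eq_matI) (auto simp: carrier_G)
      then show "g \<in> M" using subgroup.one_closed[OF M] by simp
    qed
  next
    case (step k)
    have std: "g \<in> M" if g: "g \<in> carrier G" "\<forall>j<k. \<forall>i<n. g $$ (i, j) = ebasis j i" "\<forall>i<n. g $$ (i, k) = ebasis k i" for g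
      using step.IH g less_Suc_eq by auto
    have pivot_one: "g \<in> M" if g: "g \<in> carrier G" "\<forall>j<k. \<forall>i<n. g $$ (i, j) = ebasis j i" "g $$ (k, k) = 1" for g
    proof -
      define x where "x i = (if i = k then 0 else - g $$ (i, k))" for i
      have gc: "g \<in> carrier_mat n n" and gR: "\<And>i j. i < n \<Longrightarrow> j < n \<Longrightarrow> g $$ (i, j) \<in> R" using g by (auto simp: carrier_G)
      let ?t = "transv n x (ebasis k)"
      have t: "?t \<in> M" 
        by (rule transv_column_mem[OF M]) (use gR step.hyps in \<open>auto simp: x_def intro!: el\<close>)
      have idx: "(?t * g) $$ (i, j) = g $$ (i, j) + x i * g $$ (k, j)" if "i < n" "j < n" for i j
      proof -
        have "(\<Sum>m<n. ebasis k m * g $$ (m, j)) = (\<Sum>m<n. if m = k then g $$ (k, j) else 0)"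
          by (intro sum.cong) auto
        then show ?thesis unfolding transv_mult_index[OF gc that] using step.hyps by simp
      qed
      have "?t \<otimes>\<^bsub>G\<^esub> g \<in> carrier G" using t g subgroup.subset[OF M] by (intro G.m_closed) auto
      then have "?t * g \<in> carrier G" by simp
      then have "?t * g \<in> M"
        by (rule std) (use step.hyps g in \<open>auto simp: idx x_def\<close>)
      then show ?thesis using left_mult_mem[OF M t g(1)] by blast
    qed
    define Q where "Q c \<longleftrightarrow> (\<forall>g\<in>carrier G. (\<forall>j<k. \<forall>i<n. g $$ (i, j) = ebasis j i) \<longrightarrow> (\<forall>i<n. k \<le> i \<longrightarrow> g $$ (i, k) = c i) \<longrightarrow> g \<in> M)" for c
    show ?case
    proof (intro ballI impI)
      fix g assume g: "g \<in> carrier G" "\<forall>j<k. \<forall>i<n. g $$ (i, j) = ebasis j i"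
      have "Q (\<lambda>i. g $$ (i, k))"
      proof (rule euclid_induct[of "{k..<n}" k])
        show "g $$ (i, k) \<in> R" if "i \<in> {k..<n}" for i using g that step.hyps by (auto simp: carrier_G)
      next
        fix c i j and r assume ij: "i \<in> {k..<n}" "j \<in> {k..<n}" "i \<noteq> j" "r \<in> R" and Q: "Q (c(i := c i + r * c j))"
        show "Q c" unfolding Q_def
        proof (intro ballI impI)
          fix g assume g: "g \<in> carrier G" "\<forall>j<k. \<forall>i<n. g $$ (i, j) = ebasis j i" "\<forall>i<n. k \<le> i \<longrightarrow> g $$ (i, k) = c i"
          have e: "elmat n i j r \<in> M" using ij by (intro el) auto
          have "elmat n i j r \<otimes>\<^bsub>G\<^esub> g \<in> carrier G" using e g subgroup.subset[OF M] by (intro G.m_closed) auto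
          then have "elmat n i j r * g \<in> carrier G" by simp
          moreover have "\<forall>j'<k. \<forall>i'<n. (elmat n i j r * g) $$ (i', j') = ebasis j' i'"
            using g ij by (auto simp: elmat_mult_index G_carrier_mat)
          moreover have "\<forall>i'<n. k \<le> i' \<longrightarrow> (elmat n i j r * g) $$ (i', k) = (c(i := c i + r * c j)) i'"
            using g ij by (auto simp: elmat_mult_index G_carrier_mat)
          ultimately have "elmat n i j r * g \<in> M" using Q unfolding Q_def by blast
          then show "g \<in> M" using left_mult_mem[OF M e g(1)] by blast
        qed
      next
        fix c assume cR: "\<And>i. i \<in> {k..<n} \<Longrightarrow> c i \<in> R" and c0: "\<And>i. i \<in> {k..<n} \<Longrightarrow> i \<noteq> k \<Longrightarrow> c i = 0"
        show "Q c" unfolding Q_def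
        proof (intro ballI impI)
          fix g assume g: "g \<in> carrier G" "\<forall>j<k. \<forall>i<n. g $$ (i, j) = ebasis j i" "\<forall>i<n. k \<le> i \<longrightarrow> g $$ (i, k) = c i"
          have gc: "g \<in> carrier_mat n n" and gR: "\<And>i j. i < n \<Longrightarrow> j < n \<Longrightarrow> g $$ (i, j) \<in> R" and gd: "Determinant.det g = 1"
            using g by (auto simp: carrier_G)
          have g0: "g $$ (i, k) = 0" if "i < n" "k < i" for i using g(3) c0[of i] that by auto
          define h where "h = ginv g"
          have h: "h \<in> carrier G" "h * g = 1\<^sub>m n" using G.l_inv[OF g(1)] g by (auto simp: h_def)
          have hc: "h \<in> carrier_mat n n" and hR: "\<And>i j. i < n \<Longrightarrow> j < n \<Longrightarrow> h $$ (i, j) \<in> R" using h by (auto simp: carrier_G)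
          have hg: "(\<Sum>l<n. h $$ (k, l) * g $$ (l, m)) = ebasis k m" if "m < n" for m
            using mult_mat_index[OF hc gc _ that, of k] h(2) step.hyps that by auto
          have hk: "h $$ (k, m) = 0" if "m < k" for m
          proof -
            have "(\<Sum>l<n. h $$ (k, l) * g $$ (l, m)) = (\<Sum>l<n. if l = m then h $$ (k, m) else 0)"
              using g(2) that by (intro sum.cong) auto
            then show ?thesis using hg[of m] that step.hyps by auto
          qed
          have "(\<Sum>l<n. h $$ (k, l) * g $$ (l, k)) = (\<Sum>l<n. if l = k then h $$ (k, k) * g $$ (k, k) else 0)"
            using g0 hk by (intro sum.cong) (auto, metis linorder_neqE_nat mult_zero_left mult_zero_right)
          then have wu: "h $$ (k, k) * g $$ (k, k) = 1" using hg[of k] step.hyps by simp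
          let ?w = "h $$ (k, k)" and ?u = "g $$ (k, k)"
          have wR: "?w \<in> R" "?u \<in> R" using hR gR step.hyps by auto
          show "g \<in> M"
          proof (cases "Suc k < n")
            case True
            let ?e1 = "elmat n (Suc k) k ?w" and ?e2 = "elmat n k (Suc k) (1 - ?u)"
            have e: "?e1 \<in> M" "?e2 \<in> M" using True wR by (auto intro!: el)
            have g1: "?e1 * g \<in> carrier G" using e g G.m_closed[of ?e1 g] subgroup.subset[OF M] by auto
            have g2: "?e2 * (?e1 * g) \<in> carrier G" using e g1 G.m_closed[of ?e2 "?e1 * g"] subgroup.subset[OF M] by auto
            have "?e2 * (?e1 * g) \<in> M"
            proof (rule pivot_one[OF g2])
              show "\<forall>j<k. \<forall>i<n. (?e2 * (?e1 * g)) $$ (i, j) = ebasis j i"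
                using g(2) True G_carrier_mat[OF g1] gc
                by (auto simp: elmat_mult_index)
              show "(?e2 * (?e1 * g)) $$ (k, k) = 1"
                using True G_carrier_mat[OF g1] gc wu g0[of "Suc k"]
                by (auto simp: elmat_mult_index)
            qed
            then have "?e1 * g \<in> M" using left_mult_mem[OF M e(2) g1] by blast
            then show ?thesis using left_mult_mem[OF M e(1) g(1)] by blast
          next
            case False
            then have nk: "n = Suc k" using step.hyps by auto
            have "upper_triangular g" 
              using g(2) gc nk by (auto simp: upper_triangular_def)
            then have "prod_list (diag_mat g) = 1" using det_upper_triangular[OF _ gc] gd by simp
            moreover have "diag_mat g = map (\<lambda>i. g $$ (i, i)) [0..<k] @ [?u]"
              using gc nk by (simp add: diag_mat_def)
            moreover have "map (\<lambda>i. g $$ (i, i)) [0..<k] = map (\<lambda>i. 1) [0..<k]"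
              using g(2) nk by (intro map_cong) auto
            moreover have "prod_list (map (\<lambda>i. 1::'a) [0..<k]) = 1" by (simp add: prod_list_replicate map_replicate_const)
            ultimately have "?u = 1" by simp
            then show ?thesis by (rule pivot_one[OF g(1,2)])
          qed
        qed
      qed (use step.hyps in auto)
      then show "g \<in> M" using g unfolding Q_def by blast
    qed
  qed
  show ?thesis using main[of 0] by auto
qed


section \<open>Congruence subgroups are central modulo elementary matrices\<close>

definition congr :: "nat \<Rightarrow> 'a \<Rightarrow> 'a \<Rightarrow> bool" where
  "congr q x y \<longleftrightarrow> (\<exists>r\<in>R. x = y + of_nat q * r)"

lemma congr_I: "r \<in> R \<Longrightarrow> x = y + of_nat q * r \<Longrightarrow> congr q x y"
  unfolding congr_def by blast

lemma congr_E: assumes "congr q x y" obtains r where "r \<in> R" "x = y + of_nat q * r"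
  using assms unfolding congr_def by blast

lemma congr_refl [simp]: "congr q x x"
  by (rule congr_I[of 0]) auto

lemma congr_add:
  assumes "congr q x y" "congr q x' y'" shows "congr q (x + x') (y + y')"
proof -
  obtain r s where rs: "r \<in> R" "s \<in> R" "x = y + of_nat q * r" "x' = y' + of_nat q * s"
    using assms by (meson congr_E)
  show ?thesis by (rule congr_I[of "r + s"]) (use rs in \<open>auto simp: algebra_simps\<close>)
qed

lemma congr_mult:
  assumes "congr q x y" "congr q x' y'" "y \<in> R" "y' \<in> R"
  shows "congr q (x * x') (y * y')"
proof -
  obtain r s where rs: "r \<in> R" "s \<in> R" "x = y + of_nat q * r" "x' = y' + of_nat q * s"
    using assms by (meson congr_E)
  show ?thesis
  proof (rule congr_I)
    show "y * s + r * y' + of_nat q * r * s \<in> R" using rs assms by simp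
    show "x * x' = y * y' + of_nat q * (y * s + r * y' + of_nat q * r * s)"
      unfolding rs by (simp add: algebra_simps)
  qed
qed

lemma congr_sum: "(\<And>i. i \<in> I \<Longrightarrow> congr q (f i) (g i)) \<Longrightarrow> congr q (sum f I) (sum g I)"
  by (induction I rule: infinite_finite_induct) (auto intro: congr_add)

lemma congr_sym: assumes "congr q x y" shows "congr q y x"
proof -
  obtain r where rs: "r \<in> R" "x = y + of_nat q * r" using assms by (rule congr_E)
  show ?thesis by (rule congr_I[of "- r"]) (use rs in auto)
qed

lemma congr_trans: assumes "congr q x y" "congr q y z" shows "congr q x z"
proof -
  obtain r s where rs: "r \<in> R" "s \<in> R" "x = y + of_nat q * r" "y = z + of_nat q * s"
    using assms by (meson congr_E)
  show ?thesis by (rule congr_I[of "r + s"]) (use rs in \<open>auto simp: algebra_simps\<close>)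
qed

definition mat_congr :: "nat \<Rightarrow> 'a mat \<Rightarrow> 'a mat \<Rightarrow> bool" where
  "mat_congr q A B \<longleftrightarrow> (\<forall>i<n. \<forall>j<n. congr q (A $$ (i, j)) (B $$ (i, j)))"

lemma mat_congr_refl [simp]: "mat_congr q A A" by (simp add: mat_congr_def)

lemma mat_congr_mult:
  assumes "mat_congr q A A'" "mat_congr q B B'" "A' \<in> carrier G" "B' \<in> carrier G" "A \<in> carrier G" "B \<in> carrier G"
  shows "mat_congr q (A * B) (A' * B')"
  unfolding mat_congr_def
proof (intro allI impI)
  fix i j assume ij: "i < n" "j < n"
  have c: "A \<in> carrier_mat n n" "B \<in> carrier_mat n n" "A' \<in> carrier_mat n n" "B' \<in> carrier_mat n n" using assms by (auto simp: carrier_G)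
  show "congr q ((A * B) $$ (i, j)) ((A' * B') $$ (i, j))"
    unfolding mult_mat_index[OF c(1,2) ij] mult_mat_index[OF c(3,4) ij]
    using assms ij by (intro congr_sum congr_mult) (auto simp: mat_congr_def carrier_G)
qed

text \<open>The principal congruence subgroup of level \<open>q\<close>.\<close>

definition congr_subgroup :: "nat \<Rightarrow> 'a mat set" where
  "congr_subgroup q = {A \<in> carrier G. mat_congr q A (1\<^sub>m n)}"

lemma congr_subgroup_mult: "A \<in> congr_subgroup q \<Longrightarrow> B \<in> congr_subgroup q \<Longrightarrow> A * B \<in> congr_subgroup q"
  using mat_congr_mult[of q A "1\<^sub>m n" B "1\<^sub>m n"] G.m_closed[of A B] G.one_closed by (auto simp: congr_subgroup_def)

lemma congr_subgroup_conj: 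
  assumes "A \<in> congr_subgroup q" "g \<in> carrier G" "h \<in> carrier G" "g * h = 1\<^sub>m n"
  shows "g * A * h \<in> congr_subgroup q"
proof -
  have c: "A \<in> carrier G" "mat_congr q A (1\<^sub>m n)" using assms by (auto simp: congr_subgroup_def)
  have gA: "g * A \<in> carrier G" using G.m_closed[OF assms(2) c(1)] by simp
  have "mat_congr q (g * A) (g * 1\<^sub>m n)" using c assms G.one_closed by (intro mat_congr_mult) auto
  moreover have "g * 1\<^sub>m n = g" using G.r_one[OF assms(2)] by simp
  ultimately have "mat_congr q (g * A * h) (g * h)" using assms gA by (intro mat_congr_mult) auto
  then show ?thesis using assms G.m_closed[OF gA assms(3)] by (auto simp: congr_subgroup_def)
qed

lemma elmat_congr_subgroup: "i \<noteq> j \<Longrightarrow> r \<in> R \<Longrightarrow> elmat n i j (of_nat q * r) \<in> congr_subgroup q"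
  unfolding congr_subgroup_def mat_congr_def by (auto simp: elmat_in_G intro!: congr_I[of r])

lemma congr_subgroup_entry:
  assumes "A \<in> congr_subgroup q" "i < n" "j < n"
  obtains r where "r \<in> R" "A $$ (i, j) = (if i = j then 1 else 0) + of_nat q * r"
  using assms by (auto simp: congr_subgroup_def mat_congr_def congr_def)

lemma elmat_generation_cross:
  assumes M: "subgroup M G" and l: "l < n"
    and 1: "\<And>i r. i < n \<Longrightarrow> i \<noteq> l \<Longrightarrow> r \<in> R \<Longrightarrow> elmat n i l r \<in> M"
    and 2: "\<And>i r. i < n \<Longrightarrow> i \<noteq> l \<Longrightarrow> r \<in> R \<Longrightarrow> elmat n l i r \<in> M"
  shows "carrier G \<subseteq> M"
proof (rule SL_generated_by_elementary[OF M])
  fix i j r assume ij: "i < n" "j < n" "i \<noteq> j" "r \<in> R"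
  show "elmat n i j r \<in> M"
  proof (cases "i = l \<or> j = l")
    case True then show ?thesis using 1 2 ij by auto
  next
    case False
    then have "elmat n i j (r * 1) \<in> M"
      using ij 1[of i r] 2[of j 1] l by (intro elmat_commutator_mem[OF M, of i l r j 1]) auto
    then show ?thesis by simp
  qed
qed


lemma subgroup_congr_subgroup: "subgroup (congr_subgroup q) G"
proof (rule G.subgroupI)
  show "congr_subgroup q \<subseteq> carrier G" by (auto simp: congr_subgroup_def)
  show "congr_subgroup q \<noteq> {}" using G.one_closed by (auto simp: congr_subgroup_def intro!: exI[of _ "1\<^sub>m n"])
  show "a \<otimes>\<^bsub>G\<^esub> b \<in> congr_subgroup q" if "a \<in> congr_subgroup q" "b \<in> congr_subgroup q" for a b using congr_subgroup_mult that by simp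
  fix a assume a: "a \<in> congr_subgroup q"
  then have aG: "a \<in> carrier G" by (auto simp: congr_subgroup_def)
  have i: "ginv a * a = 1\<^sub>m n" using G.l_inv[OF aG] by simp
  have iG: "ginv a \<in> carrier G" using aG by simp
  have "ginv a * 1\<^sub>m n = ginv a" using G.r_one[OF iG] by simp
  then have "mat_congr q (1\<^sub>m n) (ginv a)"
    using mat_congr_mult[of q "ginv a" "ginv a" a "1\<^sub>m n"] a aG iG G.one_closed i by (auto simp: congr_subgroup_def)
  then have "mat_congr q (ginv a) (1\<^sub>m n)" unfolding mat_congr_def using congr_sym by blast
  then show "ginv a \<in> congr_subgroup q" using iG by (simp add: congr_subgroup_def)
qed

end

text \<open>The model of \<open>\<pi>\<close> is the projection to the quotient by the normal closure of the matrices
\<open>elmat n i j (q r)\<close>.\<close>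

locale congruence_hom = sl_ring R p ip n for R :: "'a::comm_ring_1 set" and p ip n +
  fixes Q :: "('q, 'm) monoid_scheme" (structure) and \<pi> and q :: nat
  assumes hom: "group_hom (SL n R) Q \<pi>"
    and ker: "\<And>i j r. \<lbrakk>i < n; j < n; i \<noteq> j; r \<in> R\<rbrakk> \<Longrightarrow> \<pi> (elmat n i j (of_nat q * r)) = \<one>"
begin

sublocale hom: group_hom G Q \<pi> by (rule hom)

definition central :: "'a mat \<Rightarrow> bool" where
  "central x \<longleftrightarrow> (\<forall>g\<in>carrier G. \<pi> x \<otimes> \<pi> g = \<pi> g \<otimes> \<pi> x)"

lemma hom_mat_mult: "\<lbrakk>x \<in> carrier G; y \<in> carrier G\<rbrakk> \<Longrightarrow> \<pi> (x * y) = \<pi> x \<otimes> \<pi> y"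
  using hom.hom_mult[of x y] by simp

lemma mat_mult_closed: "\<lbrakk>x \<in> carrier G; y \<in> carrier G\<rbrakk> \<Longrightarrow> x * y \<in> carrier G"
  using G.m_closed[of x y] by simp

lemma congr_subgroup_in_G: "x \<in> congr_subgroup q \<Longrightarrow> x \<in> carrier G" by (simp add: congr_subgroup_def)

abbreviation "l \<equiv> n - 1"

lemma last_index: "l < n" "1 < l" "0 < l" using n3 by auto

text \<open>Two kinds of operations on a matrix \<open>x\<close> of the congruence subgroup reflect centrality of its image: conjugation
by any elementary matrix, and multiplication by one of level \<open>q\<close>. The last conjunct is the effect on the last
column. Conjugation is what allows row operations that are not of level \<open>q\<close>: for \<open>j \<noteq> l\<close> the factor on the right
leaves the last column alone.\<close>

lemma central_conj:
  assumes x: "x \<in> congr_subgroup q" and ij: "i < n" "j < n" "i \<noteq> j" "j \<noteq> l" "r \<in> R"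
  shows "elmat n i j r * x * elmat n i j (- r) \<in> congr_subgroup q \<and> (central (elmat n i j r * x * elmat n i j (- r)) \<longrightarrow> central x) \<and>
    (\<forall>k<n. (elmat n i j r * x * elmat n i j (- r)) $$ (k, l) = x $$ (k, l) + (if k = i then r * x $$ (j, l) else 0))"
proof (intro conjI impI allI)
  let ?e = "elmat n i j r" and ?f = "elmat n i j (- r)"
  have e: "?e \<in> carrier G" "?f \<in> carrier G" "?e * ?f = 1\<^sub>m n" "?f * ?e = 1\<^sub>m n" using ij by (auto intro!: elmat_in_G simp: elmat_add)
  show "?e * x * ?f \<in> congr_subgroup q" using x e by (intro congr_subgroup_conj) auto
  show "(?e * x * ?f) $$ (k, l) = x $$ (k, l) + (if k = i then r * x $$ (j, l) else 0)" if "k < n" for k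
    using that ij last_index G_carrier_mat[OF congr_subgroup_in_G[OF x]] G_carrier_mat[OF mat_mult_closed[OF e(1) congr_subgroup_in_G[OF x]]]
    by (simp add: mult_elmat_index elmat_mult_index)
  assume c: "central (?e * x * ?f)"
  let ?y = "?e * x * ?f"
  have xG: "x \<in> carrier G" using x congr_subgroup_in_G by auto
  have yG: "?y \<in> carrier G" using e xG mat_mult_closed by auto
  have "?f * ?y * ?e = (?f * ?e) * x * (?f * ?e)"
    using G_carrier_mat[OF xG] by (simp add: assoc_mult_mat[of _ n n _ n _ n] mult_carrier_mat[of _ n n _ n])
  also have "\<dots> = x" using G_carrier_mat[OF xG] unfolding e by simp
  finally have "\<pi> x = \<pi> ?f \<otimes> \<pi> ?y \<otimes> \<pi> ?e" using e yG mat_mult_closed hom_mat_mult by metis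
  also have "\<dots> = \<pi> ?y \<otimes> \<pi> ?f \<otimes> \<pi> ?e" using c e by (simp add: central_def)
  also have "\<dots> = \<pi> ?y \<otimes> \<pi> (?f * ?e)"
    unfolding hom_mat_mult[OF e(2,1)] by (rule hom.H.m_assoc) (use e yG in auto)
  also have "\<dots> = \<pi> ?y" using e yG hom.hom_one by simp
  finally show "central x" using c by (simp add: central_def)
qed

lemma central_left:
  assumes x: "x \<in> congr_subgroup q" and ij: "i < n" "j < n" "i \<noteq> j" "r \<in> R"
  shows "elmat n i j (of_nat q * r) * x \<in> congr_subgroup q \<and> (central (elmat n i j (of_nat q * r) * x) \<longrightarrow> central x) \<and>
    (\<forall>k<n. (elmat n i j (of_nat q * r) * x) $$ (k, l) = x $$ (k, l) + (if k = i then of_nat q * r * x $$ (j, l) else 0))"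
proof (intro conjI impI allI)
  let ?e = "elmat n i j (of_nat q * r)"
  have e: "?e \<in> congr_subgroup q" using ij by (intro elmat_congr_subgroup) auto
  show "?e * x \<in> congr_subgroup q" using congr_subgroup_mult[OF e x] .
  show "(?e * x) $$ (k, l) = x $$ (k, l) + (if k = i then of_nat q * r * x $$ (j, l) else 0)" if "k < n" for k
    using that ij last_index G_carrier_mat[OF congr_subgroup_in_G[OF x]] by (simp add: elmat_mult_index)
  assume "central (?e * x)"
  then show "central x" using hom_mat_mult[of ?e x] congr_subgroup_in_G e x ker ij by (simp add: central_def)
qed

text \<open>A matrix of level \<open>q\<close> on the right also makes the last row standard. The result \<open>y\<close> normalises the groups of
transvections in the last column and in the last row, and conjugates each \<open>elmat n i l r\<close> and
\<open>elmat n l i r\<close> into itself times a product of elementary matrices of level \<open>q\<close>. These matrices generate.\<close>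

lemma central_if_last_column_standard:
  assumes x: "x \<in> congr_subgroup q" and col: "\<And>k. k < n \<Longrightarrow> x $$ (k, l) = ebasis l k"
  shows "central x"
proof -
  define w where "w j = (if j = l then 0 else - x $$ (l, j))" for j
  let ?t = "transv n (ebasis l) w"
  have xG: "x \<in> carrier G" and xc: "x \<in> carrier_mat n n" using x congr_subgroup_in_G G_carrier_mat by auto
  let ?K = "{y \<in> congr_subgroup q. \<pi> y = \<one>}"
  have KG: "subgroup ?K G"
  proof -
    have "?K = congr_subgroup q \<inter> kernel G Q \<pi>" using congr_subgroup_in_G by (auto simp: kernel_def)
    then show ?thesis using G.subgroups_Inter_pair[OF subgroup_congr_subgroup hom.subgroup_kernel] by simp
  qed
  have wR: "\<exists>r\<in>R. w j = of_nat q * r" if jn: "j < n" for j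
  proof (cases "j = l")
    case False
    obtain r where "r \<in> R" "x $$ (l, j) = of_nat q * r" using congr_subgroup_entry[OF x last_index(1) jn] False by auto
    then show ?thesis using False by (intro bexI[of _ "- r"]) (auto simp: w_def)
  qed (auto simp: w_def intro!: bexI[of _ 0])
  have t: "?t \<in> ?K"
  proof (rule transv_row_mem[OF KG])
    fix j assume "j < n" "j \<noteq> l"
    then show "elmat n l j (w j) \<in> ?K" using wR[of j] ker last_index by (auto simp: elmat_congr_subgroup)
  qed (use last_index in \<open>auto simp: w_def\<close>)
  define y where "y = x * ?t"
  have y: "y \<in> congr_subgroup q" unfolding y_def using t x congr_subgroup_mult by auto
  have yG: "y \<in> carrier G" and yc: "y \<in> carrier_mat n n" using y congr_subgroup_in_G G_carrier_mat by auto
  have sl: "(\<Sum>m<n. f m * ebasis l m) = f l" for f :: "nat \<Rightarrow> 'a"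
    using pairing_ebasis(1)[OF last_index(1), of f] by (simp add: pairing_def)
  have sl': "(\<Sum>m<n. ebasis k m * f m) = f k" if "k < n" for f :: "nat \<Rightarrow> 'a" and k
    using pairing_ebasis(2)[OF that, of f] by (simp add: pairing_def)
  have yidx: "y $$ (k, j) = x $$ (k, j) + ebasis l k * w j" if "k < n" "j < n" for k j
    unfolding y_def mult_transv_index[OF xc that] using sl[of "\<lambda>m. x $$ (k, m)"] col[OF that(1)] by simp
  have ycol: "y $$ (k, l) = ebasis l k" if "k < n" for k
    using yidx[OF that last_index(1)] col[OF that] by (simp add: w_def)
  have yrow: "y $$ (l, k) = ebasis l k" if "k < n" for k
    using yidx[OF last_index(1) that] col[OF last_index(1)] by (simp add: w_def)
  let ?C = "{g \<in> carrier G. \<pi> y \<otimes> \<pi> g = \<pi> g \<otimes> \<pi> y}"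
  have CG: "subgroup ?C G"
  proof (rule G.subgroupI)
    show "?C \<noteq> {}" using G.one_closed hom.hom_one yG by auto
  next
    fix a assume a: "a \<in> ?C"
    then have "\<pi> a \<in> carrier Q" "\<pi> y \<in> carrier Q" using yG by auto
    then have c: "\<pi> a \<in> carrier Q" "\<pi> y \<in> carrier Q" using yG by auto
    have "inv \<pi> a \<otimes> \<pi> y = inv \<pi> a \<otimes> ((\<pi> y \<otimes> \<pi> a) \<otimes> inv \<pi> a)"
      using c by (simp add: hom.H.m_assoc)
    also have "\<dots> = inv \<pi> a \<otimes> ((\<pi> a \<otimes> \<pi> y) \<otimes> inv \<pi> a)"
      using a by simp
    also have "\<dots> = (inv \<pi> a \<otimes> \<pi> a) \<otimes> (\<pi> y \<otimes> inv \<pi> a)"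
      using c by (simp only: hom.H.m_assoc hom.H.m_closed hom.H.inv_closed)
    also have "\<dots> = \<pi> y \<otimes> inv \<pi> a" using c by simp
    finally have "inv \<pi> a \<otimes> \<pi> y = \<pi> y \<otimes> inv \<pi> a" .
    then show "ginv a \<in> ?C" using a by simp
  next
    fix a b assume ab: "a \<in> ?C" "b \<in> ?C"
    then have c: "\<pi> a \<in> carrier Q" "\<pi> b \<in> carrier Q" "\<pi> y \<in> carrier Q" using yG by auto
    have "\<pi> y \<otimes> (\<pi> a \<otimes> \<pi> b) = (\<pi> a \<otimes> \<pi> y) \<otimes> \<pi> b" using ab c by (simp add: hom.H.m_assoc[symmetric])
    also have "\<dots> = \<pi> a \<otimes> \<pi> b \<otimes> \<pi> y" using ab c by (simp add: hom.H.m_assoc)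
    finally show "a \<otimes>\<^bsub>G\<^esub> b \<in> ?C" using ab mat_mult_closed by (simp add: hom_mat_mult)
  qed auto
  have "carrier G \<subseteq> ?C"
  proof (rule elmat_generation_cross[OF CG last_index(1)])
    fix i r assume i: "i < n" "i \<noteq> l" "r \<in> R"
    have e: "elmat n i l r \<in> carrier G" using i by (intro elmat_in_G) auto
    define z where "z k = y $$ (k, i) - ebasis i k" for k
    have zt: "transv n (\<lambda>k. r * z k) (ebasis l) \<in> ?K"
    proof (rule transv_column_mem[OF KG])
      fix k assume k: "k < n" "k \<noteq> l"
      obtain s where s: "s \<in> R" "y $$ (k, i) = ebasis i k + of_nat q * s" using congr_subgroup_entry[OF y k(1) i(1)] by metis
      then have "r * z k = of_nat q * (r * s)" by (simp add: z_def algebra_simps)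
      then show "elmat n k l (r * z k) \<in> ?K" using k last_index i s by (simp add: elmat_congr_subgroup ker)
    qed (use last_index i yrow[OF i(1)] in \<open>auto simp: z_def\<close>)
    let ?z = "transv n (\<lambda>k. r * z k) (ebasis l)"
    have zl: "z l = 0" using yrow[OF i(1)] i by (auto simp: z_def)
    have E: "elmat n i l r * ?z = transv n (\<lambda>k. r * y $$ (k, i)) (ebasis l)"
    proof -
      have "elmat n i l r = transv n (\<lambda>k. r * ebasis i k) (ebasis l)"
        unfolding elmat_def by (rule transv_cong) auto
      moreover have "pairing n (ebasis l) (\<lambda>k. r * z k) = 0" using last_index zl by simp
      ultimately have "elmat n i l r * ?z = transv n (\<lambda>k. r * ebasis i k + r * z k) (ebasis l)"
        by (simp only: transv_add_left)
      then show ?thesis by (simp add: z_def algebra_simps)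
    qed
    have yE: "y * elmat n i l r = elmat n i l r * ?z * y"
    proof (rule eq_matI)
      fix k j assume "k < dim_row (elmat n i l r * ?z * y)" "j < dim_col (elmat n i l r * ?z * y)"
      then have kj: "k < n" "j < n" using yc by auto
      have "(elmat n i l r * ?z * y) $$ (k, j) = y $$ (k, j) + r * y $$ (k, i) * y $$ (l, j)"
        unfolding E transv_mult_index[OF yc kj] using sl'[OF last_index(1), of "\<lambda>m. y $$ (m, j)"] by simp
      then show "(y * elmat n i l r) $$ (k, j) = (elmat n i l r * ?z * y) $$ (k, j)"
        using kj i yc yrow[OF kj(2)] by (auto simp: mult_elmat_index)
    qed (use yc in auto)
    have zG: "?z \<in> carrier G" and z1: "\<pi> ?z = \<one>" using zt congr_subgroup_in_G by auto
    have "\<pi> y \<otimes> \<pi> (elmat n i l r) = \<pi> (y * elmat n i l r)" by (rule hom_mat_mult[OF yG e, symmetric])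
    also have "\<dots> = \<pi> (elmat n i l r * ?z * y)" by (simp only: yE)
    also have "\<dots> = \<pi> (elmat n i l r) \<otimes> \<pi> ?z \<otimes> \<pi> y"
      by (simp only: hom_mat_mult[OF mat_mult_closed[OF e zG] yG] hom_mat_mult[OF e zG])
    finally have "\<pi> y \<otimes> \<pi> (elmat n i l r) = \<pi> (elmat n i l r) \<otimes> \<pi> ?z \<otimes> \<pi> y" .
    then show "elmat n i l r \<in> ?C" using e zt by simp
  next
    fix i r assume i: "i < n" "i \<noteq> l" "r \<in> R"
    have e: "elmat n l i r \<in> carrier G" using i by (intro elmat_in_G) auto
    define z where "z k = y $$ (i, k) - ebasis i k" for k
    have zt: "transv n (ebasis l) (\<lambda>k. r * z k) \<in> ?K"
    proof (rule transv_row_mem[OF KG])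
      fix k assume k: "k < n" "k \<noteq> l"
      obtain s where s: "s \<in> R" "y $$ (i, k) = (if i = k then 1 else 0) + of_nat q * s" using congr_subgroup_entry[OF y i(1) k(1)] by metis
      then have "r * z k = of_nat q * (r * s)" by (auto simp: z_def algebra_simps)
      then show "elmat n l k (r * z k) \<in> ?K" using k last_index i s by (simp add: elmat_congr_subgroup ker)
    qed (use last_index i ycol[OF i(1)] in \<open>auto simp: z_def\<close>)
    let ?z = "transv n (ebasis l) (\<lambda>k. r * z k)"
    have zl: "z l = 0" using ycol[OF i(1)] i by (auto simp: z_def)
    have E: "elmat n l i r * ?z = transv n (ebasis l) (\<lambda>k. r * y $$ (i, k))"
    proof -
      have "pairing n (\<lambda>k. r * ebasis i k) (ebasis l) = 0" using last_index i by simp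
      then have "elmat n l i r * ?z = transv n (ebasis l) (\<lambda>k. r * ebasis i k + r * z k)"
        unfolding elmat_def by (simp only: transv_add_right)
      then show ?thesis by (simp add: z_def algebra_simps)
    qed
    have "y * (elmat n l i r * ?z) = elmat n l i r * y"
    proof (rule eq_matI)
      fix k j assume "k < dim_row (elmat n l i r * y)" "j < dim_col (elmat n l i r * y)"
      then have kj: "k < n" "j < n" using yc by auto
      have "(y * (elmat n l i r * ?z)) $$ (k, j) = y $$ (k, j) + y $$ (k, l) * (r * y $$ (i, j))"
        unfolding E mult_transv_index[OF yc kj] using sl[of "\<lambda>m. y $$ (k, m)"] by simp
      then show "(y * (elmat n l i r * ?z)) $$ (k, j) = (elmat n l i r * y) $$ (k, j)"
        using kj i yc ycol[OF kj(1)] by (auto simp: elmat_mult_index)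
    qed (use yc in auto)
    moreover have "\<pi> (y * (elmat n l i r * ?z)) = \<pi> y \<otimes> (\<pi> (elmat n l i r) \<otimes> \<pi> ?z)"
    proof -
      have zG: "?z \<in> carrier G" using zt congr_subgroup_in_G by auto
      show ?thesis by (simp only: hom_mat_mult[OF yG mat_mult_closed[OF e zG]] hom_mat_mult[OF e zG])
    qed
    ultimately have "\<pi> y \<otimes> (\<pi> (elmat n l i r) \<otimes> \<pi> ?z) = \<pi> (elmat n l i r) \<otimes> \<pi> y"
      using hom_mat_mult[OF e yG] by simp
    then show "elmat n l i r \<in> ?C" using e zt by simp
  qed
  moreover have "\<pi> y = \<pi> x" unfolding y_def using hom_mat_mult[of x ?t] xG t congr_subgroup_in_G by simp
  ultimately show "central x" by (auto simp: central_def)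
qed

text \<open>The entries \<open>q g\<close> and \<open>c\<close> of the last column generate the unit ideal. Placing \<open>q c\<close> in row \<open>1\<close> makes the entries
above the diagonal generate the ideal of \<open>q\<close>, which contains \<open>1 - c\<close>; so conjugations can turn \<open>c\<close> into \<open>1\<close>,
and then the entries above it can be cleared.\<close>

lemma central_if_last_column_sparse:
  assumes x: "x \<in> congr_subgroup q" and g: "g \<in> R" and col: "x $$ (0, l) = of_nat q * g" "\<And>k. 0 < k \<Longrightarrow> k < l \<Longrightarrow> x $$ (k, l) = 0"
  shows "central x"
proof -
  have xG: "x \<in> carrier G" and xc: "x \<in> carrier_mat n n" using x congr_subgroup_in_G G_carrier_mat by auto
  obtain dd where dd: "dd \<in> R" "x $$ (l, l) = 1 + of_nat q * dd" using congr_subgroup_entry[OF x last_index(1) last_index(1)] by auto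
  let ?c = "x $$ (l, l)"
  define h where "h = ginv x"
  have h: "h \<in> carrier G" "h * x = 1\<^sub>m n" using G.l_inv[OF xG] xG by (auto simp: h_def)
  have hR: "h $$ (l, k) \<in> R" if "k < n" for k using h last_index that by (auto simp: carrier_G)
  have "(\<Sum>k<n. h $$ (l, k) * x $$ (k, l)) = 1"
    using mult_mat_index[OF G_carrier_mat[OF h(1)] xc last_index(1) last_index(1)] h(2) last_index by simp
  also have "(\<Sum>k<n. h $$ (l, k) * x $$ (k, l)) = (\<Sum>k\<in>{0, l}. h $$ (l, k) * x $$ (k, l))"
  proof (rule sum.mono_neutral_right)
    show "\<forall>k\<in>{..<n} - {0, l}. h $$ (l, k) * x $$ (k, l) = 0"
    proof
      fix k assume "k \<in> {..<n} - {0, l}"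
      then have "0 < k" "k < l" by auto
      then show "h $$ (l, k) * x $$ (k, l) = 0" using col(2) by simp
    qed
  qed (use last_index in auto)
  also have "\<dots> = h $$ (l, 0) * (of_nat q * g) + h $$ (l, l) * ?c" using last_index col(1) by simp
  finally have unit: "h $$ (l, 0) * (of_nat q * g) + h $$ (l, l) * ?c = 1" .
  (* c = 1 + q dd; s0 and s1 solve s0 g + s1 c = - dd, so adding s0 times row 0 and
     s1 times row 1 of the column x1 to its last entry c gives 1 *)
  define s0 where "s0 = - (dd * h $$ (l, 0) * of_nat q)"
  define s1 where "s1 = - (dd * h $$ (l, l))"
  have sR: "s0 \<in> R" "s1 \<in> R" using dd hR last_index by (auto simp: s0_def s1_def)
  have "s0 * g + s1 * ?c = - dd * (h $$ (l, 0) * (of_nat q * g) + h $$ (l, l) * ?c)"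
    by (simp add: s0_def s1_def algebra_simps)
  then have s: "s0 * g + s1 * ?c = - dd" unfolding unit by simp
  define x1 where "x1 = elmat n 1 l (of_nat q * 1) * x"
  have x1: "x1 \<in> congr_subgroup q" "central x1 \<longrightarrow> central x" "\<forall>k<n. x1 $$ (k, l) = x $$ (k, l) + (if k = 1 then of_nat q * 1 * ?c else 0)"
    using central_left[OF x, of 1 l 1] last_index by (auto simp: x1_def)
  define x2 where "x2 = elmat n l 0 s0 * x1 * elmat n l 0 (- s0)"
  have x2: "x2 \<in> congr_subgroup q" "central x2 \<longrightarrow> central x1" "\<forall>k<n. x2 $$ (k, l) = x1 $$ (k, l) + (if k = l then s0 * x1 $$ (0, l) else 0)"
    using central_conj[OF x1(1), of l 0 s0] last_index sR by (auto simp: x2_def)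
  define x3 where "x3 = elmat n l 1 s1 * x2 * elmat n l 1 (- s1)"
  have x3: "x3 \<in> congr_subgroup q" "central x3 \<longrightarrow> central x2" "\<forall>k<n. x3 $$ (k, l) = x2 $$ (k, l) + (if k = l then s1 * x2 $$ (1, l) else 0)"
    using central_conj[OF x2(1), of l 1 s1] last_index sR by (auto simp: x3_def)
  have c3: "x3 $$ (0, l) = of_nat q * g" "x3 $$ (1, l) = of_nat q * ?c" "\<And>k. 1 < k \<Longrightarrow> k < l \<Longrightarrow> x3 $$ (k, l) = 0"
    using x3(3) x2(3) x1(3) col last_index by auto
  have "x3 $$ (l, l) = ?c + s0 * (of_nat q * g) + s1 * (of_nat q * ?c)"
    using x3(3) x2(3) x1(3) col last_index by simp
  also have "\<dots> = ?c + of_nat q * (s0 * g + s1 * ?c)" by (simp add: algebra_simps)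
  also have "\<dots> = 1" unfolding s using dd by simp
  finally have c3': "x3 $$ (l, l) = 1" .
  have cR: "?c \<in> R" using xG last_index by (auto simp: carrier_G)
  define x4 where "x4 = elmat n 0 l (of_nat q * (- g)) * x3"
  have x4: "x4 \<in> congr_subgroup q" "central x4 \<longrightarrow> central x3" "\<forall>k<n. x4 $$ (k, l) = x3 $$ (k, l) + (if k = 0 then of_nat q * (- g) * x3 $$ (l, l) else 0)"
    using central_left[OF x3(1), of 0 l "- g"] last_index g by (auto simp: x4_def)
  define x5 where "x5 = elmat n 1 l (of_nat q * (- ?c)) * x4"
  have x5: "x5 \<in> congr_subgroup q" "central x5 \<longrightarrow> central x4" "\<forall>k<n. x5 $$ (k, l) = x4 $$ (k, l) + (if k = 1 then of_nat q * (- ?c) * x4 $$ (l, l) else 0)"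
    using central_left[OF x4(1), of 1 l "- ?c"] last_index cR by (auto simp: x5_def)
  have "x5 $$ (k, l) = ebasis l k" if "k < n" for k
  proof -
    have "k < l \<or> k = l" using that by auto
    then consider "k = 0" | "k = 1" | "1 < k" "k < l" | "k = l" by linarith
    then show ?thesis using x5(3) x4(3) c3 c3' last_index by cases auto
  qed
  then have "central x5" by (rule central_if_last_column_standard[OF x5(1)])
  then show ?thesis using x5 x4 x3 x2 x1 by blast
qed

text \<open>The entries of the last column above the diagonal are divisible by \<open>q\<close>. Run the Euclidean algorithm on their
quotients, with the row operations realised as conjugations.\<close>

lemma congruence_subgroup_central:
  assumes \<gamma>: "\<gamma> \<in> congr_subgroup q"
  shows "central \<gamma>"
proof -
  define Qp where "Qp c \<longleftrightarrow> (\<forall>x\<in>congr_subgroup q. (\<forall>k<l. x $$ (k, l) = of_nat q * c k) \<longrightarrow> central x)" for c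
  have "\<forall>k<l. \<exists>r. r \<in> R \<and> \<gamma> $$ (k, l) = of_nat q * r"
  proof (intro allI impI)
    fix k assume "k < l"
    then have k: "k < n" "k \<noteq> l" by auto
    obtain r where "r \<in> R" "\<gamma> $$ (k, l) = (if k = l then 1 else 0) + of_nat q * r"
      by (rule congr_subgroup_entry[OF \<gamma> k(1) last_index(1)])
    then show "\<exists>r. r \<in> R \<and> \<gamma> $$ (k, l) = of_nat q * r" using k by auto
  qed
  then obtain c where c: "\<And>k. k < l \<Longrightarrow> c k \<in> R \<and> \<gamma> $$ (k, l) = of_nat q * c k" by metis
  have "Qp c"
  proof (rule euclid_induct[of "{..<l}" 0])
    fix c i j r assume ij: "i \<in> {..<l}" "j \<in> {..<l}" "i \<noteq> j" "r \<in> R" and Q: "Qp (c(i := c i + r * c j))"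
    show "Qp c" unfolding Qp_def
    proof (intro ballI impI)
      fix x assume x: "x \<in> congr_subgroup q" "\<forall>k<l. x $$ (k, l) = of_nat q * c k"
      let ?y = "elmat n i j r * x * elmat n i j (- r)"
      have y: "?y \<in> congr_subgroup q" "central ?y \<longrightarrow> central x" "\<forall>k<n. ?y $$ (k, l) = x $$ (k, l) + (if k = i then r * x $$ (j, l) else 0)"
        using central_conj[OF x(1), of i j r] ij last_index by auto
      have "\<forall>k<l. ?y $$ (k, l) = of_nat q * (c(i := c i + r * c j)) k"
        using y(3) x(2) ij last_index by (auto simp: algebra_simps)
      then show "central x" using Q y(1,2) unfolding Qp_def by blast
    qed
  next
    fix c assume c: "\<And>i. i \<in> {..<l} \<Longrightarrow> c i \<in> R" "\<And>i. i \<in> {..<l} \<Longrightarrow> i \<noteq> 0 \<Longrightarrow> c i = 0"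
    show "Qp c" unfolding Qp_def
    proof (intro ballI impI)
      fix x assume x: "x \<in> congr_subgroup q" "\<forall>k<l. x $$ (k, l) = of_nat q * c k"
      show "central x" by (rule central_if_last_column_sparse[OF x(1), of "c 0"]) (use x c last_index in auto)
    qed
  qed (use c last_index in auto)
  then show "central \<gamma>" using c \<gamma> unfolding Qp_def by blast
qed

end

section \<open>Finiteness of the quotient\<close>

context sl_ring begin

lemma residue_exists:
  assumes q: "q > 0" and cop: "coprime q p" and r: "r \<in> R"
  shows "\<exists>b<q. congr q r (of_nat b)"
proof -
  obtain a k where ak: "r = of_int a * ip ^ k" using r by (auto simp: R_def)
  have "coprime (int (p ^ k)) (int q)" using cop by (simp add: coprime_commute)
  then obtain x where "[int (p ^ k) * x = 1] (mod int q)" using cong_solve_coprime_int by blast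
  then obtain t where t: "int (p ^ k) * x = 1 + int q * t" by (metis cong_iff_lin cong_sym)
  define b where "b = nat ((a * x) mod int q)"
  have b: "b < q" "int b = (a * x) mod int q" using q by (auto simp: b_def nat_less_iff)
  have "a * x = int b + int q * (a * x div int q)" using b(2) by simp
  then have 1: "of_int a * of_int x = (of_nat b + of_nat q * of_int (a * x div int q) :: 'a)"
    by (metis of_int_add of_int_mult of_int_of_nat_eq)
  have "of_nat p ^ k * of_int x = (1 + of_nat q * of_int t :: 'a)"
    using arg_cong[OF t, of "of_int :: int \<Rightarrow> 'a"] by simp
  then have "(of_nat p ^ k * ip ^ k) * of_int x = ip ^ k * (1 + of_nat q * of_int t)"
    by (metis mult.assoc mult.commute)
  then have "of_int x = ip ^ k * (1 + of_nat q * of_int t)" by (simp only: ppow mult_1)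
  then have "of_int x = ip ^ k + of_nat q * (of_int t * ip ^ k)" by (simp add: algebra_simps)
  then have "of_int a * of_int x = r + of_nat q * (of_int a * of_int t * ip ^ k)"
    unfolding ak by (simp add: algebra_simps)
  with 1 have "r = of_nat b + of_nat q * (of_int (a * x div int q) - of_int a * of_int t * ip ^ k)"
    by (simp add: algebra_simps)
  moreover have "of_int (a * x div int q) - of_int a * of_int t * ip ^ k \<in> R"
    using R_I[of "a * t" k] by (intro R_diff) auto
  ultimately show ?thesis using b(1) congr_I by blast
qed

end

context congruence_hom begin

lemma elmat_power:
  assumes "i \<noteq> j" "i < n" "r \<in> R"
  shows "\<pi> (elmat n i j r) [^] k = \<pi> (elmat n i j (of_nat k * r))"
proof (induction k)
  case 0
  then show ?case using hom.hom_one by simp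
next
  case (Suc k)
  have "\<pi> (elmat n i j (of_nat k * r) * elmat n i j r) = \<pi> (elmat n i j (of_nat k * r)) \<otimes> \<pi> (elmat n i j r)"
    using assms by (intro hom_mat_mult elmat_in_G) auto
  then show ?case using Suc assms by (simp add: elmat_add algebra_simps)
qed

lemma conj_power:
  assumes "a \<in> carrier Q" "b \<in> carrier Q"
  shows "(a \<otimes> b \<otimes> inv a) [^] (k::nat) = a \<otimes> b [^] k \<otimes> inv a"
proof (induction k)
  case (Suc k)
  have "(a \<otimes> b [^] k \<otimes> inv a) \<otimes> (a \<otimes> b \<otimes> inv a)
      = a \<otimes> b [^] k \<otimes> ((inv a \<otimes> a) \<otimes> (b \<otimes> inv a))"
    using assms by (simp only: hom.H.m_assoc hom.H.m_closed hom.H.inv_closed hom.H.nat_pow_closed)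
  also have "\<dots> = a \<otimes> b [^] Suc k \<otimes> inv a"
    using assms by (simp add: hom.H.m_assoc)
  finally show ?case using Suc by simp
qed (use assms in simp)

text \<open>Congruent matrices differ by an element with central image, so they conjugate in the same way.\<close>

lemma congruent_conj_eq:
  assumes g: "g \<in> carrier G" "g' \<in> carrier G" "mat_congr q g' g" and b: "b \<in> carrier G"
  shows "\<pi> g' \<otimes> \<pi> b \<otimes> inv \<pi> g' = \<pi> g \<otimes> \<pi> b \<otimes> inv \<pi> g"
proof -
  define c where "c = ginv g * g'"
  have ig: "ginv g \<in> carrier G" using g by simp
  have "mat_congr q (ginv g * g') (ginv g * g)" using g ig by (intro mat_congr_mult) auto
  moreover have "ginv g * g = 1\<^sub>m n" using G.l_inv[OF g(1)] by simp
  ultimately have "c \<in> congr_subgroup q" unfolding c_def using mat_mult_closed[OF ig g(2)] by (simp add: congr_subgroup_def)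
  then have c: "c \<in> carrier G" "central c" using congr_subgroup_in_G congruence_subgroup_central by auto
  have "g \<otimes>\<^bsub>G\<^esub> (ginv g \<otimes>\<^bsub>G\<^esub> g') = g'" using g ig by (metis G.inv_solve_left' G.m_closed)
  then have "\<pi> g' = \<pi> g \<otimes> \<pi> c" using hom_mat_mult[OF g(1) c(1)] by (simp add: c_def)
  also have "\<dots> = \<pi> c \<otimes> \<pi> g" using c(2) g(1) by (simp add: central_def)
  finally have g': "\<pi> g' = \<pi> c \<otimes> \<pi> g" .
  have mem: "\<pi> g \<in> carrier Q" "\<pi> c \<in> carrier Q" "\<pi> b \<in> carrier Q" using g c b by auto
  let ?y = "\<pi> g \<otimes> \<pi> b \<otimes> inv \<pi> g"
  have y: "?y = \<pi> (g * b * ginv g)" using g b ig by (simp add: hom_mat_mult mat_mult_closed)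
  have "\<pi> g' \<otimes> \<pi> b \<otimes> inv \<pi> g' = \<pi> c \<otimes> ?y \<otimes> inv \<pi> c"
    unfolding g' using mem by (simp add: hom.H.inv_mult_group hom.H.m_assoc)
  also have "\<pi> c \<otimes> ?y = ?y \<otimes> \<pi> c" unfolding y using c(2) mat_mult_closed g b ig by (simp add: central_def)
  also have "?y \<otimes> \<pi> c \<otimes> inv \<pi> c = ?y \<otimes> (\<pi> c \<otimes> inv \<pi> c)"
    using mem by (intro hom.H.m_assoc) auto
  also have "\<dots> = ?y" using mem by simp
  finally show ?thesis .
qed

text \<open>The images of conjugates of elementary matrices form a finite set: they depend only on the entries modulo \<open>q\<close>.
Each has order dividing \<open>q\<close>, so Dietzmann's lemma applies.\<close>

lemma finite_quotient:
  assumes q: "q > 0" "coprime q p" and surj: "carrier Q \<subseteq> \<pi> ` carrier G"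
  shows "finite (carrier Q)"
proof -
  define res where "res r = (SOME b. b < q \<and> congr q r (of_nat b))" for r
  have res: "res r < q" "congr q r (of_nat (res r))" if "r \<in> R" for r
    using someI_ex[of "\<lambda>b. b < q \<and> congr q r (of_nat b)"] residue_exists[OF q that] by (auto simp: res_def)
  have res_eq: "congr q r s" if "r \<in> R" "s \<in> R" "res r = res s" for r s
  proof -
    have "congr q r (of_nat (res s))" using res(2)[OF that(1)] that(3) by simp
    then show ?thesis using congr_sym[OF res(2)[OF that(2)]] by (rule congr_trans)
  qed
  define D where "D = carrier G \<times> ({(i, j). i < n \<and> j < n \<and> i \<noteq> j} \<times> R)"
  define f where "f = (\<lambda>(g, (i, j), r). \<pi> g \<otimes> \<pi> (elmat n i j r) \<otimes> inv \<pi> g)"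
  define key where "key = (\<lambda>(g, ij :: nat \<times> nat, r). ((\<lambda>x\<in>{..<n}\<times>{..<n}. res (g $$ x)), ij, res r))"
  have "finite (key ` D)"
  proof (rule finite_subset)
    show "key ` D \<subseteq> (({..<n}\<times>{..<n}) \<rightarrow>\<^sub>E {..<q}) \<times> (({..<n}\<times>{..<n}) \<times> {..<q})"
    proof
      fix y assume "y \<in> key ` D"
      then obtain g i j r where y: "g \<in> carrier G" "i < n" "j < n" "r \<in> R" "y = key (g, (i, j), r)"
        unfolding D_def by blast
      have "res (g $$ x) \<in> {..<q}" if "x \<in> {..<n}\<times>{..<n}" for x
      proof -
        have "g $$ x \<in> R" using that y(1) by (cases x) (simp add: carrier_G)
        then show ?thesis using res(1) by simp
      qed
      then have "(\<lambda>x\<in>{..<n}\<times>{..<n}. res (g $$ x)) \<in> ({..<n}\<times>{..<n}) \<rightarrow>\<^sub>E {..<q}" by (simp only: restrict_PiE_iff) blast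
      then show "y \<in> (({..<n}\<times>{..<n}) \<rightarrow>\<^sub>E {..<q}) \<times> (({..<n}\<times>{..<n}) \<times> {..<q})"
        unfolding y(5) key_def prod.case using y(2-4) res(1) by (intro SigmaI) simp_all
    qed
    show "finite ((({..<n}\<times>{..<n}) \<rightarrow>\<^sub>E {..<q}) \<times> (({..<n}\<times>{..<n}) \<times> {..<q}))"
      by (intro finite_cartesian_product finite_PiE) auto
  qed
  then have fin: "finite (f ` D)"
  proof (rule finite_image_if_key)
    fix x y assume xy: "x \<in> D" "y \<in> D" "key x = key y"
    obtain g i j r where x: "x = (g, (i, j), r)" by (metis prod.collapse)
    obtain g' i' j' r' where y: "y = (g', (i', j'), r')" by (metis prod.collapse)
    have gr: "g \<in> carrier G" "g' \<in> carrier G" "r \<in> R" "r' \<in> R" and ij: "i < n" "j < n" "i \<noteq> j" using xy x y by (auto simp: D_def)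
    have k: "(\<lambda>x\<in>{..<n}\<times>{..<n}. res (g $$ x)) = (\<lambda>x\<in>{..<n}\<times>{..<n}. res (g' $$ x))" "i' = i" "j' = j" "res r = res r'"
      using xy(3) unfolding x y key_def prod.case by (auto simp only: prod.inject)
    have "mat_congr q g g'" unfolding mat_congr_def
    proof (intro allI impI)
      fix a b assume ab: "a < n" "b < n"
      then have "res (g $$ (a, b)) = res (g' $$ (a, b))" using fun_cong[OF k(1), of "(a, b)"] by simp
      then show "congr q (g $$ (a, b)) (g' $$ (a, b))" using gr ab by (intro res_eq) (auto simp: carrier_G)
    qed
    moreover have "\<pi> (elmat n i j r) = \<pi> (elmat n i j r')"
    proof -
      obtain s where s: "s \<in> R" "r = r' + of_nat q * s" using res_eq[OF gr(3,4) k(4)] by (rule congr_E)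
      have "elmat n i j r = elmat n i j r' * elmat n i j (of_nat q * s)" using ij s by (simp add: elmat_add)
      moreover have e: "elmat n i j r' \<in> carrier G" "elmat n i j (of_nat q * s) \<in> carrier G"
        using ij s gr by (auto intro!: elmat_in_G)
      ultimately show ?thesis using hom_mat_mult[OF e] ker[OF ij s(1)] e by simp
    qed
    moreover have "elmat n i j r' \<in> carrier G" using ij gr by (intro elmat_in_G) auto
    ultimately show "f x = f y" unfolding x y f_def k using congruent_conj_eq[OF gr(2,1)] by simp
  qed
  show ?thesis
  proof (rule hom.H.dietzmann[OF fin _ _ q(1)])
    show SQ: "f ` D \<subseteq> carrier Q"
      by (auto simp: f_def D_def elmat_in_G)
    show "inv h \<otimes> s \<otimes> h \<in> f ` D" if s: "s \<in> f ` D" and h: "h \<in> carrier Q" for s h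
    proof -
      obtain g i j r where g: "g \<in> carrier G" and ij: "i < n" "j < n" "i \<noteq> j" "r \<in> R" and sf: "s = f (g, (i, j), r)"
        using s by (auto simp: D_def)
      obtain h' where h': "h' \<in> carrier G" "h = \<pi> h'" using h surj by auto
      let ?k = "ginv h' * g"
      have k: "?k \<in> carrier G" using mat_mult_closed[of "ginv h'" g] h' g by simp
      have e: "elmat n i j r \<in> carrier G" using ij by (intro elmat_in_G) auto
      have pk: "\<pi> ?k = inv h \<otimes> \<pi> g" using hom_mat_mult[of "ginv h'" g] h' g by simp
      have "f (?k, (i, j), r) = inv h \<otimes> s \<otimes> h"
        unfolding sf f_def using pk h g e by (simp add: hom.H.inv_mult_group hom.H.m_assoc)
      moreover have "(?k, (i, j), r) \<in> D" using k ij by (simp add: D_def)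
      ultimately show ?thesis by (metis imageI)
    qed
    show "s [^] q = \<one>" if s: "s \<in> f ` D" for s
    proof -
      obtain g i j r where g: "g \<in> carrier G" and ij: "i < n" "j < n" "i \<noteq> j" "r \<in> R" and sf: "s = f (g, (i, j), r)"
        using s by (auto simp: D_def)
      have e: "elmat n i j r \<in> carrier G" using ij by (intro elmat_in_G) auto
      show ?thesis unfolding sf f_def using g e ij by (simp add: conj_power elmat_power ker)
    qed
    show "carrier Q \<subseteq> generate Q (f ` D)"
    proof
      fix h assume "h \<in> carrier Q"
      then obtain g where g: "g \<in> carrier G" "h = \<pi> g" using surj by auto
      let ?M = "{g \<in> carrier G. \<pi> g \<in> generate Q (f ` D)}"
      have gs: "subgroup (generate Q (f ` D)) Q" by (rule hom.H.generate_is_subgroup[OF SQ])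
      have "carrier G \<subseteq> ?M"
      proof (rule SL_generated_by_elementary)
        show "subgroup ?M G"
        proof (rule G.subgroupI)
          show "?M \<noteq> {}" using G.one_closed hom.hom_one subgroup.one_closed[OF gs] by (auto intro!: exI[of _ "1\<^sub>m n"])
        qed (use subgroup.m_inv_closed[OF gs] subgroup.m_closed[OF gs] mat_mult_closed hom_mat_mult in auto)
        fix i j r assume ij: "i < n" "j < n" "i \<noteq> j" "r \<in> R"
        have e: "elmat n i j r \<in> carrier G" using ij by (intro elmat_in_G) auto
        have "f (1\<^sub>m n, (i, j), r) = \<pi> (elmat n i j r)" using e hom.hom_one by (simp add: f_def)
        moreover have "(1\<^sub>m n, (i, j), r) \<in> D" using G.one_closed ij by (simp add: D_def)
        ultimately have "\<pi> (elmat n i j r) \<in> f ` D" by (metis imageI)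
        then show "elmat n i j r \<in> ?M" using e by (auto intro: generate.incl)
      qed
      then show "h \<in> generate Q (f ` D)" using g by auto
    qed
  qed
qed


end

section \<open>Normal subgroups generated by elementary matrices\<close>

context sl_ring begin

text \<open>The row vector \<open>v\<close> is supported on \<open>a\<close> and \<open>b\<close> and kills \<open>u\<close>, and hence both the part \<open>u1\<close> of \<open>u\<close> on \<open>{a, b}\<close> and
the rest \<open>u2\<close>. The factor for \<open>u2\<close> is a product of elementary matrices. The factor for \<open>u1\<close> is a commutator of
a column and a row through a third index \<open>k\<close>; this uses up one factor \<open>q\<close> on either side.\<close>

lemma koszul_transv_mem:
  assumes M: "subgroup M G"
    and el: "\<And>i j r. \<lbrakk>i < n; j < n; i \<noteq> j; r \<in> R\<rbrakk> \<Longrightarrow> elmat n i j (of_nat q * r) \<in> M"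
    and u: "\<And>k. k < n \<Longrightarrow> u k \<in> R" and t: "t \<in> R" and ab: "a < n" "b < n" "a \<noteq> b"
  shows "transv n u (\<lambda>l. of_nat (q\<^sup>2) * (t * (u b * ebasis a l - u a * ebasis b l))) \<in> M"
proof -
  define v where "v l = t * (u b * ebasis a l - u a * ebasis b l)" for l
  have vR: "v l \<in> R" for l using t u ab by (auto simp: v_def)
  define u1 where "u1 k = (if k = a \<or> k = b then u k else 0)" for k
  define u2 where "u2 k = (if k = a \<or> k = b then 0 else u k)" for k
  let ?V = "\<lambda>l. of_nat (q\<^sup>2) * v l"
  have p1: "pairing n v x = t * (u b * x a - u a * x b)" for x
  proof -
    have "pairing n v x = t * (u b * pairing n (ebasis a) x - u a * pairing n (ebasis b) x)"
      by (simp add: pairing_def v_def sum_distrib_left sum_subtractf algebra_simps)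
    then show ?thesis using ab by simp
  qed
  have p2: "pairing n v u2 = 0" "pairing n v u1 = 0" unfolding p1 by (simp_all add: u1_def u2_def algebra_simps)
  have "transv n (\<lambda>l. \<Sum>k\<in>{..<n} - {a, b}. u k * ebasis k l) ?V \<in> M"
  proof (rule transv_sum_left_mem[OF M])
    fix k assume k: "k \<in> {..<n} - {a, b}"
    have "transv n (ebasis k) (\<lambda>l. u k * ?V l) \<in> M"
    proof (rule transv_row_mem[OF M])
      fix j assume "j < n" "j \<noteq> k"
      then have "elmat n k j (of_nat q * (of_nat q * u k * v j)) \<in> M"
        using k vR u by (intro el) auto
      then show "elmat n k j (u k * ?V j) \<in> M" by (simp add: power2_eq_square algebra_simps)
    qed (use k in \<open>auto simp: v_def\<close>)
    then show "transv n (\<lambda>l. u k * ebasis k l) ?V \<in> M"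
      by (subst transv_cong[where u' = "ebasis k" and v' = "\<lambda>l. u k * ?V l"]) auto
    show "pairing n ?V (\<lambda>l. u k * ebasis k l) = 0" using k ab by (simp add: p1)
  qed auto
  moreover have "(\<Sum>k\<in>{..<n} - {a, b}. u k * ebasis k l) = u2 l" if "l < n" for l
  proof -
    have "(\<Sum>k\<in>{..<n} - {a, b}. u k * ebasis k l) = (\<Sum>k\<in>{..<n} - {a, b}. if k = l then u l else 0)"
      by (intro sum.cong) auto
    then show ?thesis using that by (auto simp: u2_def)
  qed
  ultimately have m2: "transv n u2 ?V \<in> M"
    by (subst transv_cong[where u' = "\<lambda>l. \<Sum>k\<in>{..<n} - {a, b}. u k * ebasis k l" and v' = ?V]) auto
  have "card {a, b} < card {..<n}" using ab n3 by simp
  then obtain k where k: "k < n" "k \<noteq> a" "k \<noteq> b"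
    by (metis card_mono finite.emptyI finite.insertI insertCI lessThan_iff not_le subsetI)
  have "transv n (\<lambda>l. of_nat q * u1 l) (ebasis k) \<in> M"
    by (rule transv_column_mem[OF M]) (use k u ab subgroup.one_closed[OF M] in \<open>auto intro!: el simp: u1_def\<close>)
  moreover have "transv n (ebasis k) (\<lambda>l. of_nat q * v l) \<in> M"
    by (rule transv_row_mem[OF M]) (use k vR ab in \<open>auto intro!: el simp: v_def[of k]\<close>)
  ultimately have "transv n (\<lambda>l. of_nat q * u1 l) (\<lambda>l. of_nat q * v l) \<in> M"
    by (rule transv_commutator_mem[OF M]) (use p2 k in simp_all)
  then have m1: "transv n u1 ?V \<in> M"
    by (subst transv_cong[where u' = "\<lambda>l. of_nat q * u1 l" and v' = "\<lambda>l. of_nat q * v l"])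
       (auto simp: power2_eq_square algebra_simps)
  have "transv n u1 ?V * transv n u2 ?V = transv n (\<lambda>k. u1 k + u2 k) ?V"
    using p2 by (intro transv_add_left) simp
  moreover have "(\<lambda>k. u1 k + u2 k) = u" by (auto simp: u1_def u2_def)
  ultimately show ?thesis using subgroup.m_closed[OF M m1 m2] by (simp add: v_def)
qed

text \<open>The conjugate is the transvection with column \<open>u = g e\<^sub>i\<close> and a row proportional to \<open>v = e\<^sub>j g\<^sup>-\<^sup>1\<close>. Because
\<open>w = e\<^sub>i g\<^sup>-\<^sup>1\<close> has \<open>w u = 1\<close>, the Koszul relations write \<open>v\<close>, which kills \<open>u\<close>, as the sum of
\<open>v\<^sub>a w\<^sub>b (u\<^sub>b e\<^sub>a - u\<^sub>a e\<^sub>b)\<close>; each summand is covered by the preceding lemma.\<close>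

lemma conj_elmat_mem:
  assumes M: "subgroup M G"
    and el: "\<And>i j r. \<lbrakk>i < n; j < n; i \<noteq> j; r \<in> R\<rbrakk> \<Longrightarrow> elmat n i j (of_nat q * r) \<in> M"
    and g: "g \<in> carrier G" and ij: "i < n" "j < n" "i \<noteq> j" and r: "r \<in> R"
  shows "g * elmat n i j (of_nat (q\<^sup>2) * r) * ginv g \<in> M"
proof -
  define h where "h = ginv g"
  have h: "h \<in> carrier G" "g * h = 1\<^sub>m n" "h * g = 1\<^sub>m n"
    using G.l_inv[OF g] G.r_inv[OF g] g by (auto simp: h_def)
  have gc: "g \<in> carrier_mat n n" "h \<in> carrier_mat n n" using g h G_carrier_mat by auto
  define u where "u k = g $$ (k, i)" for k
  define w where "w k = h $$ (i, k)" for k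
  define v where "v k = h $$ (j, k)" for k
  have uR: "u k \<in> R" "w k \<in> R" "v k \<in> R" if "k < n" for k using g h that ij by (auto simp: u_def w_def v_def carrier_G)
  have wu: "(\<Sum>k<n. w k * u k) = 1" and vu: "(\<Sum>k<n. v k * u k) = 0"
    using mult_mat_index[OF gc(2,1) ij(1) ij(1)] mult_mat_index[OF gc(2,1) ij(2) ij(1)] h(3) ij
    by (simp_all add: u_def w_def v_def)
  let ?s = "of_nat (q\<^sup>2) * r"
  define f where "f = (\<lambda>(a, b) l. of_nat (q\<^sup>2) * ((r * v a * w b) * (u b * ebasis a l - u a * ebasis b l)))"
  have "transv n u (\<lambda>l. \<Sum>x\<in>{..<n} \<times> {..<n}. f x l) \<in> M"
  proof (rule transv_sum_right_mem[OF M])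
    fix x assume x: "x \<in> {..<n} \<times> {..<n}"
    obtain a b where ab: "x = (a, b)" "a < n" "b < n" using x by auto
    show "transv n u (f x) \<in> M"
    proof (cases "a = b")
      case True
      then have "f x = (\<lambda>l. 0)" by (auto simp: f_def ab)
      then show ?thesis using subgroup.one_closed[OF M] by simp
    next
      case False
      then have "transv n u (\<lambda>l. of_nat (q\<^sup>2) * ((r * v a * w b) * (u b * ebasis a l - u a * ebasis b l))) \<in> M"
        by (intro koszul_transv_mem[OF M el] uR) (use ab uR r in auto)
      then show ?thesis by (simp add: f_def ab)
    qed
    have "pairing n (f x) u = of_nat (q\<^sup>2) * ((r * v a * w b) * (u b * pairing n (ebasis a) u - u a * pairing n (ebasis b) u))"
      by (simp add: pairing_def f_def ab sum_distrib_left sum_subtractf algebra_simps)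
    then show "pairing n (f x) u = 0" using ab by simp
  qed auto
  moreover have "(\<Sum>x\<in>{..<n} \<times> {..<n}. f x l) = ?s * v l" if l: "l < n" for l
  proof -
    have "(\<Sum>x\<in>{..<n} \<times> {..<n}. f x l) = (\<Sum>a<n. \<Sum>b<n. ?s * (v a * ebasis a l * (w b * u b)) - ?s * ((v a * u a) * (w b * ebasis b l)))"
      unfolding f_def sum.cartesian_product by (intro sum.cong) (auto simp: algebra_simps)
    also have "\<dots> = ?s * ((\<Sum>a<n. v a * ebasis a l) * (\<Sum>b<n. w b * u b)) - ?s * ((\<Sum>a<n. v a * u a) * (\<Sum>b<n. w b * ebasis b l))"
      by (simp only: sum_subtractf sum_product) (simp only: sum_distrib_left)
    also have "\<dots> = ?s * (\<Sum>a<n. v a * ebasis a l)" unfolding wu vu by simp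
    also have "(\<Sum>a<n. v a * ebasis a l) = (\<Sum>a<n. if a = l then v l else 0)" by (intro sum.cong) auto
    also have "\<dots> = v l" using l by simp
    finally show ?thesis .
  qed
  ultimately have "transv n u (\<lambda>l. ?s * v l) \<in> M"
    by (subst transv_cong[where u' = u and v' = "\<lambda>l. \<Sum>x\<in>{..<n} \<times> {..<n}. f x l"]) auto
  moreover have "g * elmat n i j ?s * h = transv n u (\<lambda>l. ?s * v l)"
    unfolding elmat_def transv_conj[OF gc h(2)]
  proof (rule transv_cong)
    fix a b assume "a < n" "b < n"
    have "(\<Sum>k<n. g $$ (a, k) * ebasis i k) = u a"
      using pairing_ebasis(1)[OF ij(1), of "\<lambda>k. g $$ (a, k)"] by (simp add: pairing_def u_def)
    moreover have "(\<Sum>k<n. ?s * ebasis j k * h $$ (k, b)) = ?s * v b"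
      using pairing_ebasis(2)[OF ij(2), of "\<lambda>k. h $$ (k, b)"]
      by (simp add: pairing_def v_def mult.assoc flip: sum_distrib_left)
    ultimately show "(\<Sum>k<n. g $$ (a, k) * ebasis i k) * (\<Sum>k<n. ?s * ebasis j k * h $$ (k, b)) = u a * (?s * v b)"
      by simp
  qed
  ultimately show ?thesis by (simp add: h_def)
qed

lemma chain_mem:
  assumes M: "subgroup M G" and c: "\<And>i. i < n \<Longrightarrow> elmat n i (Suc i mod n) (c i) \<in> M"
    and i: "i < n" and l: "0 < l" "l < n"
  shows "elmat n i ((i + l) mod n) (\<Prod>s<l. c ((i + s) mod n)) \<in> M"
  using l
proof (induction l)
  case (Suc l)
  show ?case
  proof (cases "l = 0")
    case True
    then show ?thesis using c[OF i] i by simp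
  next
    case False
    let ?k = "(i + l) mod n"
    have k: "?k < n" using i by simp
    have e: "Suc ?k mod n = (i + Suc l) mod n" by (simp add: mod_Suc_eq)
    have neq: "(i + a) mod n \<noteq> (i + b) mod n" if "a < n" "b < n" "a \<noteq> b" for a b
      using that cong_add_lcancel_nat[of i a b n] by (auto simp: cong_def)
    have "elmat n i ((i + Suc l) mod n) ((\<Prod>s<l. c ((i + s) mod n)) * c ?k) \<in> M"
    proof (rule elmat_commutator_mem[OF M])
      show "elmat n i ?k (\<Prod>s<l. c ((i + s) mod n)) \<in> M" using Suc False by simp
      show "elmat n ?k ((i + Suc l) mod n) (c ?k) \<in> M" using c[OF k] unfolding e .
      show "i \<noteq> ?k" "?k \<noteq> (i + Suc l) mod n" "i \<noteq> (i + Suc l) mod n"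
        using neq[of 0 l] neq[of l "Suc l"] neq[of 0 "Suc l"] Suc.prems False i by auto
    qed (use i k in auto)
    then show ?thesis by simp
  qed
qed auto

definition entry_set :: "'a mat set \<Rightarrow> nat \<Rightarrow> nat \<Rightarrow> 'a set" where
  "entry_set M i j = {w. elmat n i j w \<in> M}"

lemma entry_set_zero: "subgroup M G \<Longrightarrow> 0 \<in> entry_set M i j"
  using subgroup.one_closed by (fastforce simp: entry_set_def)

lemma entry_set_add: "\<lbrakk>subgroup M G; i \<noteq> j; i < n; x \<in> entry_set M i j; y \<in> entry_set M i j\<rbrakk> \<Longrightarrow> x + y \<in> entry_set M i j"
  using subgroup.m_closed[of M G "elmat n i j x" "elmat n i j y"] by (auto simp: entry_set_def elmat_add)

lemma entry_set_uminus:
  assumes "subgroup M G" "i \<noteq> j" "i < n" "x \<in> entry_set M i j"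
  shows "- x \<in> entry_set M i j"
proof -
  have m: "elmat n i j x \<in> M" using assms by (simp add: entry_set_def)
  then have g: "elmat n i j x \<in> carrier G" using subgroup.subset[OF assms(1)] by auto
  have "elmat n i j (- x) \<in> carrier G"
  proof (cases "j < n")
    case True
    have "\<forall>a<n. \<forall>b<n. elmat n i j x $$ (a, b) \<in> R" using g unfolding carrier_G by blast
    then have "elmat n i j x $$ (i, j) \<in> R" using assms(3) True by blast
    then have "x \<in> R" using assms(2,3) True by simp
    then show ?thesis using assms True by (intro elmat_in_G) auto
  next
    case False
    then have "elmat n i j (- x) = 1\<^sub>m n" by (intro eq_matI) auto
    then show ?thesis using G.one_closed by simp
  qed
  then have "ginv (elmat n i j x) = elmat n i j (- x)"
    using elmat_add[OF assms(2,3), of "- x" x] g by (intro G.inv_equality) auto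
  then show ?thesis using subgroup.m_inv_closed[OF assms(1) m] by (simp add: entry_set_def)
qed

lemma entry_set_of_int:
  assumes "subgroup M G" "i \<noteq> j" "i < n" "x \<in> entry_set M i j"
  shows "of_int a * x \<in> entry_set M i j"
proof -
  have nat: "of_nat k * x \<in> entry_set M i j" for k
    by (induction k) (use assms entry_set_zero entry_set_add in \<open>auto simp: algebra_simps\<close>)
  show ?thesis
  proof (cases "a \<ge> 0")
    case True then show ?thesis using nat[of "nat a"] by simp
  next
    case False
    then have "of_int a * x = - (of_nat (nat (- a)) * x)" by simp
    then show ?thesis using entry_set_uminus[OF assms(1-3) nat[of "nat (- a)"]] by metis
  qed
qed

lemma entry_set_mult: "\<lbrakk>subgroup M G; x \<in> entry_set M i k; y \<in> entry_set M k j; i \<noteq> k; k \<noteq> j; i \<noteq> j; i < n; k < n; j < n\<rbrakk>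
    \<Longrightarrow> x * y \<in> entry_set M i j"
  using elmat_commutator_mem[of M i k x j y] by (auto simp: entry_set_def)

lemma third_index: "\<exists>k<n. k \<noteq> i \<and> k \<noteq> (j::nat)"
proof -
  have "i \<noteq> 0 \<and> j \<noteq> 0 \<or> i \<noteq> 1 \<and> j \<noteq> 1 \<or> i \<noteq> 2 \<and> j \<noteq> 2" by auto
  then show ?thesis
    by (elim disjE) (use n3 in \<open>auto intro: exI[of _ 0] exI[of _ 1] exI[of _ 2]\<close>)
qed

text \<open>Products along paths in the cycle give \<open>N^n\<close> in every position, and commutators with these spread the entry \<open>N / p\<close> to
\<open>N^(3n+1) / p\<close> in every position. The set \<open>J\<close> of elements that occur in all positions is closed under
products, as there is a third index; it is thus stable under multiplication by \<open>V / p\<close> with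
\<open>V = N^(3n+1)\<close>, and as \<open>V\<close> is prime to \<open>p\<close>, also by \<open>1 / p\<close>.\<close>

lemma cyclic_elementary_generate:
  assumes M: "subgroup M G" and N: "coprime N p"
    and c: "\<And>i. i < n \<Longrightarrow> elmat n i (Suc i mod n) (if i = n - 1 then of_nat N * ip else of_nat N) \<in> M"
    and ij: "i < n" "j < n" "i \<noteq> j" and r: "r \<in> R"
  shows "elmat n i j (of_nat (N ^ n) * r) \<in> M"
proof -
  let ?c = "\<lambda>i. if i = n - 1 then of_nat N * ip else of_nat N"
  let ?u = "of_nat (N ^ n) :: 'a"
  have u: "?u \<in> entry_set M i j" if ij: "i < n" "j < n" "i \<noteq> j" for i j
  proof -
    define l where "l = (j + n - i) mod n"
    have l: "(i + l) mod n = j" "l < n" unfolding l_def using ij by (simp_all add: mod_add_right_eq)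
    have l0: "0 < l" using l ij by (cases l) auto
    have "\<exists>e. (\<Prod>s<m. ?c ((i + s) mod n)) = of_nat N ^ m * ip ^ e" for m
    proof (induction m)
      case (Suc m)
      then obtain e where e: "(\<Prod>s<m. ?c ((i + s) mod n)) = of_nat N ^ m * ip ^ e" by blast
      show ?case
        by (rule exI[of _ "if (i + m) mod n = n - 1 then Suc e else e"])
           (simp only: prod.lessThan_Suc e, simp add: algebra_simps)
    qed (auto intro: exI[of _ 0])
    then obtain e where e: "(\<Prod>s<l. ?c ((i + s) mod n)) = of_nat N ^ l * ip ^ e" by blast
    have "of_nat N ^ l * ip ^ e \<in> entry_set M i j"
      using chain_mem[OF M, of ?c, OF c ij(1) l0 l(2)] unfolding e l(1) by (simp add: entry_set_def)
    from entry_set_of_int[OF M ij(3,1) this, of "int (N ^ (n - l) * p ^ e)"]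
    have "of_nat (N ^ (n - l) * p ^ e) * (of_nat N ^ l * ip ^ e) \<in> entry_set M i j" by simp
    also have "of_nat (N ^ (n - l) * p ^ e) * (of_nat N ^ l * ip ^ e) = of_nat (N ^ (n - l) * N ^ l) * (of_nat p ^ e * ip ^ e)"
      by (simp add: algebra_simps)
    also have "N ^ (n - l) * N ^ l = N ^ n" using l(2) by (simp flip: power_add)
    also have "of_nat (N ^ n) * (of_nat p ^ e * ip ^ e) = ?u" by (simp only: ppow mult_1_right)
    finally show ?thesis .
  qed
  have umul: "w * ?u \<in> entry_set M a b" if "w \<in> entry_set M a b" "a < n" "a \<noteq> b" for w a b
    using entry_set_of_int[OF M that(3,2,1), of "int (N ^ n)"] by (simp add: mult.commute)
  have right: "w * ?u \<in> entry_set M a b'" if "w \<in> entry_set M a b" "a < n" "b < n" "b' < n" "a \<noteq> b" "b \<noteq> b'" "a \<noteq> b'" for w a b b'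
    using entry_set_mult[OF M that(1) u[OF that(3,4,6)]] that by auto
  have left: "w * ?u \<in> entry_set M a' b" if "w \<in> entry_set M a b" "a < n" "b < n" "a' < n" "a \<noteq> b" "a' \<noteq> a" "a' \<noteq> b" for w a b a'
    using entry_set_mult[OF M u[OF that(4,2,6)] that(1)] that by (auto simp: mult.commute)
  let ?w = "of_nat N * ip"
  have w0: "?w \<in> entry_set M (n - 1) 0" using c[of "n - 1"] n3 by (simp add: entry_set_def)
  let ?v = "?w * ?u * ?u * ?u"
  have v: "?v \<in> entry_set M i j" if ij: "i < n" "j < n" "i \<noteq> j" for i j
  proof -
    let ?a = "n - 1" and ?b = "0 :: nat"
    have ab: "?a < n" "?b < n" "?a \<noteq> ?b" using n3 by auto
    consider "i = ?a" "j = ?b" | "i = ?a" "j \<noteq> ?b" | "i \<noteq> ?a" "j = ?b" | "i \<noteq> ?a" "j \<noteq> ?b" "j \<noteq> ?a"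
      | "i \<noteq> ?a" "j = ?a" "i \<noteq> ?b" | "i = ?b" "j = ?a" using ab(3) by blast
    then show ?thesis
    proof cases
      case 1
      then show ?thesis using umul[OF umul[OF umul[OF w0]]] ab by simp
    next
      case 2
      have "?w * ?u \<in> entry_set M i j" using right[OF w0, of j] 2 ab ij by auto
      then show ?thesis using umul ij by blast
    next
      case 3
      have "?w * ?u \<in> entry_set M i j" using left[OF w0, of i] 3 ab ij by auto
      then show ?thesis using umul ij by blast
    next
      case 4
      have 1: "?w * ?u \<in> entry_set M ?a j" using right[OF w0, of j] 4 ab ij by auto
      have "?w * ?u * ?u \<in> entry_set M i j" using left[OF 1, of i] 4 ab ij by auto
      then show ?thesis using umul ij by blast
    next
      case 5
      have 1: "?w * ?u \<in> entry_set M i ?b" using left[OF w0, of i] 5 ab ij by auto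
      have "?w * ?u * ?u \<in> entry_set M i j" using right[OF 1, of j] 5 ab ij by auto
      then show ?thesis using umul ij by blast
    next
      case 6
      obtain k where k: "k < n" "k \<noteq> ?a" "k \<noteq> ?b" using third_index by blast
      have 1: "?w * ?u \<in> entry_set M ?a k" using right[OF w0, of k] k ab by auto
      have 2: "?w * ?u * ?u \<in> entry_set M ?b k" using left[OF 1, of ?b] k ab by auto
      show ?thesis using right[OF 2, of ?a] k ab 6 by auto
    qed
  qed
  define J where "J = {x. \<forall>i<n. \<forall>j<n. i \<noteq> j \<longrightarrow> x \<in> entry_set M i j}"
  have uJ: "?u \<in> J" and vJ: "?v \<in> J" using u v by (auto simp: J_def)
  have J_mult: "x * y \<in> J" if "x \<in> J" "y \<in> J" for x y
    unfolding J_def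
  proof (intro CollectI allI impI)
    fix i j assume ij: "i < n" "j < n" "i \<noteq> j"
    obtain k where k: "k < n" "k \<noteq> i" "k \<noteq> j" using third_index by blast
    show "x * y \<in> entry_set M i j"
      by (rule entry_set_mult[OF M, of x i k]) (use that k ij in \<open>auto simp: J_def\<close>)
  qed
  have J_lin: "of_int a * x + of_int b * y \<in> J" if "x \<in> J" "y \<in> J" for a b x y
    using that by (auto simp: J_def intro!: entry_set_add[OF M] entry_set_of_int[OF M])
  define V where "V = N ^ (3 * n + 1)"
  have "coprime (int V) (int p)" using N by (simp add: V_def)
  then obtain \<alpha> \<beta> where ab: "\<alpha> * int V + \<beta> * int p = 1" using bezout_int[of "int V" "int p"] by auto
  have vV: "?v = of_nat V * ip" by (simp add: V_def power_add power_mult power3_eq_cube power_mult_distrib algebra_simps mult.commute[of 3 n])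
  have ip_eq: "ip = of_int \<alpha> * ?v + of_int \<beta>"
  proof -
    have "ip = of_int (\<alpha> * int V + \<beta> * int p) * ip" by (simp add: ab)
    also have "\<dots> = of_int \<alpha> * (of_nat V * ip) + of_int \<beta> * (of_nat p * ip)" by (simp add: algebra_simps)
    finally show ?thesis unfolding pip vV by simp
  qed
  have J_ip: "ip * x \<in> J" if "x \<in> J" for x
  proof -
    have "ip * x = of_int \<alpha> * (?v * x) + of_int \<beta> * x" by (subst ip_eq) (simp add: algebra_simps)
    then show ?thesis using J_lin J_mult vJ that by metis
  qed
  have J_pow: "ip ^ k * ?u \<in> J" for k
    by (induction k) (use uJ J_ip in \<open>auto simp: mult.assoc\<close>)
  obtain a k where "r = of_int a * ip ^ k" using r by (auto simp: R_def)
  then have "?u * r = of_int a * (ip ^ k * ?u) + of_int 0 * (ip ^ k * ?u)" by (simp add: algebra_simps)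
  then have "?u * r \<in> J" using J_lin J_pow by metis
  then show ?thesis using ij by (auto simp: J_def entry_set_def)
qed

lemma exists_normal_finite_index:
  assumes M: "subgroup M G" and N: "coprime N p" "N > 0"
    and c: "\<And>i. i < n \<Longrightarrow> elmat n i (Suc i mod n) (if i = n - 1 then of_nat N * ip else of_nat N) \<in> M"
  shows "\<exists>L. L \<lhd> G \<and> L \<subseteq> M \<and> finite (rcosets\<^bsub>G\<^esub> L)"
proof -
  define q where "q = (N ^ n)\<^sup>2"
  have q: "q > 0" "coprime q p" using N by (simp_all add: q_def)
  have el: "elmat n i j (of_nat (N ^ n) * r) \<in> M" if "i < n" "j < n" "i \<noteq> j" "r \<in> R" for i j r
    by (rule cyclic_elementary_generate[OF M N(1) c that])
  define S where "S = {g * elmat n i j (of_nat q * r) * ginv g | g i j r. g \<in> carrier G \<and> i < n \<and> j < n \<and> i \<noteq> j \<and> r \<in> R}"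
  have SM: "S \<subseteq> M" unfolding S_def q_def
    using conj_elmat_mem[OF M el] by blast
  have SG: "S \<subseteq> carrier G" using SM subgroup.subset[OF M] by auto
  define L where "L = generate G S"
  have normal: "L \<lhd> G" unfolding L_def
  proof (rule G.normal_generateI[OF SG])
    fix h g assume "h \<in> S" and g: "g \<in> carrier G"
    then obtain g' i j r where h: "h = g' * elmat n i j (of_nat q * r) * ginv g'" "g' \<in> carrier G" "i < n" "j < n" "i \<noteq> j" "r \<in> R"
      by (auto simp: S_def)
    let ?e = "elmat n i j (of_nat q * r)"
    have e: "?e \<in> carrier G" using h by (intro elmat_in_G) auto
    have gg: "g * g' \<in> carrier G" using G.m_closed[OF g h(2)] by simp
    have "g \<otimes>\<^bsub>G\<^esub> (g' \<otimes>\<^bsub>G\<^esub> ?e \<otimes>\<^bsub>G\<^esub> ginv g') \<otimes>\<^bsub>G\<^esub> ginv g = (g \<otimes>\<^bsub>G\<^esub> g') \<otimes>\<^bsub>G\<^esub> ?e \<otimes>\<^bsub>G\<^esub> ginv (g \<otimes>\<^bsub>G\<^esub> g')"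
      using g h(2) e by (simp only: G.inv_mult_group G.m_assoc G.m_closed G.inv_closed)
    then show "g \<otimes>\<^bsub>G\<^esub> h \<otimes>\<^bsub>G\<^esub> ginv g \<in> S" unfolding h(1) mult_G S_def using gg h(3-6) by blast
  qed
  have LM: "L \<subseteq> M" unfolding L_def using G.generate_subgroup_incl[OF SM M] .
  interpret L: normal L G by (rule normal)
  have Lsub: "subgroup L G" by (rule L.subgroup_axioms)
  have "congruence_hom R p ip n (G Mod L) (\<lambda>a. L #>\<^bsub>G\<^esub> a) q"
  proof (intro congruence_hom.intro sl_ring_axioms congruence_hom_axioms.intro)
    show "group_hom G (G Mod L) (\<lambda>a. L #>\<^bsub>G\<^esub> a)"
      by (intro group_hom.intro group_hom_axioms.intro G.is_group L.factorgroup_is_group L.r_coset_hom_Mod)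
    fix i j r assume ij: "i < n" "j < n" "i \<noteq> j" "r \<in> R"
    let ?e = "elmat n i j (of_nat q * r)"
    have e: "?e \<in> carrier G" using ij by (intro elmat_in_G) auto
    have "1\<^sub>m n * ?e * ginv (1\<^sub>m n) = ?e" using G.inv_one e G.r_one[OF e] by simp
    then have "?e \<in> S" unfolding S_def using ij G.one_closed by (metis (mono_tags, lifting) mem_Collect_eq one_G)
    then have "?e \<in> L" by (simp add: L_def generate.incl)
    then show "L #>\<^bsub>G\<^esub> ?e = \<one>\<^bsub>G Mod L\<^esub>" using G.coset_join2[OF e Lsub] by (simp add: FactGroup_def)
  qed
  then interpret congruence_hom R p ip n "G Mod L" "\<lambda>a. L #>\<^bsub>G\<^esub> a" q .
  have "finite (carrier (G Mod L))"
    by (rule finite_quotient[OF q]) (auto simp: FactGroup_def RCOSETS_def)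
  then show ?thesis using normal LM by (auto simp: FactGroup_def)
qed

end

section \<open>Actions of finite index subgroups\<close>

context sl_ring begin

lemma elmat_pow: "i \<noteq> j \<Longrightarrow> i < n \<Longrightarrow> elmat n i j r [^]\<^bsub>G\<^esub> (k::nat) = elmat n i j (of_nat k * r)"
  by (induction k) (simp_all add: elmat_add algebra_simps)

lemma elementary_in_finite_index:
  assumes H: "subgroup H G" and fin: "finite (rcosets\<^bsub>G\<^esub> H)"
  shows "\<exists>N>0. coprime N p \<and> (\<forall>i<n. \<forall>j<n. i \<noteq> j \<longrightarrow> (\<forall>r\<in>R. elmat n i j (of_nat N * r) \<in> H))"
proof (cases "p = 0")
  case True
  (* p = 0 is possible only in the zero ring *)
  then have triv: "x = 0" for x :: 'a using pip by (metis mult_1 mult_zero_left of_nat_0)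
  have "elmat n i j (of_nat 1 * r) \<in> H" for i j r
    using triv[of "of_nat 1 * r"] subgroup.one_closed[OF H] by simp
  then show ?thesis using True by (intro exI[of _ 1]) auto
next
  case False
  define d :: nat where "d = fact (card (rcosets\<^bsub>G\<^esub> H))"
  have "d > 0" by (simp add: d_def)
  then obtain N k where N: "N > 0" "coprime N p" "d dvd N * p ^ k" using coprime_part[of d p] False by auto
  then obtain t where t: "N * p ^ k = d * t" by blast
  have "elmat n i j (of_nat N * r) \<in> H" if ij: "i < n" "j < n" "i \<noteq> j" "r \<in> R" for i j r
  proof -
    have "of_nat N * r = of_nat N * (of_nat p ^ k * ip ^ k) * r" by (simp add: ppow)
    also have "\<dots> = of_nat (N * p ^ k) * (ip ^ k * r)" by (simp add: algebra_simps)
    also have "\<dots> = of_nat d * (of_nat t * ip ^ k * r)" unfolding t by (simp add: algebra_simps)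
    finally have e: "of_nat N * r = of_nat d * (of_nat t * ip ^ k * r)" .
    have "ip ^ k \<in> R" using R_I[of 1 k] by simp
    then have x: "elmat n i j (of_nat t * ip ^ k * r) \<in> carrier G" using ij by (intro elmat_in_G) auto
    show ?thesis using G.finite_index_power[OF H fin x] unfolding elmat_pow[OF ij(3,1)] e d_def .
  qed
  then show ?thesis using N by blast
qed

lemma pairing_ebasis_neq [simp]: "i \<noteq> j \<Longrightarrow> pairing n (ebasis i) (ebasis j) = 0"
  unfolding pairing_def by (intro sum.neutral) auto

lemma elmat_steinberg:
  assumes "i \<noteq> j" "k < n"
  shows "elmat n i k a * elmat n k j b = elmat n k j b * (elmat n i j (a * b) * elmat n i k a)"
proof -
  have 1: "elmat n i k a = transv n (\<lambda>l. a * ebasis i l) (ebasis k)"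
    unfolding elmat_def by (rule transv_cong) auto
  have 2: "elmat n i j (a * b) = transv n (\<lambda>l. a * ebasis i l) (\<lambda>l. b * ebasis j l)"
    unfolding elmat_def by (rule transv_cong) auto
  have "pairing n (\<lambda>l. b * ebasis j l) (\<lambda>l. a * ebasis i l) = 0"
    using assms(1) by simp
  then show ?thesis unfolding 1 2 unfolding elmat_def using assms(2) by (intro transv_commutator)
qed

lemma elmat_commute:
  assumes "b \<noteq> c" "d \<noteq> a"
  shows "elmat n a b x * elmat n c d y = elmat n c d y * elmat n a b x"
  unfolding elmat_def by (rule transv_commute) (use assms in simp_all)

end

locale sl_action = sl_ring R p ip n + cat0 "X" d geo
  for R :: "'a::comm_ring_1 set" and p ip n and X :: "'x set" and d geo +
  fixes H :: "'a mat set" and \<phi> :: "'a mat \<Rightarrow> 'x \<Rightarrow> 'x"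
  assumes complete: "mcomplete"
    and H: "subgroup H (SL n R)"
    and act_mult: "\<lbrakk>g \<in> H; h \<in> H; x \<in> X\<rbrakk> \<Longrightarrow> \<phi> (g * h) x = \<phi> g (\<phi> h x)"
    and act_one: "x \<in> X \<Longrightarrow> \<phi> (1\<^sub>m n) x = x"
    and act_isom: "g \<in> H \<Longrightarrow> isometric_map (\<phi> g)"
    and semisimple: "g \<in> H \<Longrightarrow> \<exists>x\<in>X. \<forall>y\<in>X. d x (\<phi> g x) \<le> d y (\<phi> g y)"
begin

lemma H_G: "g \<in> H \<Longrightarrow> g \<in> carrier G" using subgroup.subset[OF H] by auto
lemma H_mult: "g \<in> H \<Longrightarrow> h \<in> H \<Longrightarrow> g * h \<in> H" using subgroup.m_closed[OF H, of g h] by simp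
lemma H_one: "1\<^sub>m n \<in> H" using subgroup.one_closed[OF H] by simp
lemma H_inv: "g \<in> H \<Longrightarrow> ginv g \<in> H" using subgroup.m_inv_closed[OF H] by simp
lemma act_in: "g \<in> H \<Longrightarrow> x \<in> X \<Longrightarrow> \<phi> g x \<in> X" using act_isom[of g] by (auto simp: isometric_map_def)
lemma act_dist: "g \<in> H \<Longrightarrow> x \<in> X \<Longrightarrow> y \<in> X \<Longrightarrow> d (\<phi> g x) (\<phi> g y) = d x y" using act_isom[of g] by (auto simp: isometric_map_def)
lemma inv_l: "g \<in> H \<Longrightarrow> ginv g * g = 1\<^sub>m n" using G.l_inv[OF H_G] by simp
lemma inv_r: "g \<in> H \<Longrightarrow> g * ginv g = 1\<^sub>m n" using G.r_inv[OF H_G] by simp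

lemma H_pow: "g \<in> H \<Longrightarrow> g [^]\<^bsub>G\<^esub> (k::nat) \<in> H"
  by (induction k) (auto simp: H_one H_mult)

lemma act_pow: "g \<in> H \<Longrightarrow> x \<in> X \<Longrightarrow> (\<phi> g ^^ k) x = \<phi> (g [^]\<^bsub>G\<^esub> k) x"
proof (induction k)
  case (Suc k)
  have "g [^]\<^bsub>G\<^esub> Suc k = g * g [^]\<^bsub>G\<^esub> k" using G.nat_pow_Suc2[OF H_G[OF Suc.prems(1)], of k] by simp
  then show ?case using Suc act_mult[OF Suc.prems(1) H_pow[OF Suc.prems(1)] Suc.prems(2), of k] by simp
qed (simp add: act_one)

lemma disp_mult:
  assumes "g \<in> H" "h \<in> H" "x \<in> X"
  shows "d x (\<phi> (g * h) x) \<le> d x (\<phi> g x) + d x (\<phi> h x)"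
proof -
  have "d x (\<phi> g (\<phi> h x)) \<le> d x (\<phi> g x) + d (\<phi> g x) (\<phi> g (\<phi> h x))"
    using assms by (intro triangle act_in)
  also have "d (\<phi> g x) (\<phi> g (\<phi> h x)) = d x (\<phi> h x)" using assms by (intro act_dist act_in)
  finally show ?thesis using assms by (simp add: act_mult)
qed

lemma disp_inv:
  assumes "g \<in> H" "x \<in> X"
  shows "d x (\<phi> (ginv g) x) = d x (\<phi> g x)"
proof -
  have "d x (\<phi> (ginv g) x) = d (\<phi> g x) (\<phi> g (\<phi> (ginv g) x))"
    using assms by (intro act_dist[symmetric] act_in H_inv)
  also have "\<phi> g (\<phi> (ginv g) x) = x"
    using act_mult[OF assms(1) H_inv[OF assms(1)] assms(2)] inv_r[OF assms(1)] act_one[OF assms(2)] by simp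
  finally show ?thesis by (simp add: commute)
qed

lemma disp_pow: "g \<in> H \<Longrightarrow> x \<in> X \<Longrightarrow> d x (\<phi> (g [^]\<^bsub>G\<^esub> (k::nat)) x) \<le> real k * d x (\<phi> g x)"
proof (induction k)
  case (Suc k)
  have "d x (\<phi> (g [^]\<^bsub>G\<^esub> k * g) x) \<le> d x (\<phi> (g [^]\<^bsub>G\<^esub> k) x) + d x (\<phi> g x)"
    using Suc.prems by (intro disp_mult H_pow)
  then show ?case using Suc by (simp add: algebra_simps)
qed (simp add: act_one)

text \<open>For a point \<open>x\<close> of minimal displacement \<open>L\<close>, the power of \<open>z\<close> with exponent \<open>S * S\<close>, where \<open>S = 2 ^ s\<close>, has
displacement at least \<open>S * S * L\<close>. As a commutator of \<open>S\<close>-th powers, it has displacement at most \<open>2 * S * A\<close>. So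
\<open>L = 0\<close>.\<close>

lemma elementary_elliptic:
  assumes N: "\<And>i j r. \<lbrakk>i < n; j < n; i \<noteq> j; r \<in> R\<rbrakk> \<Longrightarrow> elmat n i j (of_nat N * r) \<in> H"
    and ij: "i < n" "j < n" "i \<noteq> j" "r \<in> R"
  shows "\<exists>x\<in>X. \<phi> (elmat n i j (of_nat (N\<^sup>2) * r)) x = x"
proof -
  let ?z = "elmat n i j (of_nat (N\<^sup>2) * r)"
  have z: "?z \<in> H" using N[OF ij(1-3), of "of_nat N * r"] ij by (simp add: power2_eq_square mult.assoc)
  obtain x where x: "x \<in> X" "\<And>y. y \<in> X \<Longrightarrow> d x (\<phi> ?z x) \<le> d y (\<phi> ?z y)" using semisimple[OF z] by blast
  let ?L = "d x (\<phi> ?z x)"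
  obtain k where k: "k < n" "k \<noteq> i" "k \<noteq> j" using third_index by blast
  let ?a = "elmat n i k (of_nat N * r)" and ?b = "elmat n k j (of_nat N * 1)"
  have ab: "?a \<in> H" "?b \<in> H" using k ij by (auto intro!: N simp del: mult_1_right)
  define A where "A = d x (\<phi> ?a x) + d x (\<phi> ?b x)"
  have bound: "2 ^ s * ?L \<le> 2 * A" for s
  proof -
    define S :: nat where "S = 2 ^ s"
    let ?as = "?a [^]\<^bsub>G\<^esub> S" and ?bs = "?b [^]\<^bsub>G\<^esub> S" and ?c = "?z [^]\<^bsub>G\<^esub> (2 ^ (2 * s) :: nat)"
    have m: "?as \<in> H" "?bs \<in> H" "?c \<in> H" using ab z by (auto intro!: H_pow)
    have SS: "2 ^ (2 * s) = S * S" by (simp add: S_def power_add mult_2)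
    have cS: "?c = elmat n i j ((of_nat S * (of_nat N * r)) * (of_nat S * (of_nat N * 1)))"
      unfolding elmat_pow[OF ij(3,1)] SS by (simp add: power2_eq_square algebra_simps)
    have "?as = elmat n i k (of_nat S * (of_nat N * r))" "?bs = elmat n k j (of_nat S * (of_nat N * 1))"
      using elmat_pow[of i k "of_nat N * r" S] elmat_pow[of k j "of_nat N * 1" S] k ij by auto
    then have eq: "?as * ?bs = ?bs * (?c * ?as)" unfolding cS using elmat_steinberg[OF ij(3) k(1)] by simp
    have cm: "?as \<in> carrier_mat n n" "?bs \<in> carrier_mat n n" "?c \<in> carrier_mat n n"
      "ginv ?as \<in> carrier_mat n n" "ginv ?bs \<in> carrier_mat n n"
      using m H_inv by (auto intro!: G_carrier_mat H_G)
    have "ginv ?bs * (?as * ?bs) * ginv ?as = (ginv ?bs * ?bs) * ?c * (?as * ginv ?as)"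
      unfolding eq using cm by (simp add: assoc_mult_mat[of _ n n _ n _ n] mult_carrier_mat[of _ n n _ n])
    also have "\<dots> = ?c" unfolding inv_l[OF m(2)] inv_r[OF m(1)] using cm by simp
    finally have c: "?c = ginv ?bs * (?as * ?bs) * ginv ?as" by simp
    have "2 ^ (2 * s) * ?L \<le> d x ((\<phi> ?z ^^ 2 ^ (2 * s)) x)"
      by (rule displacement_power) (use act_isom[OF z] x in auto)
    also have "\<dots> = d x (\<phi> ?c x)" using act_pow[OF z x(1)] by simp
    also have "\<dots> \<le> d x (\<phi> (ginv ?bs * (?as * ?bs)) x) + d x (\<phi> (ginv ?as) x)"
      by (subst c, rule disp_mult) (use m H_inv H_mult x in auto)
    also have "d x (\<phi> (ginv ?bs * (?as * ?bs)) x) \<le> d x (\<phi> (ginv ?bs) x) + d x (\<phi> (?as * ?bs) x)"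
      by (rule disp_mult) (use m H_inv H_mult x in auto)
    also have "d x (\<phi> (?as * ?bs) x) \<le> d x (\<phi> ?as x) + d x (\<phi> ?bs x)"
      by (rule disp_mult) (use m x in auto)
    finally have 1: "2 ^ (2 * s) * ?L \<le> 2 * d x (\<phi> ?as x) + 2 * d x (\<phi> ?bs x)"
      unfolding disp_inv[OF m(1) x(1)] disp_inv[OF m(2) x(1)] by linarith
    have 2: "d x (\<phi> ?as x) \<le> real S * d x (\<phi> ?a x)" "d x (\<phi> ?bs x) \<le> real S * d x (\<phi> ?b x)"
      using ab x by (auto intro!: disp_pow)
    have "2 ^ (2 * s) * ?L \<le> 2 * (real S * d x (\<phi> ?a x)) + 2 * (real S * d x (\<phi> ?b x))"
      using 1 2 by (meson add_mono mult_left_mono order_trans zero_le_numeral)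
    also have "\<dots> = 2 ^ s * (2 * A)" by (simp add: A_def S_def algebra_simps)
    finally have "2 ^ (2 * s) * ?L \<le> 2 ^ s * (2 * A)" .
    moreover have "(2::real) ^ (2 * s) = 2 ^ s * 2 ^ s" by (simp add: mult_2 power_add)
    ultimately have "2 ^ s * (2 ^ s * ?L) \<le> 2 ^ s * (2 * A)" by (simp only: mult.assoc)
    then show ?thesis by simp
  qed
  have "?L = 0"
  proof (rule ccontr)
    assume "?L \<noteq> 0"
    then have "?L > 0" using nonneg[of x "\<phi> ?z x"] by linarith
    then obtain s where "2 * A / ?L < 2 ^ s" using real_arch_pow[of 2] by auto
    then have "2 * A < 2 ^ s * ?L" using \<open>?L > 0\<close> by (simp add: pos_divide_less_eq)
    then show False using bound[of s] by simp
  qed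
  then show ?thesis using x act_in[OF z x(1)] by (intro bexI[of _ x]) auto
qed

definition common_fixed :: "'a mat set \<Rightarrow> 'x set" where
  "common_fixed Y = {x \<in> X. \<forall>g\<in>Y. \<phi> g x = x}"

lemma common_fixed_closed_convex:
  assumes "Y \<subseteq> H" shows "geo_convex (common_fixed Y)" "closedin mtopology (common_fixed Y)"
proof -
  have e: "common_fixed Y = \<Inter>(insert X ((\<lambda>g. fixed_points (\<phi> g)) ` Y))" by (auto simp: common_fixed_def fixed_points_def)
  show "geo_convex (common_fixed Y)" unfolding e
    by (rule geo_convex_Inter) (use assms in \<open>auto simp: geo_convex_M intro!: geo_convex_fixed_points act_isom\<close>)
  show "closedin mtopology (common_fixed Y)" unfolding e
    by (rule closedin_Inter) (use assms closedin_topspace[of mtopology] in \<open>auto intro!: closedin_fixed_points act_isom\<close>)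
qed

text \<open>Project a fixed point of \<open>g\<close> to the common fixed set of \<open>Y\<close>, which is \<open>g\<close>-invariant.\<close>

lemma common_fixed_insert_nonempty:
  assumes Y: "Y \<subseteq> H" and g: "g \<in> H" and ne: "common_fixed Y \<noteq> {}" and z: "z \<in> X" "\<phi> g z = z"
    and inv: "\<And>x h. x \<in> common_fixed Y \<Longrightarrow> h \<in> Y \<Longrightarrow> \<phi> h (\<phi> g x) = \<phi> g x"
  shows "common_fixed (insert g Y) \<noteq> {}"
proof -
  have "\<exists>x\<in>common_fixed Y. \<forall>f\<in>{\<phi> g}. f x = x"
  proof (rule fixed_point_invariant_set[where F = "{z}"])
    show "f ` common_fixed Y \<subseteq> common_fixed Y" if "f \<in> {\<phi> g}" for f
      using that inv act_in[OF g] by (auto simp: common_fixed_def)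
  qed (use complete z ne common_fixed_closed_convex[OF Y] act_isom[OF g] in auto)
  then show ?thesis by (auto simp: common_fixed_def)
qed

text \<open>The products of consecutive \<open>b k\<close> are the entries for which commutators of the \<open>y s t\<close> are again of this form, with no
extra exponents. Height \<open>t - s\<close> adds up under commutators, so the \<open>y s t\<close> can be added in order of decreasing
height, and each one preserves the common fixed set of its predecessors.\<close>

lemma chain_fixed_point:
  fixes v :: "nat \<Rightarrow> nat" and b :: "nat \<Rightarrow> 'a"
  assumes ell: "\<And>i j r. \<lbrakk>i < n; j < n; i \<noteq> j; r \<in> R\<rbrakk> \<Longrightarrow>
      elmat n i j (of_nat N * r) \<in> H \<and> (\<exists>x\<in>X. \<phi> (elmat n i j (of_nat N * r)) x = x)"
    and v: "\<And>s. s < n \<Longrightarrow> v s < n" "inj_on v {..<n}"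
    and b: "\<And>s. s < n \<Longrightarrow> \<exists>r\<in>R. b s = of_nat N * r" and ne: "X \<noteq> {}"
  shows "\<exists>x\<in>X. \<forall>s. Suc s < n \<longrightarrow> \<phi> (elmat n (v s) (v (Suc s)) (b s)) x = x"
proof -
  define y where "y s t = elmat n (v s) (v t) (\<Prod>k\<in>{s..<t}. b k)" for s t
  have vneq: "v s \<noteq> v t" if "s < n" "t < n" "s \<noteq> t" for s t using v(2) that by (auto simp: inj_on_def)
  have bR: "b s \<in> R" if "s < n" for s using b[OF that] by auto
  have y: "y s t \<in> H \<and> (\<exists>x\<in>X. \<phi> (y s t) x = x)" if st: "s < t" "t < n" for s t
  proof -
    obtain r where r: "r \<in> R" "b s = of_nat N * r" using b[of s] st by auto
    have "(\<Prod>k\<in>{s..<t}. b k) = of_nat N * (r * (\<Prod>k\<in>{Suc s..<t}. b k))"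
      using st(1) r by (simp add: prod.atLeast_Suc_lessThan mult.assoc)
    moreover have "(\<Prod>k\<in>{Suc s..<t}. b k) \<in> R" using bR st by (intro R_prod) auto
    ultimately show ?thesis unfolding y_def
      using ell[of "v s" "v t" "r * (\<Prod>k\<in>{Suc s..<t}. b k)"] v(1) vneq[of s t] r st by simp
  qed
  have y_prod: "y s u = elmat n (v s) (v u) ((\<Prod>k\<in>{s..<t}. b k) * (\<Prod>k\<in>{t..<u}. b k))" if "s < t" "t < u" for s t u
    using that by (simp add: y_def prod.atLeastLessThan_concat)
  have steinberg: "y s t * y t u = y t u * (y s u * y s t)" if "s < t" "t < u" "u < n" for s t u
    unfolding y_prod[OF that(1,2)] unfolding y_def
    using that v(1) vneq by (intro elmat_steinberg) auto
  have comm: "y s t * y s' t' = y s' t' * y s t" if "s < t" "t < n" "s' < t'" "t' < n" "t \<noteq> s'" "t' \<noteq> s" for s t s' t'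
    unfolding y_def using that vneq by (intro elmat_commute) auto
  (* all y s t of height more than h, and the first m of height h *)
  define Y where "Y h m = {y s t | s t. s < t \<and> t < n \<and> (t - s > h \<or> t - s = h \<and> s < m)}" for h m
  have YH: "Y h m \<subseteq> H" for h m using y by (auto simp: Y_def)
  have step: "common_fixed (Y h (Suc m)) \<noteq> {}" if ne: "common_fixed (Y h m) \<noteq> {}" and h: "h > 0" for h m
  proof (cases "m + h < n")
    case False
    then have "Y h (Suc m) = Y h m" unfolding Y_def
      by (intro Collect_cong ex_cong1) (use h in \<open>auto simp: less_Suc_eq\<close>)
    then show ?thesis using ne by simp
  next
    case True
    let ?g = "y m (m + h)"
    have g: "?g \<in> H" using y[of m "m + h"] True h by auto
    obtain z where z: "z \<in> X" "\<phi> ?g z = z" using y[of m "m + h"] True h by auto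
    have "common_fixed (insert ?g (Y h m)) \<noteq> {}"
    proof (rule common_fixed_insert_nonempty[OF YH g ne z])
      fix x f assume x: "x \<in> common_fixed (Y h m)" and "f \<in> Y h m"
      then obtain s t where f: "f = y s t" and st: "s < t" "t < n" "t - s > h \<or> t - s = h \<and> s < m"
        by (auto simp: Y_def)
      have xX: "x \<in> X" and fixx: "\<And>s t. s < t \<Longrightarrow> t < n \<Longrightarrow> t - s > h \<or> t - s = h \<and> s < m \<Longrightarrow> \<phi> (y s t) x = x"
        using x by (auto simp: common_fixed_def Y_def)
      have yst: "y s t \<in> H" using y st by auto
      have gx: "\<phi> ?g x \<in> X" using act_in[OF g xX] .
      consider "t = m" | "s = m + h" | "t \<noteq> m" "s \<noteq> m + h" by blast
      then show "\<phi> f (\<phi> ?g x) = \<phi> ?g x"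
      proof cases
        case 1
        have w: "y s (m + h) \<in> H" using y[of s "m + h"] st 1 True by auto
        have "\<phi> (y s t) (\<phi> ?g x) = \<phi> (y s t * ?g) x" using act_mult[OF yst g xX] by simp
        also have "y s t * ?g = ?g * (y s (m + h) * y s t)" using steinberg[of s m "m + h"] 1 st True h by simp
        also have "\<phi> \<dots> x = \<phi> ?g (\<phi> (y s (m + h)) (\<phi> (y s t) x))"
          using act_mult w yst g xX H_mult by simp
        also have "\<dots> = \<phi> ?g x" 
        proof -
          have "m + h - s > h" "s < m + h" using st 1 by linarith+
          then have "\<phi> (y s (m + h)) x = x" using fixx True by blast
          then show ?thesis using fixx[OF st] by simp
        qed
        finally show ?thesis unfolding f .
      next
        case 2
        have w: "y m t \<in> H" using y[of m t] st 2 h by auto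
        have wx: "\<phi> (y m t) x = x" using fixx[of m t] st 2 by auto
        have "\<phi> (y m t) (\<phi> ?g x) = \<phi> (y m t * ?g) x" using act_mult[OF w g xX] by simp
        also have "y m t * ?g = ?g * y m t" using comm[of m t m "m + h"] st 2 h True by auto
        also have "\<phi> \<dots> x = \<phi> ?g x" using act_mult[OF g w xX] wx by simp
        finally have wg: "\<phi> (y m t) (\<phi> ?g x) = \<phi> ?g x" .
        have "\<phi> (y s t) (\<phi> ?g x) = \<phi> (y s t) (\<phi> (y m t) (\<phi> ?g x))" using wg by simp
        also have "\<dots> = \<phi> (y s t * (y m t * ?g)) x" using act_mult w yst g xX H_mult by simp
        also have "y s t * (y m t * ?g) = ?g * y s t" using steinberg[of m "m + h" t] 2 st h by simp
        also have "\<phi> \<dots> x = \<phi> ?g x" using act_mult[OF g yst xX] fixx[OF st] by simp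
        finally show ?thesis unfolding f .
      next
        case 3
        have "\<phi> (y s t) (\<phi> ?g x) = \<phi> (y s t * ?g) x" using act_mult[OF yst g xX] by simp
        also have "y s t * ?g = ?g * y s t" using comm[of s t m "m + h"] st 3 h True by auto
        also have "\<phi> \<dots> x = \<phi> ?g x" using act_mult[OF g yst xX] fixx[OF st] by simp
        finally show ?thesis unfolding f .
      qed
    qed
    moreover have "Y h (Suc m) \<subseteq> insert ?g (Y h m)"
    proof
      fix f assume "f \<in> Y h (Suc m)"
      then obtain s t where f: "f = y s t" and st: "s < t" "t < n" "t - s > h \<or> t - s = h \<and> s < Suc m"
        by (auto simp: Y_def)
      show "f \<in> insert ?g (Y h m)"
      proof (cases "t - s = h \<and> s = m")
        case True
        then have "t = m + h" using st(1) by auto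
        then show ?thesis using f True by simp
      next
        case False
        then have "t - s > h \<or> t - s = h \<and> s < m" using st(3) by auto
        then show ?thesis unfolding f Y_def using st(1,2) by blast
      qed
    qed
    ultimately show ?thesis by (auto simp: common_fixed_def)
  qed
  have inner: "common_fixed (Y h m) \<noteq> {}" if "common_fixed (Y h 0) \<noteq> {}" "h > 0" for h m
    by (induction m) (use that step in auto)
  have "common_fixed (Y (n - k) 0) \<noteq> {}" if "k < n" for k
    using that
  proof (induction k)
    case 0
    have "Y n 0 = {}" by (auto simp: Y_def)
    then show ?case using ne by (simp add: common_fixed_def)
  next
    case (Suc k)
    have "Y (n - Suc k) 0 \<subseteq> Y (n - k) n" unfolding Y_def using Suc.prems by force
    moreover have "common_fixed (Y (n - k) n) \<noteq> {}" by (rule inner) (use Suc in auto)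
    ultimately show ?case unfolding common_fixed_def by blast
  qed
  from this[of "n - 1"] have "common_fixed (Y 1 0) \<noteq> {}" using n3 by simp
  then have "common_fixed (Y 1 n) \<noteq> {}" by (rule inner) simp
  then obtain x where x: "x \<in> common_fixed (Y 1 n)" by blast
  have "\<phi> (elmat n (v s) (v (Suc s)) (b s)) x = x" if "Suc s < n" for s
  proof -
    have "y s (Suc s) \<in> Y 1 n" unfolding Y_def using that by force
    moreover have "y s (Suc s) = elmat n (v s) (v (Suc s)) (b s)" by (simp add: y_def)
    ultimately show ?thesis using x by (auto simp: common_fixed_def)
  qed
  then show ?thesis using x by (auto simp: common_fixed_def)
qed

lemma fixed_point:
  assumes fin: "finite (rcosets\<^bsub>G\<^esub> H)" 
    and dim: "\<And>Y. openin mtopology Y \<Longrightarrow>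
                trivial_group (reduced_homology_group (int (n - 2)) (subtopology mtopology Y))"
  shows "\<exists>x\<in>X. \<forall>g\<in>H. \<phi> g x = x"
proof -
  have neX: "X \<noteq> {}" using semisimple[OF H_one] by auto
  obtain N0 where N0: "N0 > 0" "coprime N0 p" "\<And>i j r. \<lbrakk>i < n; j < n; i \<noteq> j; r \<in> R\<rbrakk> \<Longrightarrow> elmat n i j (of_nat N0 * r) \<in> H"
    using elementary_in_finite_index[OF H fin] by blast
  define N where "N = N0\<^sup>2"
  have N: "N > 0" "coprime N p" using N0 by (simp_all add: N_def)
  have ell: "elmat n i j (of_nat N * r) \<in> H \<and> (\<exists>x\<in>X. \<phi> (elmat n i j (of_nat N * r)) x = x)"
    if "i < n" "j < n" "i \<noteq> j" "r \<in> R" for i j r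
  proof
    show "\<exists>x\<in>X. \<phi> (elmat n i j (of_nat N * r)) x = x" unfolding N_def by (rule elementary_elliptic[OF N0(3) that])
    show "elmat n i j (of_nat N * r) \<in> H"
      using N0(3)[OF that(1-3), of "of_nat N0 * r"] that(4) by (simp add: N_def power2_eq_square mult.assoc)
  qed
  define c where "c i = (if i = n - 1 then of_nat N * ip else of_nat N)" for i
  have c: "\<exists>r\<in>R. c i = of_nat N * r" for i
    unfolding c_def by (cases "i = n - 1") (auto intro: bexI[of _ ip] bexI[of _ 1])
  define e where "e i = elmat n i (Suc i mod n) (c i)" for i
  have Si: "Suc i mod n < n" "Suc i mod n \<noteq> i" if "i < n" for i
    using that n3 by (auto simp: mod_Suc)
  have eH: "e i \<in> H" if "i < n" for i
  proof -
    obtain r where "r \<in> R" "c i = of_nat N * r" using c by blast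
    then show ?thesis using ell[of i "Suc i mod n" r] Si[OF that] that by (auto simp: e_def)
  qed
  have "(\<Inter>i\<in>{..<n}. fixed_points (\<phi> (e i))) \<noteq> {}"
  proof (rule helly[OF complete dim])
    show "card {..<n} = n - 2 + 2" using n3 by simp
    show "geo_convex (fixed_points (\<phi> (e i)))" "closedin mtopology (fixed_points (\<phi> (e i)))" if "i \<in> {..<n}" for i
      using act_isom[OF eH] that by (auto intro: geo_convex_fixed_points closedin_fixed_points)
    fix i assume i: "i \<in> {..<n}"
    (* cut the cycle between i and its successor *)
    define v where "v s = (Suc i + s) mod n" for s
    have "\<exists>x\<in>X. \<forall>s. Suc s < n \<longrightarrow> \<phi> (elmat n (v s) (v (Suc s)) (c (v s))) x = x"
    proof (rule chain_fixed_point[OF ell])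
      show "v s < n" for s using n3 by (simp add: v_def)
      show "inj_on v {..<n}"
      proof (rule inj_onI)
        fix s t assume "s \<in> {..<n}" "t \<in> {..<n}" "v s = v t"
        then show "s = t" using cong_add_lcancel_nat[of "Suc i" s t n] by (auto simp: v_def cong_def)
      qed
    qed (use c neX in auto)
    then obtain x where x: "x \<in> X" "\<And>s. Suc s < n \<Longrightarrow> \<phi> (elmat n (v s) (v (Suc s)) (c (v s))) x = x" by blast
    have "x \<in> fixed_points (\<phi> (e j))" if j: "j \<in> {..<n} - {i}" for j
    proof -
      define s where "s = (j + n - Suc i) mod n"
      have sn: "s < n" using n3 by (simp add: s_def)
      have "v s = (Suc i + (j + n - Suc i)) mod n" unfolding v_def s_def by (rule mod_add_right_eq)
      also have "Suc i + (j + n - Suc i) = j + n" using i by simp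
      finally have vs: "v s = j" using j by simp
      have "Suc s \<noteq> n"
      proof
        assume "Suc s = n"
        then have "Suc i + s = i + n" by simp
        then have "v s = (i + n) mod n" by (simp only: v_def)
        then show False using vs i j by simp
      qed
      then have "Suc s < n" using sn by simp
      moreover have "v (Suc s) = Suc j mod n" using vs by (simp add: v_def mod_Suc_eq flip: vs)
      ultimately show ?thesis using x(1) x(2)[of s] vs by (simp add: fixed_points_def e_def)
    qed
    then show "\<exists>p\<in>X. \<forall>j\<in>{..<n} - {i}. p \<in> fixed_points (\<phi> (e j))" using x(1) by blast
  qed simp_all
  then obtain x0 where x0: "\<And>i. i < n \<Longrightarrow> x0 \<in> fixed_points (\<phi> (e i))" by blast
  have x0X: "x0 \<in> X" using x0[of 0] n3 by (auto simp: fixed_points_def)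
  define M where "M = {g \<in> H. \<phi> g x0 = x0}"
  have M: "subgroup M G"
  proof (rule G.subgroupI)
    show "M \<subseteq> carrier G" using H_G by (auto simp: M_def)
    show "M \<noteq> {}" using H_one act_one[OF x0X] by (auto simp: M_def)
    fix a assume a: "a \<in> M"
    then have aH: "a \<in> H" "\<phi> a x0 = x0" by (auto simp: M_def)
    have "\<phi> (ginv a) x0 = \<phi> (ginv a) (\<phi> a x0)" using aH by simp
    also have "\<dots> = x0" using act_mult[OF H_inv[OF aH(1)] aH(1) x0X] inv_l[OF aH(1)] act_one[OF x0X] by simp
    finally show "ginv a \<in> M" using H_inv[OF aH(1)] by (simp add: M_def)
    fix b assume "b \<in> M"
    then show "a \<otimes>\<^bsub>G\<^esub> b \<in> M" using aH act_mult H_mult x0X by (simp add: M_def)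
  qed
  have "elmat n i (Suc i mod n) (if i = n - 1 then of_nat N * ip else of_nat N) \<in> M" if "i < n" for i
    using eH[OF that] x0[OF that] by (simp add: M_def e_def c_def fixed_points_def)
  then obtain L where L: "L \<lhd> G" "L \<subseteq> M" "finite (rcosets\<^bsub>G\<^esub> L)"
    using exists_normal_finite_index[OF M N(2,1)] by blast
  interpret L: normal L G by (rule L(1))
  define F where "F = (\<lambda>h. \<phi> h x0) ` H"
  have "finite F" unfolding F_def
  proof (rule finite_image_if_key)
    show "finite ((\<lambda>h. L #>\<^bsub>G\<^esub> h) ` H)"
      by (rule finite_subset[OF _ L(3)]) (use H_G in \<open>auto simp: RCOSETS_def\<close>)
    fix h h' assume h: "h \<in> H" "h' \<in> H" "L #>\<^bsub>G\<^esub> h = L #>\<^bsub>G\<^esub> h'"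
    have "h' \<in> L #>\<^bsub>G\<^esub> h'" using h H_G L.subgroup_axioms by (intro G.rcos_self) auto
    then have "h' \<in> h <#\<^bsub>G\<^esub> L" using h(3) L.coset_eq H_G[OF h(1)] by simp
    then obtain l where l: "l \<in> L" "h' = h * l" by (auto simp: l_coset_def)
    then have "l \<in> H" "\<phi> l x0 = x0" using L(2) by (auto simp: M_def)
    then show "\<phi> h x0 = \<phi> h' x0" using l act_mult[OF h(1) _ x0X] by simp
  qed
  have "\<exists>x\<in>X. \<forall>g\<in>\<phi> ` H. g x = x"
  proof (rule fixed_point_invariant_set[OF complete \<open>finite F\<close> _ _ neX geo_convex_M])
    show "F \<noteq> {}" using H_one by (auto simp: F_def)
    show "F \<subseteq> X" using act_in x0X by (auto simp: F_def)
    show "closedin mtopology X" using closedin_topspace[of mtopology] by simp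
    fix g assume "g \<in> \<phi> ` H"
    then obtain h where h: "h \<in> H" "g = \<phi> h" by blast
    show "isometric_map g" "g ` X \<subseteq> X" using h act_isom act_in by auto
    show "g ` F \<subseteq> F"
    proof
      fix y assume "y \<in> g ` F"
      then obtain k where "k \<in> H" "y = \<phi> h (\<phi> k x0)" using h by (auto simp: F_def)
      then show "y \<in> F" using act_mult[OF h(1) _ x0X] H_mult[OF h(1)] by (auto simp: F_def intro!: image_eqI[of _ _ "h * k"])
    qed
  qed
  then show ?thesis by blast
qed

end

lemma (in sl_ring) strong_FA_finite_index:
  assumes "finite_index_subgroup H (SL n R)"
  shows "strong_FA TYPE('x) (n - 2) ((SL n R)\<lparr>carrier := H\<rparr>)"
  unfolding strong_FA_def
proof (intro allI impI, elim conjE)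
  fix X :: "'x metric" and \<phi>
  let ?\<Gamma> = "(SL n R)\<lparr>carrier := H\<rparr>"
  assume compl: "mcomplete_of X" and cat: "CAT0_space X" and act: "isometric_action ?\<Gamma> X \<phi>"
    and dim: "m_dimensional (n - 2) X" and ss: "semisimple_action ?\<Gamma> X \<phi>"
  have H: "subgroup H G" and fin: "finite (rcosets\<^bsub>G\<^esub> H)" using assms by (auto simp: finite_index_subgroup_def)
  obtain geo where geo: "cat0 (mspace X) (mdist X) geo" using CAT0_space_imp_cat0[OF cat] by blast
  interpret C: cat0 "mspace X" "mdist X" geo by (rule geo)
  interpret A: group_action ?\<Gamma> "mspace X" \<phi> using act by (simp add: isometric_action_def)
  have "sl_action R p ip n (mspace X) (mdist X) geo H \<phi>"
  proof (intro sl_action.intro sl_ring_axioms geo sl_action_axioms.intro H)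
    show "C.mcomplete" using compl by (simp add: mcomplete_of_def)
    show "\<phi> (g * h) x = \<phi> g (\<phi> h x)" if "g \<in> H" "h \<in> H" "x \<in> mspace X" for g h x
      using A.composition_rule[of x g h] that by simp
    show "\<phi> (1\<^sub>m n) x = x" if "x \<in> mspace X" for x
    proof -
      have "\<phi> (1\<^sub>m n) = (\<lambda>x\<in>mspace X. x)" using A.id_eq_one by simp
      then show ?thesis using that by simp
    qed
    fix g assume g: "g \<in> H"
    show "C.isometric_map (\<phi> g)" using act g A.element_image[of g] by (auto simp: C.isometric_map_def isometric_action_def)
    obtain x where x: "x \<in> mspace X" "mdist X x (\<phi> g x) = translation_length X (\<phi> g)"
      using ss g by (auto simp: semisimple_action_def)
    have "translation_length X (\<phi> g) \<le> mdist X y (\<phi> g y)" if "y \<in> mspace X" for y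
      unfolding translation_length_def by (rule cINF_lower[OF bdd_belowI2[of _ 0] that]) simp
    then show "\<exists>x\<in>mspace X. \<forall>y\<in>mspace X. mdist X x (\<phi> g x) \<le> mdist X y (\<phi> g y)"
      using x by (intro bexI[of _ x]) auto
  qed
  then interpret sl_action R p ip n "mspace X" "mdist X" geo H \<phi> .
  have "\<exists>x\<in>mspace X. \<forall>g\<in>H. \<phi> g x = x"
    using fixed_point[OF fin] dim by (simp add: m_dimensional_def mtopology_of_def)
  then show "\<exists>x\<in>mspace X. \<forall>g\<in>carrier ?\<Gamma>. \<phi> g x = x" by simp
qed

theorem corollary1p2:
  fixes n p :: nat
  assumes "n \<ge> 3" and "Factorial_Ring.prime p"
  shows "(\<forall>H. finite_index_subgroup H (SL n (UNIV :: int set)) \<longrightarrow>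
            strong_FA TYPE('x) (n - 2) ((SL n (UNIV :: int set))\<lparr>carrier := H\<rparr>)) \<and>
         (\<forall>H. finite_index_subgroup H (SL n (Z_inverse p)) \<longrightarrow>
            strong_FA TYPE('x) (n - 2) ((SL n (Z_inverse p))\<lparr>carrier := H\<rparr>))"
proof -
  interpret Z: sl_ring "UNIV :: int set" 1 1 n
    by unfold_locales (use assms in auto)
  interpret Zp: sl_ring "Z_inverse p" p "1 / of_nat p" n
  proof
    show "of_nat p * (1 / of_nat p :: rat) = 1" using prime_gt_0_nat[OF assms(2)] by simp
    show "Z_inverse p = {of_int a * (1 / of_nat p) ^ k | a k. True}"
      by (simp add: Z_inverse_def power_one_over divide_inverse power_inverse)
  qed fact
  show ?thesis using Z.strong_FA_finite_index Zp.strong_FA_finite_index by blast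
qed

end
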